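(* Let $(g,f)$ be a homogeneous pair of degree $\alpha\in\mathbb{R}-\{0\}$ on a manifold $M$ with a free $\mathbb{R}_{>0}$-action. Assume that $g$ is positive definite and that the pseudometric $d_g$ induced from $g$ is a metric. Let $l>0$, $M_l=f^{-1}(l)$, $g_l$ the pullback of $g$ to $M_l$, and let $\overline{M_l}$ be the metric completion of $M_l$ with respect to the metric induced from $g_l$. Let $v:\mathbb{R}_{>0}\to\mathbb{R}_{>0}$ be a smooth function, fix $R_0>0$, set $\hat T(r)=\int_{R_0}^r\sqrt{\frac{v(q)}{q}}\,dq$ and $$\hat T_0=\lim_{r\to0}\hat T(r)\in\mathbb{R}\cup\{-\infty\},\qquad\hat T_\infty=\lim_{r\to\infty}\hat T(r)\in\mathbb{R}\cup\{\infty\}.$$ Then the metric completion $\overline M$ of $M$ with respect to the metric $d_{(v\circ f)g}$ induced from the Riemannian metric $(v\circ f)g$ is homeomorphic to the following. (1) If $\hat T_0=-\infty$ and $\hat T_\infty=\infty$: $\ \mathbb{R}_{>0}\times\overline{M_l}$ with the product topology. (2) If $\hat T_0\in\mathbb{R}$, $\hat T_\infty=\infty$ and $\lim_{r\to0}rv(r)=0$: $\ (\{0\}\cup\mathbb{R}_{>0})\times\overline{M_l}/(\{0\}\times\overline{M_l})=(\mathbb{R}_{>0}\times\overline{M_l})\cup\{*\}$ with the topology $\mathcal{O}_0$. (3) If $\hat T_0=-\infty$, $\hat T_\infty\in\mathbb{R}$ and $\lim_{r\to\infty}rv(r)=0$: $\ (\mathbb{R}_{>0}\cup\{\infty\})\times\overline{M_l}/(\{\infty\}\times\overline{M_l})=(\mathbb{R}_{>0}\times\overline{M_l})\cup\{*\}$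 with the topology $\mathcal{O}_\infty$. (4) If $\hat T_0\in\mathbb{R}$, $\hat T_\infty\in\mathbb{R}$, $\lim_{r\to0}rv(r)=0$ and $\lim_{r\to\infty}rv(r)=0$: $\ (\mathbb{R}_{>0}\times\overline{M_l})\cup\{*\}\cup\{*\}$, i.e. $(\{0\}\cup\mathbb{R}_{>0}\cup\{\infty\})\times\overline{M_l}$ with $\{0\}\times\overline{M_l}$ collapsed to one point and $\{\infty\}\times\overline{M_l}$ collapsed to another point, with the topology $\mathcal{O}_{0,\infty}$.
   Context: Homogeneous pair: $m:\mathbb{R}_{>0}\times M\to M$ is a smooth free action, $m_\lambda=m(\lambda,\cdot)$, $P_x=\frac{d}{dt}m(e^t,x)|_{t=0}$. For a pseudo-Riemannian metric $g$, a smooth $f:M\to\mathbb{R}_{>0}$ and $\alpha\in\mathbb{R}-\{0\}$, $(g,f)$ is a homogeneous pair of degree $\alpha$ if $m_\lambda^*g=\lambda^\alpha g$, $m_\lambda^*f=\lambda^\alpha f$ for all $\lambda>0$ and $g(P,\cdot)=df$. The pseudometric induced from a Riemannian metric is the infimum of lengths of piecewise smooth paths. The metric completion of a metric space is the set of Cauchy sequences modulo $\{z_k\}\sim\{z_k'\}\Leftrightarrow\lim d(z_k,z_k')=0$, with the induced metric. Topologies. Let $\pi_0:(\{0\}\cup\mathbb{R}_{>0})\times\overline{M_l}\to(\{0\}\cup\mathbb{R}_{>0})\times\overline{M_l}/(\{0\}\times\overline{M_l})$ be the projection and $*_0=\pi_0(\{0\}\times\overline{M_l})$. $\mathcal{O}_0$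 is defined by the fundamental systems of neighborhoods $\mathcal{U}(x)$: if $x\neq*_0$, $\mathcal{U}(x)$ consists of the $\epsilon$-balls ($\epsilon>0$) centered at $x$ with respect to the product metric on $\mathbb{R}_{>0}\times\overline{M_l}$; and $\mathcal{U}( *_0)=\{\pi_0([0,\epsilon)\times\overline{M_l})\mid\epsilon>0\}$. Similarly let $\pi_\infty:(\mathbb{R}_{>0}\cup\{\infty\})\times\overline{M_l}\to(\mathbb{R}_{>0}\cup\{\infty\})\times\overline{M_l}/(\{\infty\}\times\overline{M_l})$ be the projection and $*_\infty=\pi_\infty(\{\infty\}\times\overline{M_l})$; $\mathcal{O}_\infty$ is defined by $\epsilon$-balls of the product metric at $x\ne*_\infty$ and $\mathcal{U}( *_\infty)=\{\pi_\infty((R,\infty]\times\overline{M_l})\mid R>0\}$. $\mathcal{O}_{0,\infty}$ is defined in the same way: let $\pi_{0,\infty}$ be the projection from $(\{0\}\cup\mathbb{R}_{>0}\cup\{\infty\})\times\overline{M_l}$ to the space obtained by collapsing $\{0\}\times\overline{M_l}$ to one point and $\{\infty\}\times\overline{M_l}$ to another point; one uses product-metric $\epsilon$-balls away from the two added points, the fundamental system of neighborhoods $\{\pi_{0,\infty}([0,\epsilon)\times\overline{M_l})\mid\epsilon>0\}$ at the added point $\pi_{0,\infty}(\{0\}\times\overline{M_l})$, and the fundamental system of neighborhoods $\{\pi_{0,\infty}((R,\infty]\times\overline{M_l})\mid R>0\}$ at the added point $\pi_{0,\infty}(\{\infty\}\times\overline{M_l})$. *)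

theory Defs
  imports "HOL-Analysis.Analysis"
begin

section \<open>Smooth maps between subsets of Euclidean spaces\<close>

text \<open>\<open>C\<^sup>k\<close> functions on an open set: the derivative in every fixed direction is \<open>C\<^sup>k\<^sup>-\<^sup>1\<close>.\<close>

primrec Ck_on ::
  "nat \<Rightarrow> 'e::euclidean_space set \<Rightarrow> ('e \<Rightarrow> 'b::real_normed_vector) \<Rightarrow> bool" where
  "Ck_on 0 U F \<longleftrightarrow> continuous_on U F"
| "Ck_on (Suc k) U F \<longleftrightarrow>
     (\<forall>x\<in>U. F differentiable (at x)) \<and>
     (\<forall>v. Ck_on k U (\<lambda>x. frechet_derivative F (at x) v))"

text \<open>On an arbitrary set, smooth means: locally extendable to a \<open>C\<^sup>\<infinity>\<close> function on an open set.
  This covers open sets, compact intervals and relatively open subsets of linear subspaces.\<close>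

definition smooth_on :: "'e::euclidean_space set \<Rightarrow> ('e \<Rightarrow> 'b::real_normed_vector) \<Rightarrow> bool" where
  "smooth_on S F \<longleftrightarrow>
     (\<forall>x\<in>S. \<exists>U G. open U \<and> x \<in> U \<and> (\<forall>k. Ck_on k U G) \<and> (\<forall>y\<in>U \<inter> S. G y = F y))"


section \<open>Manifolds\<close>

text \<open>A chart is a pair \<open>(U, \<phi>)\<close>; only the values of \<open>\<phi>\<close> on \<open>U\<close> matter.\<close>

record ('a, 'e) atlas_space =
  mtop :: "'a topology"
  charts :: "('a set \<times> ('a \<Rightarrow> 'e)) set"

abbreviation points :: "('a, 'e) atlas_space \<Rightarrow> 'a set" where
  "points M \<equiv> topspace (mtop M)"

definition is_chart :: "'a topology \<Rightarrow> 'a set \<times> ('a \<Rightarrow> 'e::euclidean_space) \<Rightarrow> bool" where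
  "is_chart X = (\<lambda>(U, \<phi>). openin X U \<and> open (\<phi> ` U) \<and>
     homeomorphic_map (subtopology X U) (top_of_set (\<phi> ` U)) \<phi>)"

definition compatible ::
  "'a set \<times> ('a \<Rightarrow> 'e::euclidean_space) \<Rightarrow> 'a set \<times> ('a \<Rightarrow> 'e) \<Rightarrow> bool" where
  "compatible = (\<lambda>(U, \<phi>) (W, \<psi>).
     smooth_on (\<phi> ` (U \<inter> W)) (\<psi> \<circ> inv_into U \<phi>) \<and>
     smooth_on (\<psi> ` (U \<inter> W)) (\<phi> \<circ> inv_into W \<psi>))"

definition smooth_manifold :: "('a, 'e::euclidean_space) atlas_space \<Rightarrow> bool" where
  "smooth_manifold M \<longleftrightarrow>
     points M \<noteq> {} \<and> Hausdorff_space (mtop M) \<and> second_countable (mtop M) \<and>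
     (\<Union>c\<in>charts M. fst c) = points M \<and>
     (\<forall>c\<in>charts M. is_chart (mtop M) c) \<and>
     (\<forall>c\<in>charts M. \<forall>d\<in>charts M. compatible c d)"

definition max_atlas :: "('a, 'e::euclidean_space) atlas_space \<Rightarrow> ('a set \<times> ('a \<Rightarrow> 'e)) set" where
  "max_atlas M = {c. is_chart (mtop M) c \<and> (\<forall>d\<in>charts M. compatible c d)}"

definition smooth_map ::
  "('a, 'e::euclidean_space) atlas_space \<Rightarrow> ('b, 'f::euclidean_space) atlas_space \<Rightarrow>
   ('a \<Rightarrow> 'b) \<Rightarrow> bool" where
  "smooth_map M N F \<longleftrightarrow> continuous_map (mtop M) (mtop N) F \<and>
     (\<forall>(U, \<phi>)\<in>charts M. \<forall>(W, \<psi>)\<in>charts N.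
        smooth_on (\<phi> ` {x \<in> U. F x \<in> W}) (\<psi> \<circ> F \<circ> inv_into U \<phi>))"

text \<open>A subset of the line (used for \<open>\<real>\<close>, \<open>\<real>\<^sub>>\<^sub>0\<close> and compact intervals) with its global coordinate.\<close>

definition real_space :: "real set \<Rightarrow> (real, real) atlas_space" where
  "real_space S = \<lparr>mtop = top_of_set S, charts = {(S, \<lambda>t. t)}\<rparr>"

definition prod_space ::
  "('a, 'e::euclidean_space) atlas_space \<Rightarrow> ('b, 'f::euclidean_space) atlas_space \<Rightarrow>
   ('a \<times> 'b, 'e \<times> 'f) atlas_space" where
  "prod_space M N = \<lparr>mtop = prod_topology (mtop M) (mtop N),
     charts = {(U \<times> W, map_prod \<phi> \<psi>) | U \<phi> W \<psi>. (U, \<phi>) \<in> charts M \<and> (W, \<psi>) \<in> charts N}\<rparr>"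

text \<open>An embedded hypersurface \<open>S \<subseteq> M\<close> with its induced structure: its charts are the restrictions
  of the slice charts, i.e. of the charts \<open>(U, \<phi>)\<close> of the maximal atlas of \<open>M\<close> for which
  \<open>\<phi>(U \<inter> S)\<close> is the intersection of \<open>\<phi>(U)\<close> with a linear hyperplane \<open>V\<close>.  So the charts of
  a hypersurface take values in a hyperplane of \<open>'e\<close>
  (which also covers zero-dimensional hypersurfaces).\<close>

definition hypersurface ::
  "('a, 'e::euclidean_space) atlas_space \<Rightarrow> 'a set \<Rightarrow> ('a, 'e) atlas_space" where
  "hypersurface M S = \<lparr>mtop = subtopology (mtop M) S,
     charts = {(U \<inter> S, \<phi>) | U \<phi>. (U, \<phi>) \<in> max_atlas M \<and>
       (\<exists>V. subspace V \<and> Suc (dim V) = DIM('e) \<and> \<phi> ` (U \<inter> S) = \<phi> ` U \<inter> V)}\<rparr>"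


section \<open>Tangent vectors and metrics\<close>

definition smooth_funs :: "('a, 'e::euclidean_space) atlas_space \<Rightarrow> ('a \<Rightarrow> real) set" where
  "smooth_funs M = {h. smooth_map M (real_space UNIV) h}"

text \<open>A tangent vector at \<open>x\<close> is a derivation at \<open>x\<close> of the algebra of smooth functions.
  Derivations are normalised to be \<open>0\<close> on non-smooth functions, so that two of them
  are equal iff they agree on smooth functions.\<close>

definition tangent_space ::
  "('a, 'e::euclidean_space) atlas_space \<Rightarrow> 'a \<Rightarrow> (('a \<Rightarrow> real) \<Rightarrow> real) set" where
  "tangent_space M x = {v.
     (\<forall>h. h \<notin> smooth_funs M \<longrightarrow> v h = 0) \<and>
     (\<forall>h\<in>smooth_funs M. \<forall>k\<in>smooth_funs M. \<forall>a b. v (\<lambda>y. a * h y + b * k y) = a * v h + b * v k) \<and>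
     (\<forall>h\<in>smooth_funs M. \<forall>k\<in>smooth_funs M. v (\<lambda>y. h y * k y) = h x * v k + k x * v h)}"

definition coord_vector ::
  "('a, 'e::euclidean_space) atlas_space \<Rightarrow> 'a set \<times> ('a \<Rightarrow> 'e) \<Rightarrow> 'a \<Rightarrow> 'e \<Rightarrow>
   ('a \<Rightarrow> real) \<Rightarrow> real" where
  "coord_vector M = (\<lambda>(U, \<phi>) x e h. if h \<in> smooth_funs M
     then frechet_derivative (h \<circ> inv_into U \<phi>) (at (\<phi> x)) e else 0)"

definition velocity ::
  "('a, 'e::euclidean_space) atlas_space \<Rightarrow> (real \<Rightarrow> 'a) \<Rightarrow> real \<Rightarrow> ('a \<Rightarrow> real) \<Rightarrow> real" where
  "velocity M c t h = (if h \<in> smooth_funs M then deriv (\<lambda>s. h (c s)) t else 0)"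

definition pushforward ::
  "('b, 'f::euclidean_space) atlas_space \<Rightarrow> ('a \<Rightarrow> 'b) \<Rightarrow> (('a \<Rightarrow> real) \<Rightarrow> real) \<Rightarrow>
   ('b \<Rightarrow> real) \<Rightarrow> real" where
  "pushforward N F v h = (if h \<in> smooth_funs N then v (h \<circ> F) else 0)"

type_synonym 'a tensor2 =
  "'a \<Rightarrow> (('a \<Rightarrow> real) \<Rightarrow> real) \<Rightarrow> (('a \<Rightarrow> real) \<Rightarrow> real) \<Rightarrow> real"

definition pullback ::
  "('b, 'f::euclidean_space) atlas_space \<Rightarrow> ('a \<Rightarrow> 'b) \<Rightarrow> 'b tensor2 \<Rightarrow> 'a tensor2" where
  "pullback N F g x v w = g (F x) (pushforward N F v) (pushforward N F w)"

definition pseudo_riemannian :: "('a, 'e::euclidean_space) atlas_space \<Rightarrow> 'a tensor2 \<Rightarrow> bool" where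
  "pseudo_riemannian M g \<longleftrightarrow>
     (\<forall>x\<in>points M.
        (\<forall>u\<in>tangent_space M x. \<forall>v\<in>tangent_space M x. g x u v = g x v u) \<and>
        (\<forall>u\<in>tangent_space M x. \<forall>v\<in>tangent_space M x. \<forall>w\<in>tangent_space M x. \<forall>a b.
           g x (\<lambda>h. a * u h + b * v h) w = a * g x u w + b * g x v w) \<and>
        (\<forall>u\<in>tangent_space M x. (\<forall>v\<in>tangent_space M x. g x u v = 0) \<longrightarrow> u = (\<lambda>h. 0))) \<and>
     (\<forall>(U, \<phi>)\<in>charts M. \<forall>e e'. smooth_on (\<phi> ` U)
        (\<lambda>p. let x = inv_into U \<phi> p
             in g x (coord_vector M (U, \<phi>) x e) (coord_vector M (U, \<phi>) x e')))"

definition positive_definite :: "('a, 'e::euclidean_space) atlas_space \<Rightarrow> 'a tensor2 \<Rightarrow> bool" where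
  "positive_definite M g \<longleftrightarrow>
     (\<forall>x\<in>points M. \<forall>v\<in>tangent_space M x. v \<noteq> (\<lambda>h. 0) \<longrightarrow> g x v v > 0)"

definition conformal :: "(real \<Rightarrow> real) \<Rightarrow> ('a \<Rightarrow> real) \<Rightarrow> 'a tensor2 \<Rightarrow> 'a tensor2" where
  "conformal v f g x u w = v (f x) * g x u w"

definition piecewise_smooth_path ::
  "('a, 'e::euclidean_space) atlas_space \<Rightarrow> real \<Rightarrow> real \<Rightarrow> (real \<Rightarrow> 'a) \<Rightarrow> bool" where
  "piecewise_smooth_path M a b c \<longleftrightarrow> a < b \<and>
     continuous_map (top_of_set {a..b}) (mtop M) c \<and>
     (\<exists>D. finite D \<and> {a, b} \<subseteq> D \<and> D \<subseteq> {a..b} \<and>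
        (\<forall>s\<in>D. \<forall>t\<in>D. s < t \<and> {s<..<t} \<inter> D = {} \<longrightarrow> smooth_map (real_space {s..t}) M c))"

definition path_length ::
  "('a, 'e::euclidean_space) atlas_space \<Rightarrow> 'a tensor2 \<Rightarrow> real \<Rightarrow> real \<Rightarrow> (real \<Rightarrow> 'a) \<Rightarrow> real" where
  "path_length M g a b c = integral {a..b} (\<lambda>t. sqrt (g (c t) (velocity M c t) (velocity M c t)))"

text \<open>The induced pseudometric, with value \<open>\<infinity>\<close> on pairs of points not joined by a path.\<close>

definition path_dist ::
  "('a, 'e::euclidean_space) atlas_space \<Rightarrow> 'a tensor2 \<Rightarrow> 'a \<Rightarrow> 'a \<Rightarrow> ennreal" where
  "path_dist M g x y =
     (INF (a, b, c)\<in>{(a, b, c). piecewise_smooth_path M a b c \<and> c a = x \<and> c b = y}.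
        ennreal (path_length M g a b c))"

definition path_dist_is_metric ::
  "('a, 'e::euclidean_space) atlas_space \<Rightarrow> 'a tensor2 \<Rightarrow> bool" where
  "path_dist_is_metric M g \<longleftrightarrow>
     (\<forall>x\<in>points M. \<forall>y\<in>points M. path_dist M g x y \<noteq> \<infinity>) \<and>
     Metric_space (points M) (\<lambda>x y. enn2real (path_dist M g x y))"

definition path_metric ::
  "('a, 'e::euclidean_space) atlas_space \<Rightarrow> 'a tensor2 \<Rightarrow> 'a metric" where
  "path_metric M g = metric (points M, \<lambda>x y. enn2real (path_dist M g x y))"


section \<open>Actions and homogeneous pairs\<close>

definition free_smooth_action ::
  "('a, 'e::euclidean_space) atlas_space \<Rightarrow> (real \<Rightarrow> 'a \<Rightarrow> 'a) \<Rightarrow> bool" where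
  "free_smooth_action M m \<longleftrightarrow>
     smooth_map (prod_space (real_space {0<..}) M) M (\<lambda>(t, x). m t x) \<and>
     (\<forall>x\<in>points M. m 1 x = x) \<and>
     (\<forall>s>0. \<forall>t>0. \<forall>x\<in>points M. m (s * t) x = m s (m t x)) \<and>
     (\<forall>t>0. \<forall>x\<in>points M. m t x = x \<longrightarrow> t = 1)"

definition action_field ::
  "('a, 'e::euclidean_space) atlas_space \<Rightarrow> (real \<Rightarrow> 'a \<Rightarrow> 'a) \<Rightarrow> 'a \<Rightarrow> ('a \<Rightarrow> real) \<Rightarrow> real" where
  "action_field M m x = velocity M (\<lambda>t. m (exp t) x) 0"

text \<open>In the last conjunct, \<open>v f\<close> is \<open>df(v)\<close>, as \<open>v\<close> is a derivation.\<close>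

definition homogeneous_pair ::
  "('a, 'e::euclidean_space) atlas_space \<Rightarrow> (real \<Rightarrow> 'a \<Rightarrow> 'a) \<Rightarrow> 'a tensor2 \<Rightarrow> ('a \<Rightarrow> real) \<Rightarrow>
   real \<Rightarrow> bool" where
  "homogeneous_pair M m g f \<alpha> \<longleftrightarrow> \<alpha> \<noteq> 0 \<and>
     pseudo_riemannian M g \<and>
     f \<in> smooth_funs M \<and> (\<forall>x\<in>points M. f x > 0) \<and>
     (\<forall>s>0. \<forall>x\<in>points M. \<forall>v\<in>tangent_space M x. \<forall>w\<in>tangent_space M x.
        pullback M (m s) g x v w = s powr \<alpha> * g x v w) \<and>
     (\<forall>s>0. \<forall>x\<in>points M. f (m s x) = s powr \<alpha> * f x) \<and>
     (\<forall>x\<in>points M. \<forall>v\<in>tangent_space M x. g x (action_field M m x) v = v f)"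

definition level_set :: "('a, 'e::euclidean_space) atlas_space \<Rightarrow> ('a \<Rightarrow> real) \<Rightarrow> real \<Rightarrow>
   ('a, 'e) atlas_space" where
  "level_set M f l = hypersurface M {x \<in> points M. f x = l}"

definition level_metric :: "('a, 'e::euclidean_space) atlas_space \<Rightarrow> 'a tensor2 \<Rightarrow> 'a tensor2" where
  "level_metric M g = pullback M (\<lambda>x. x) g"


section \<open>Metric completion\<close>

definition Cauchy_seqs :: "'a metric \<Rightarrow> (nat \<Rightarrow> 'a) set" where
  "Cauchy_seqs X = {z. Metric_space.MCauchy (mspace X) (mdist X) z}"

definition Cauchy_rel :: "'a metric \<Rightarrow> ((nat \<Rightarrow> 'a) \<times> (nat \<Rightarrow> 'a)) set" where
  "Cauchy_rel X = {(z, z'). z \<in> Cauchy_seqs X \<and> z' \<in> Cauchy_seqs X \<and>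
     (\<lambda>k. mdist X (z k) (z' k)) \<longlonglongrightarrow> 0}"

definition completion_dist :: "'a metric \<Rightarrow> (nat \<Rightarrow> 'a) set \<Rightarrow> (nat \<Rightarrow> 'a) set \<Rightarrow> real" where
  "completion_dist X A B =
     (if A \<in> Cauchy_seqs X // Cauchy_rel X \<and> B \<in> Cauchy_seqs X // Cauchy_rel X
      then THE c. \<forall>z\<in>A. \<forall>z'\<in>B. (\<lambda>k. mdist X (z k) (z' k)) \<longlonglongrightarrow> c
      else 0)"

definition metric_completion :: "'a metric \<Rightarrow> (nat \<Rightarrow> 'a) set metric" where
  "metric_completion X = metric (Cauchy_seqs X // Cauchy_rel X, completion_dist X)"


lemma Cauchy_seqs_dist_convergent:
  assumes "z \<in> Cauchy_seqs X" "w \<in> Cauchy_seqs X"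
  shows "convergent (\<lambda>k. mdist X (z k) (w k))"
proof -
  interpret X: Metric_space "mspace X" "mdist X" by simp
  have mem: "z k \<in> mspace X" "w k \<in> mspace X" for k
    using assms by (auto simp: Cauchy_seqs_def X.MCauchy_def)
  have "Cauchy (\<lambda>k. mdist X (z k) (w k))"
  proof (rule metric_CauchyI)
    fix e :: real assume "e > 0"
    then obtain N1 N2
      where N1: "\<And>i j. i \<ge> N1 \<Longrightarrow> j \<ge> N1 \<Longrightarrow> mdist X (z i) (z j) < e/2"
        and N2: "\<And>i j. i \<ge> N2 \<Longrightarrow> j \<ge> N2 \<Longrightarrow> mdist X (w i) (w j) < e/2"
      using assms unfolding Cauchy_seqs_def X.MCauchy_def mem_Collect_eq by (meson half_gt_zero)
    have "dist (mdist X (z i) (w i)) (mdist X (z j) (w j)) < e"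
      if "i \<ge> max N1 N2" "j \<ge> max N1 N2" for i j
    proof -
      have "mdist X (z i) (w i) \<le> mdist X (z i) (z j) + mdist X (z j) (w j) + mdist X (w j) (w i)"
        "mdist X (z j) (w j) \<le> mdist X (z j) (z i) + mdist X (z i) (w i) + mdist X (w i) (w j)"
        using X.triangle[OF mem(1)[of i] mem(1)[of j] mem(2)[of i]]
          X.triangle[OF mem(1)[of j] mem(2)[of j] mem(2)[of i]]
          X.triangle[OF mem(1)[of j] mem(1)[of i] mem(2)[of j]]
          X.triangle[OF mem(1)[of i] mem(2)[of i] mem(2)[of j]] by linarith+
      moreover have "mdist X (z i) (z j) < e/2" "mdist X (w i) (w j) < e/2"
        using N1 N2 that by auto
      ultimately show ?thesis
        using X.commute[of "z i" "z j"] X.commute[of "w i" "w j"] by (simp add: dist_real_def)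
    qed
    then show "\<exists>K. \<forall>i\<ge>K. \<forall>j\<ge>K. dist (mdist X (z i) (w i)) (mdist X (z j) (w j)) < e" by blast
  qed
  then show ?thesis by (simp add: Cauchy_convergent_iff)
qed

lemma equiv_Cauchy_rel: "equiv (Cauchy_seqs X) (Cauchy_rel X)"
proof (rule equivI)
  interpret X: Metric_space "mspace X" "mdist X" by simp
  have mem: "z k \<in> mspace X" if "z \<in> Cauchy_seqs X" for z k
    using that by (auto simp: Cauchy_seqs_def X.MCauchy_def)
  show "Cauchy_rel X \<subseteq> Cauchy_seqs X \<times> Cauchy_seqs X"
    by (auto simp: Cauchy_rel_def)
  show "refl_on (Cauchy_seqs X) (Cauchy_rel X)"
    using mem by (auto simp: refl_on_def Cauchy_rel_def)
  show "sym (Cauchy_rel X)"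
    by (auto simp: sym_def Cauchy_rel_def X.commute)
  show "trans (Cauchy_rel X)"
  proof (rule transI)
    fix x y z assume *: "(x, y) \<in> Cauchy_rel X" "(y, z) \<in> Cauchy_rel X"
    then have C: "x \<in> Cauchy_seqs X" "y \<in> Cauchy_seqs X" "z \<in> Cauchy_seqs X"
      and lim: "(\<lambda>k. mdist X (x k) (y k) + mdist X (y k) (z k)) \<longlonglongrightarrow> 0"
      using tendsto_add[of _ "0::real" sequentially _ 0] by (auto simp: Cauchy_rel_def)
    have "(\<lambda>k. mdist X (x k) (z k)) \<longlonglongrightarrow> 0"
      by (rule tendsto_sandwich[OF _ _ tendsto_const lim])
         (use X.triangle[OF mem[OF C(1)] mem[OF C(2)] mem[OF C(3)]] in simp_all)
    then show "(x, z) \<in> Cauchy_rel X" using C by (simp add: Cauchy_rel_def)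
  qed
qed

lemma completion_dist_tendsto:
  assumes A: "A \<in> Cauchy_seqs X // Cauchy_rel X" "z \<in> A"
    and B: "B \<in> Cauchy_seqs X // Cauchy_rel X" "w \<in> B"
  shows "(\<lambda>k. mdist X (z k) (w k)) \<longlonglongrightarrow> completion_dist X A B"
proof -
  interpret X: Metric_space "mspace X" "mdist X" by simp
  have rel: "(x, y) \<in> Cauchy_rel X" if "C \<in> Cauchy_seqs X // Cauchy_rel X" "x \<in> C" "y \<in> C" for C x y
    using quotient_eq_iff[OF equiv_Cauchy_rel that(1) that(1) that(2) that(3)] by simp
  have seqs: "x \<in> Cauchy_seqs X" if "C \<in> Cauchy_seqs X // Cauchy_rel X" "x \<in> C" for C x
    using rel[OF that(1,2,2)] by (simp add: Cauchy_rel_def)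
  have mem: "x k \<in> mspace X" if "x \<in> Cauchy_seqs X" for x k
    using that by (auto simp: Cauchy_seqs_def X.MCauchy_def)
  obtain c where c: "(\<lambda>k. mdist X (z k) (w k)) \<longlonglongrightarrow> c"
    using Cauchy_seqs_dist_convergent[OF seqs[OF A] seqs[OF B]] unfolding convergent_def by blast
  have all: "(\<lambda>k. mdist X (z' k) (w' k)) \<longlonglongrightarrow> c" if "z' \<in> A" "w' \<in> B" for z' w'
  proof -
    have z: "(\<lambda>k. mdist X (z k) (z' k)) \<longlonglongrightarrow> 0" and w: "(\<lambda>k. mdist X (w k) (w' k)) \<longlonglongrightarrow> 0"
      using rel[OF A that(1)] rel[OF B that(2)] by (simp_all add: Cauchy_rel_def)
    have m: "z k \<in> mspace X" "z' k \<in> mspace X" "w k \<in> mspace X" "w' k \<in> mspace X" for k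
      using mem[OF seqs[OF A]] mem[OF seqs[OF A(1) that(1)]] mem[OF seqs[OF B]] mem[OF seqs[OF B(1) that(2)]]
      by simp_all
    have "(\<lambda>k. mdist X (z' k) (w' k) - mdist X (z k) (w k)) \<longlonglongrightarrow> 0"
    proof (rule tendsto_rabs_zero_cancel, rule tendsto_sandwich[OF _ _ tendsto_const])
      show "(\<lambda>k. mdist X (z k) (z' k) + mdist X (w k) (w' k)) \<longlonglongrightarrow> 0"
        using tendsto_add[OF z w] by simp
      have "\<bar>mdist X (z' k) (w' k) - mdist X (z k) (w k)\<bar> \<le> mdist X (z k) (z' k) + mdist X (w k) (w' k)"
        for k
        using X.triangle[OF m(1)[of k] m(2)[of k] m(3)[of k]] X.triangle[OF m(2)[of k] m(4)[of k] m(3)[of k]]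
          X.triangle[OF m(2)[of k] m(1)[of k] m(4)[of k]] X.triangle[OF m(1)[of k] m(3)[of k] m(4)[of k]]
          X.commute[of "z k" "z' k"] X.commute[of "w k" "w' k"] by linarith
      then show "\<forall>\<^sub>F k in sequentially. \<bar>mdist X (z' k) (w' k) - mdist X (z k) (w k)\<bar>
          \<le> mdist X (z k) (z' k) + mdist X (w k) (w' k)" by simp
    qed simp
    from tendsto_add[OF this c] show ?thesis by simp
  qed
  have "(THE c. \<forall>z\<in>A. \<forall>w\<in>B. (\<lambda>k. mdist X (z k) (w k)) \<longlonglongrightarrow> c) = c"
  proof (rule the_equality)
    show "\<forall>z\<in>A. \<forall>w\<in>B. (\<lambda>k. mdist X (z k) (w k)) \<longlonglongrightarrow> c" using all by blast
    show "c' = c" if "\<forall>z\<in>A. \<forall>w\<in>B. (\<lambda>k. mdist X (z k) (w k)) \<longlonglongrightarrow> c'" for c'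
      using that A(2) B(2) c LIMSEQ_unique by blast
  qed
  then show ?thesis using c A B by (simp add: completion_dist_def)
qed

lemma Metric_space_completion:
  "Metric_space (Cauchy_seqs X // Cauchy_rel X) (completion_dist X)"
proof
  interpret X: Metric_space "mspace X" "mdist X" by simp
  let ?Q = "Cauchy_seqs X // Cauchy_rel X"
  have ex: "\<exists>z. z \<in> A" if "A \<in> ?Q" for A
    using in_quotient_imp_non_empty[OF equiv_Cauchy_rel that] by blast
  have seqs: "A \<subseteq> Cauchy_seqs X" if "A \<in> ?Q" for A
    using in_quotient_imp_subset[OF equiv_Cauchy_rel that] .
  have mem: "x k \<in> mspace X" if "A \<in> ?Q" "x \<in> A" for A x k
    using seqs[OF that(1)] that(2) by (auto simp: Cauchy_seqs_def X.MCauchy_def)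
  show "0 \<le> completion_dist X A B" for A B
  proof (cases "A \<in> ?Q \<and> B \<in> ?Q")
    case True
    then obtain z w where zw: "z \<in> A" "w \<in> B" using ex[of A] ex[of B] by blast
    with True show ?thesis
      using LIMSEQ_le_const[OF completion_dist_tendsto[of A X z B w], of 0] zw by simp
  qed (auto simp: completion_dist_def)
  show "completion_dist X A B = completion_dist X B A" for A B
  proof (cases "A \<in> ?Q \<and> B \<in> ?Q")
    case True
    then obtain z w where zw: "z \<in> A" "w \<in> B" using ex[of A] ex[of B] by blast
    then show ?thesis
      using LIMSEQ_unique[OF completion_dist_tendsto[of A X z B w]]
        completion_dist_tendsto[of B X w A z] True
      by (simp add: X.commute[of "w _"])
  qed (auto simp: completion_dist_def)
  show "completion_dist X A B = 0 \<longleftrightarrow> A = B" if AB: "A \<in> ?Q" "B \<in> ?Q" for A B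
  proof -
    obtain z w where zw: "z \<in> A" "w \<in> B" using ex[OF AB(1)] ex[OF AB(2)] by blast
    have "completion_dist X A B = 0 \<longleftrightarrow> (\<lambda>k. mdist X (z k) (w k)) \<longlonglongrightarrow> 0"
      using completion_dist_tendsto[OF that(1) zw(1) that(2) zw(2)] LIMSEQ_unique[of "\<lambda>k. mdist X (z k) (w k)"] by metis
    also have "\<dots> \<longleftrightarrow> (z, w) \<in> Cauchy_rel X"
      using seqs[OF AB(1)] seqs[OF AB(2)] zw by (auto simp: Cauchy_rel_def)
    also have "\<dots> \<longleftrightarrow> A = B"
      using quotient_eq_iff[OF equiv_Cauchy_rel AB zw] by simp
    finally show ?thesis .
  qed
  show "completion_dist X A C \<le> completion_dist X A B + completion_dist X B C"
    if ABC: "A \<in> ?Q" "B \<in> ?Q" "C \<in> ?Q" for A B C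
  proof -
    obtain z w u where *: "z \<in> A" "w \<in> B" "u \<in> C"
      using ex[OF ABC(1)] ex[OF ABC(2)] ex[OF ABC(3)] by blast
    show ?thesis
    proof (rule LIMSEQ_le)
      show "(\<lambda>k. mdist X (z k) (u k)) \<longlonglongrightarrow> completion_dist X A C"
        by (rule completion_dist_tendsto[OF ABC(1) *(1) ABC(3) *(3)])
      show "(\<lambda>k. mdist X (z k) (w k) + mdist X (w k) (u k)) \<longlonglongrightarrow> completion_dist X A B + completion_dist X B C"
        by (intro tendsto_add completion_dist_tendsto ABC *)
      show "\<exists>N. \<forall>k\<ge>N. mdist X (z k) (u k) \<le> mdist X (z k) (w k) + mdist X (w k) (u k)"
        using X.triangle[OF mem[OF ABC(1) *(1)] mem[OF ABC(2) *(2)] mem[OF ABC(3) *(3)]] by simp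
    qed
  qed
qed

lemma mspace_metric_completion [simp]:
    "mspace (metric_completion X) = Cauchy_seqs X // Cauchy_rel X"
  and mdist_metric_completion [simp]: "mdist (metric_completion X) = completion_dist X"
  by (simp_all add: metric_completion_def Metric_space.mspace_metric Metric_space.mdist_metric
      Metric_space_completion)


section \<open>The topologies on the collapsed products\<close>

text \<open>The factors \<open>\<real>\<^sub>>\<^sub>0\<close>, \<open>{0} \<union> \<real>\<^sub>>\<^sub>0\<close>, \<open>\<real>\<^sub>>\<^sub>0 \<union> {\<infinity>}\<close> and \<open>{0} \<union> \<real>\<^sub>>\<^sub>0 \<union> {\<infinity>}\<close> are the sets
  \<open>E\<close> of extended reals \<open>{0<..<\<infinity>}\<close>, \<open>{0..<\<infinity>}\<close>, \<open>{0<..\<infinity>}\<close> and \<open>{0..\<infinity>}\<close>.  The projection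
  sends a point of \<open>E \<times> Y\<close> to its class, which is \<open>{0} \<times> Y\<close>, \<open>{\<infinity>} \<times> Y\<close> or a singleton.\<close>

definition collapse :: "'b set \<Rightarrow> ereal \<times> 'b \<Rightarrow> (ereal \<times> 'b) set" where
  "collapse Y p = (if fst p = 0 \<or> fst p = \<infinity> then {fst p} \<times> Y else {p})"

definition collapsed :: "ereal set \<Rightarrow> 'b set \<Rightarrow> (ereal \<times> 'b) set set" where
  "collapsed E Y = collapse Y ` (E \<times> Y)"

inductive basic_nhd ::
  "ereal set \<Rightarrow> 'b metric \<Rightarrow> (ereal \<times> 'b) set \<Rightarrow> (ereal \<times> 'b) set set \<Rightarrow> bool"
  for E :: "ereal set" and N :: "'b metric" where
  ball: "\<lbrakk>r > 0; y \<in> mspace N; \<epsilon> > 0\<rbrakk> \<Longrightarrow>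
    basic_nhd E N (collapse (mspace N) (ereal r, y))
      ((\<lambda>(s, z). collapse (mspace N) (ereal s, z)) `
        mball_of (prod_metric (submetric euclidean_metric {0<..}) N) (r, y) \<epsilon>)"
| zero: "\<lbrakk>0 \<in> E; \<epsilon> > 0\<rbrakk> \<Longrightarrow>
    basic_nhd E N ({0} \<times> mspace N) (collapse (mspace N) ` ({0..<ereal \<epsilon>} \<times> mspace N))"
| infinity: "\<lbrakk>\<infinity> \<in> E; R > 0\<rbrakk> \<Longrightarrow>
    basic_nhd E N ({\<infinity>} \<times> mspace N) (collapse (mspace N) ` ({ereal R<..\<infinity>} \<times> mspace N))"

definition collapsed_topology :: "ereal set \<Rightarrow> 'b metric \<Rightarrow> (ereal \<times> 'b) set topology" where
  "collapsed_topology E N = topology (\<lambda>W. W \<subseteq> collapsed E (mspace N) \<and>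
     (\<forall>x\<in>W. \<exists>B. basic_nhd E N x B \<and> B \<subseteq> W))"

lemma basic_nhd_Int:
  assumes "basic_nhd E N x A" "basic_nhd E N x B" "x \<in> collapsed E (mspace N)"
  shows "\<exists>C. basic_nhd E N x C \<and> C \<subseteq> A \<inter> B"
proof -
  obtain p0 where p0: "p0 \<in> E \<times> mspace N" "x = collapse (mspace N) p0"
    using assms(3) by (auto simp: collapsed_def)
  have ne: "mspace N \<noteq> {}" using p0 by auto
  have sep: "collapse (mspace N) (ereal r, y) \<noteq> {0} \<times> mspace N"
    "collapse (mspace N) (ereal r, y) \<noteq> {\<infinity>} \<times> mspace N" if "r > 0" for r y
  proof -
    have "(ereal r, y) \<in> collapse (mspace N) (ereal r, y)"
      using that by (simp add: collapse_def)
    moreover have "(ereal r, y) \<notin> {0} \<times> mspace N" "(ereal r, y) \<notin> {\<infinity>} \<times> mspace N"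
      using that by auto
    ultimately show "collapse (mspace N) (ereal r, y) \<noteq> {0} \<times> mspace N"
      "collapse (mspace N) (ereal r, y) \<noteq> {\<infinity>} \<times> mspace N" by metis+
  qed
  have sep': "{0::ereal} \<times> mspace N \<noteq> {\<infinity>} \<times> mspace N"
  proof
    assume eq: "{0::ereal} \<times> mspace N = {\<infinity>} \<times> mspace N"
    obtain y where "y \<in> mspace N" using ne by blast
    then have "(0::ereal, y) \<in> {\<infinity>} \<times> mspace N" unfolding eq[symmetric] by simp
    then show False by simp
  qed
  have inj: "r = r' \<and> y = y'"
    if "collapse (mspace N) (ereal r, y) = collapse (mspace N) (ereal r', y')" "r > 0" "r' > 0"
    for r r' y y'
    using that by (auto simp: collapse_def)
  show ?thesis
    using assms(1)
  proof cases
    case a: (ball r y \<epsilon>)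
    from assms(2) show ?thesis
    proof cases
      case b: (ball r' y' \<epsilon>')
      have eq: "r' = r" "y' = y" using inj[of r' y' r y] a b by auto
      show ?thesis
      proof (intro exI conjI)
        show "basic_nhd E N x ((\<lambda>(s, z). collapse (mspace N) (ereal s, z)) `
          mball_of (prod_metric (submetric euclidean_metric {0<..}) N) (r, y) (min \<epsilon> \<epsilon>'))"
          unfolding a(1) by (rule basic_nhd.ball) (use a b in auto)
        show "(\<lambda>(s, z). collapse (mspace N) (ereal s, z)) `
          mball_of (prod_metric (submetric euclidean_metric {0<..}) N) (r, y) (min \<epsilon> \<epsilon>') \<subseteq> A \<inter> B"
          unfolding a(2) b(2) eq by (intro Int_greatest image_mono) auto
      qed
    qed (use a sep in auto)
  next
    case a: (zero \<epsilon>)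
    from assms(2) show ?thesis
    proof cases
      case b: (zero \<epsilon>')
      have "basic_nhd E N x (collapse (mspace N) ` ({0..<ereal (min \<epsilon> \<epsilon>')} \<times> mspace N))"
        unfolding a(1) by (rule basic_nhd.zero) (use a b in auto)
      moreover have "collapse (mspace N) ` ({0..<ereal (min \<epsilon> \<epsilon>')} \<times> mspace N) \<subseteq> A \<inter> B"
        unfolding a(2) b(2) by (intro Int_greatest image_mono) (auto elim: order.strict_trans2)
      ultimately show ?thesis by blast
    qed (use a sep sep[symmetric] sep' in auto)
  next
    case a: (infinity R)
    from assms(2) show ?thesis
    proof cases
      case b: (infinity R')
      have "basic_nhd E N x (collapse (mspace N) ` ({ereal (max R R')<..\<infinity>} \<times> mspace N))"
        unfolding a(1) by (rule basic_nhd.infinity) (use a b in auto)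
      moreover have "collapse (mspace N) ` ({ereal (max R R')<..\<infinity>} \<times> mspace N) \<subseteq> A \<inter> B"
        unfolding a(2) b(2) by (intro Int_greatest image_mono) (auto elim: order.strict_trans1[rotated])
      ultimately show ?thesis by blast
    qed (use a sep sep[symmetric] sep' in auto)
  qed
qed

lemma openin_collapsed_topology:
  "openin (collapsed_topology E N) W \<longleftrightarrow> W \<subseteq> collapsed E (mspace N) \<and>
     (\<forall>x\<in>W. \<exists>B. basic_nhd E N x B \<and> B \<subseteq> W)"
proof -
  have "istopology (\<lambda>W. W \<subseteq> collapsed E (mspace N) \<and> (\<forall>x\<in>W. \<exists>B. basic_nhd E N x B \<and> B \<subseteq> W))"
    unfolding istopology_def
  proof (intro conjI allI impI ballI)
    fix S T x
    assume S: "S \<subseteq> collapsed E (mspace N) \<and> (\<forall>x\<in>S. \<exists>B. basic_nhd E N x B \<and> B \<subseteq> S)"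
      and T: "T \<subseteq> collapsed E (mspace N) \<and> (\<forall>x\<in>T. \<exists>B. basic_nhd E N x B \<and> B \<subseteq> T)"
      and x: "x \<in> S \<inter> T"
    then obtain A B where "basic_nhd E N x A" "A \<subseteq> S" "basic_nhd E N x B" "B \<subseteq> T" by blast
    moreover have "x \<in> collapsed E (mspace N)" using S x by blast
    ultimately show "\<exists>B. basic_nhd E N x B \<and> B \<subseteq> S \<inter> T"
      using basic_nhd_Int[of E N x A B] by blast
  next
    fix \<K> x
    assume K: "\<forall>K\<in>\<K>. K \<subseteq> collapsed E (mspace N) \<and> (\<forall>x\<in>K. \<exists>B. basic_nhd E N x B \<and> B \<subseteq> K)"
      and "x \<in> \<Union>\<K>"
    then obtain K B where "K \<in> \<K>" "basic_nhd E N x B" "B \<subseteq> K" by blast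
    then show "\<exists>B. basic_nhd E N x B \<and> B \<subseteq> \<Union>\<K>" by blast
  qed auto
  then show ?thesis by (simp add: collapsed_topology_def)
qed

definition topology_O0 :: "'b metric \<Rightarrow> (ereal \<times> 'b) set topology" where
  "topology_O0 N = collapsed_topology {0..<\<infinity>} N"

definition topology_Oinf :: "'b metric \<Rightarrow> (ereal \<times> 'b) set topology" where
  "topology_Oinf N = collapsed_topology {0<..\<infinity>} N"

definition topology_O0inf :: "'b metric \<Rightarrow> (ereal \<times> 'b) set topology" where
  "topology_O0inf N = collapsed_topology {0..\<infinity>} N"


section \<open>The reparametrisation of the radius\<close>

definition That :: "(real \<Rightarrow> real) \<Rightarrow> real \<Rightarrow> real \<Rightarrow> real" where
  "That v R0 r = (LBINT q=ereal R0..ereal r. sqrt (v q / q))"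

definition That_zero :: "(real \<Rightarrow> real) \<Rightarrow> real \<Rightarrow> ereal" where
  "That_zero v R0 = Lim (at_right 0) (\<lambda>r. ereal (That v R0 r))"

definition That_infinity :: "(real \<Rightarrow> real) \<Rightarrow> real \<Rightarrow> ereal" where
  "That_infinity v R0 = Lim at_top (\<lambda>r. ereal (That v R0 r))"

end

theory Submission
  imports Defs
begin

text \<open>Write \<open>P\<close> for the field that generates the action. Homogeneity gives \<open>P f = \<alpha> f\<close>, and
  \<open>g(P, \<cdot>) = df\<close> gives \<open>g(P, P) = \<alpha> f\<close> and the orthogonality of \<open>P\<close> and \<open>ker df\<close>; in particular
  \<open>\<alpha> > 0\<close>. Every orbit meets the level set \<open>f = l\<close> exactly once, so \<open>r = f x\<close> and the projection of
  \<open>x\<close> along its orbit identify the manifold with \<open>\<real>\<^sub>>\<^sub>0 \<times> M\<^sub>l\<close>. As \<open>m\<^sub>s\<close> scales \<open>g\<close> by \<open>s\<close> to the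
  power \<open>\<alpha>\<close>, the metric \<open>g\<close> becomes the warped product \<open>dr\<^sup>2 / (\<alpha> r) + (r / l) g\<^sub>l\<close> (lemma
  \<open>speed_sq_split\<close>), and \<open>(v \<circ> f) g\<close> becomes \<open>dT\<^sup>2 + warp(r)\<^sup>2 g\<^sub>l\<close> with the radial arc length
  \<open>T = That / sqrt \<alpha>\<close> and the warping factor \<open>warp(r) = sqrt (r v(r) / l)\<close>.

  The distance \<open>d\<close> of a warped product has no closed formula, but four estimates suffice: \<open>d\<close> is at
  least the difference of the values of \<open>T\<close> (\<open>dist_radial\<close>); a path that stays in a shell
  \<open>r1 \<le> r \<le> r2\<close> projects to a path in \<open>M\<^sub>l\<close> whose length is at most the original one divided by the
  minimum of \<open>warp\<close> on the shell, while leaving the shell costs the radial distance to its boundary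
  (\<open>dist_shell\<close>); moving along an orbit costs the difference of the values of \<open>T\<close> (\<open>dist_orbit\<close>);
  and moving inside the slice at radius \<open>r\<close> costs at most \<open>warp(r)\<close> times the distance in \<open>M\<^sub>l\<close>
  (\<open>dist_level\<close>).

  The rest is a statement about metric spaces, \<open>warped_distance.homeomorphic_completion\<close>. The
  function \<open>T\<close> extends to the completion. A Cauchy sequence whose heights tend to a value \<open>T r\<close>
  eventually stays in a shell, so its projections form a Cauchy sequence in \<open>M\<^sub>l\<close>, and its limit has
  coordinates in \<open>\<real>\<^sub>>\<^sub>0\<close> and in the completion of \<open>M\<^sub>l\<close>. The only other possible heights are finite
  limits of \<open>T\<close> at 0 or at infinity. If \<open>r v(r)\<close> tends to 0 there, then so does \<open>warp\<close>, and
  travelling out to the end, across a slice and back shows that the distance of two points is at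
  most the sum of their radial distances from the end. So all sequences running to this end have the
  same limit, and the sets of points of nearby height form a fundamental system of neighbourhoods of
  it, as in the definition of the collapsed product.

  The differential geometry consists of what is needed to make sense of this for derivations,
  atlases and piecewise smooth paths: composition of smooth maps, slice charts for the level sets
  (without which the level set would have too few charts for its paths to be paths of the manifold),
  the integrability of the speed, and the product rule for \<open>m (\<mu> t) (c t)\<close>.\<close>


section \<open>Calculus of \<open>C\<^sup>k\<close> functions\<close>

lemma Ck_on_subset: "Ck_on k U F \<Longrightarrow> V \<subseteq> U \<Longrightarrow> Ck_on k V F"
  by (induction k arbitrary: F) (auto intro: continuous_on_subset)

lemma Ck_on_cong:
  assumes "open U" "\<And>x. x \<in> U \<Longrightarrow> F x = G x" "Ck_on k U F"
  shows "Ck_on k U G"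
  using assms(2,3)
proof (induction k arbitrary: F G)
  case 0
  then show ?case by (auto cong: continuous_on_cong)
next
  case (Suc k)
  have D: "(G has_derivative frechet_derivative F (at x)) (at x)" if "x \<in> U" for x
  proof (rule has_derivative_transform_within_open[OF _ \<open>open U\<close> that])
    show "(F has_derivative frechet_derivative F (at x)) (at x)"
      using Suc.prems(2) that by (simp add: frechet_derivative_works[symmetric])
  qed (rule Suc.prems(1))
  then have "frechet_derivative F (at x) = frechet_derivative G (at x)" if "x \<in> U" for x
    using frechet_derivative_at that by blast
  then have D': "frechet_derivative F (at x) v = frechet_derivative G (at x) v" if "x \<in> U" for x v
    using that by simp
  have "Ck_on k U (\<lambda>x. frechet_derivative G (at x) v)" for v
    by (rule Suc.IH[where F = "\<lambda>x. frechet_derivative F (at x) v"]) (use D' Suc.prems(2) in auto)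
  with D show ?case by (auto simp: differentiable_def)
qed

text \<open>The way to bound the order of differentiability below by induction: exhibit the derivative and
  show that it is one order smoother. It suffices to know the derivative on the open set \<open>U\<close>, where
  it agrees with the chosen one.\<close>

lemma Ck_on_SucI:
  assumes "open U" "\<And>x. x \<in> U \<Longrightarrow> (F has_derivative F' x) (at x)"
    and "\<And>v. Ck_on k U (\<lambda>x. F' x v)"
  shows "Ck_on (Suc k) U F"
proof -
  have "frechet_derivative F (at x) = F' x" if "x \<in> U" for x
    using frechet_derivative_at[OF assms(2)[OF that]] by simp
  then have "Ck_on k U (\<lambda>x. frechet_derivative F (at x) v)" for v
    by (intro Ck_on_cong[OF \<open>open U\<close> _ assms(3)[of v]]) auto
  with assms(2) show ?thesis by (auto simp: differentiable_def)
qed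

lemma Ck_on_Suc_derivative:
  assumes "Ck_on (Suc k) U F" "x \<in> U"
  shows "(F has_derivative frechet_derivative F (at x)) (at x)"
  using assms by (simp add: frechet_derivative_works[symmetric])

lemma Ck_on_continuous_on: "Ck_on k U F \<Longrightarrow> continuous_on U F"
  by (cases k) (simp_all add: continuous_at_imp_continuous_on differentiable_imp_continuous_within)

lemma Ck_on_SucD: "Ck_on (Suc k) U F \<Longrightarrow> Ck_on k U F"
proof (induction k arbitrary: F)
  case 0
  then show ?case using Ck_on_continuous_on[OF 0] by simp
qed auto

lemma Ck_on_const: "open U \<Longrightarrow> Ck_on k U (\<lambda>x. c)"
proof (induction k arbitrary: c)
  case (Suc k)
  then show ?case by (intro Ck_on_SucI[where F' = "\<lambda>x v. 0"]) auto
qed simp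

lemma Ck_on_linear:
  assumes "open U" "bounded_linear L"
  shows "Ck_on k U L"
proof (cases k)
  case 0
  then show ?thesis by (auto intro: linear_continuous_on assms)
next
  case (Suc n)
  show ?thesis unfolding Suc
    by (rule Ck_on_SucI[OF assms(1) bounded_linear_imp_has_derivative[OF assms(2)] Ck_on_const[OF assms(1)]])
qed

lemma Ck_on_compose_linear:
  assumes "open U" "bounded_linear L" "Ck_on k U F"
  shows "Ck_on k U (\<lambda>x. L (F x))"
  using assms(3)
proof (induction k arbitrary: F)
  case 0
  then show ?case using assms(2) by (auto intro: bounded_linear.continuous_on)
next
  case (Suc k)
  show ?case
    by (rule Ck_on_SucI[OF assms(1) bounded_linear.has_derivative[OF assms(2) Ck_on_Suc_derivative[OF Suc.prems]]])
       (use Suc in auto)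
qed

lemma Ck_on_add:
  assumes "open U" "Ck_on k U F" "Ck_on k U G"
  shows "Ck_on k U (\<lambda>x. F x + G x)"
  using assms(2,3)
proof (induction k arbitrary: F G)
  case 0
  then show ?case by (auto intro: continuous_on_add)
next
  case (Suc k)
  show ?case
    by (rule Ck_on_SucI[OF assms(1) has_derivative_add[OF Ck_on_Suc_derivative[OF Suc.prems(1)]
          Ck_on_Suc_derivative[OF Suc.prems(2)]]])
       (use Suc in auto)
qed

lemma Ck_on_sum:
  assumes "open U" "\<And>i. i \<in> I \<Longrightarrow> Ck_on k U (F i)"
  shows "Ck_on k U (\<lambda>x. \<Sum>i\<in>I. F i x)"
  using assms(2)
  by (induction I rule: infinite_finite_induct)
     (auto intro: Ck_on_add[OF assms(1)] Ck_on_const[OF assms(1)])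

lemma Ck_on_bilinear:
  assumes "open U" "bounded_bilinear B" "Ck_on k U F" "Ck_on k U G"
  shows "Ck_on k U (\<lambda>x. B (F x) (G x))"
  using assms(3,4)
proof (induction k arbitrary: F G)
  case 0
  then show ?case using bounded_bilinear.continuous_on[OF assms(2)] by auto
next
  case (Suc k)
  show ?case
  proof (rule Ck_on_SucI[OF assms(1) bounded_bilinear.FDERIV[OF assms(2) Ck_on_Suc_derivative[OF Suc.prems(1)]
          Ck_on_Suc_derivative[OF Suc.prems(2)]]])
    show "Ck_on k U (\<lambda>x. B (F x) (frechet_derivative G (at x) v) + B (frechet_derivative F (at x) v) (G x))" for v
      using Suc.prems Ck_on_SucD[OF Suc.prems(1)] Ck_on_SucD[OF Suc.prems(2)]
      by (intro Ck_on_add[OF assms(1)] Suc.IH) auto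
  qed
qed

lemmas Ck_on_mult = Ck_on_bilinear[OF _ bounded_bilinear_mult]
lemmas Ck_on_scaleR = Ck_on_bilinear[OF _ bounded_bilinear_scaleR]

text \<open>The chain rule is expanded in a basis, \<open>D(G \<circ> F)(x) v = (\<Sum>b. (DF(x) v \<bullet> b) *\<^sub>R DG(F x) b)\<close>,
  since smoothness is only assumed of the derivative in each fixed direction \<open>b\<close>.\<close>

lemma Ck_on_compose:
  fixes F :: "'e::euclidean_space \<Rightarrow> 'f::euclidean_space" and G :: "'f \<Rightarrow> 'b::real_normed_vector"
  assumes "open U" "F ` U \<subseteq> V" "Ck_on k U F" "Ck_on k V G"
  shows "Ck_on k U (\<lambda>x. G (F x))"
  using assms(3,4)
proof (induction k arbitrary: G)
  case 0
  then show ?case using continuous_on_compose2[of V G U F] assms(2) by auto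
next
  case (Suc k)
  note dF = Ck_on_Suc_derivative[OF Suc.prems(1)]
  have dG: "(G has_derivative frechet_derivative G (at (F x))) (at (F x))" if "x \<in> U" for x
    using Ck_on_Suc_derivative[OF Suc.prems(2)] that assms(2) by auto
  show ?case
  proof (rule Ck_on_SucI[OF assms(1)])
    show "((\<lambda>x. G (F x)) has_derivative
        (\<lambda>v. \<Sum>b\<in>Basis. (frechet_derivative F (at x) v \<bullet> b) *\<^sub>R frechet_derivative G (at (F x)) b)) (at x)"
      if "x \<in> U" for x
    proof -
      have eq: "frechet_derivative G (at (F x)) w = (\<Sum>b\<in>Basis. (w \<bullet> b) *\<^sub>R frechet_derivative G (at (F x)) b)" for w
      proof -
        have "linear (frechet_derivative G (at (F x)))"
          using has_derivative_linear[OF dG[OF that]] .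
        then have "frechet_derivative G (at (F x)) (\<Sum>b\<in>Basis. (w \<bullet> b) *\<^sub>R b)
            = (\<Sum>b\<in>Basis. (w \<bullet> b) *\<^sub>R frechet_derivative G (at (F x)) b)"
          by (simp add: linear_sum linear_scale)
        then show ?thesis by (simp add: euclidean_representation)
      qed
      show ?thesis
        by (rule has_derivative_eq_rhs[OF has_derivative_compose[OF dF[OF that] dG[OF that]]])
           (rule ext, rule eq)
    qed
    show "Ck_on k U (\<lambda>x. \<Sum>b\<in>Basis. (frechet_derivative F (at x) v \<bullet> b) *\<^sub>R frechet_derivative G (at (F x)) b)" for v
    proof (intro Ck_on_sum[OF assms(1)] Ck_on_scaleR[OF assms(1)])
      fix b :: 'f assume "b \<in> Basis"
      show "Ck_on k U (\<lambda>x. frechet_derivative F (at x) v \<bullet> b)"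
        by (rule Ck_on_compose_linear[OF assms(1) bounded_linear_inner_left]) (use Suc.prems in auto)
      show "Ck_on k U (\<lambda>x. frechet_derivative G (at (F x)) b)"
        by (rule Suc.IH[OF Ck_on_SucD[OF Suc.prems(1)]]) (use Suc.prems in auto)
    qed
  qed
qed

lemma Ck_on_Pair:
  assumes "open U" "Ck_on k U F" "Ck_on k U G"
  shows "Ck_on k U (\<lambda>x. (F x, G x))"
proof -
  have "Ck_on k U (\<lambda>x. (F x, 0) + (0, G x))"
    by (intro Ck_on_add[OF assms(1)] Ck_on_compose_linear[OF assms(1) _ assms(2), of "\<lambda>y. (y, 0)"]
        Ck_on_compose_linear[OF assms(1) _ assms(3), of "\<lambda>y. (0, y)"]
        bounded_linear_Pair bounded_linear_ident bounded_linear_zero)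
  then show ?thesis by simp
qed

text \<open>The factor \<open>c\<close> makes the statement closed under differentiation, so that the induction goes
  through.\<close>

lemma Ck_on_powr: "Ck_on k {0<..} (\<lambda>x::real. c * x powr \<beta>)"
proof (induction k arbitrary: c \<beta>)
  case 0
  then show ?case by (auto intro!: continuous_intros)
next
  case (Suc k)
  show ?case
  proof (rule Ck_on_SucI)
    show "((\<lambda>x. c * x powr \<beta>) has_derivative (\<lambda>v. (v * c * \<beta>) * x powr (\<beta> - 1))) (at x)"
      if "x \<in> {0<..}" for x
      using that by (auto intro!: derivative_eq_intros simp: field_simps powr_diff)
  qed (use Suc in auto)
qed

lemma Ck_on_divide:
  fixes F G :: "'e::euclidean_space \<Rightarrow> real"
  assumes "open U" "Ck_on k U F" "Ck_on k U G" "\<And>x. x \<in> U \<Longrightarrow> G x > 0"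
  shows "Ck_on k U (\<lambda>x. F x / G x)"
proof -
  have "Ck_on k U (\<lambda>x. F x * (1 * G x powr (-1)))"
    by (rule Ck_on_mult[OF assms(1,2) Ck_on_compose[OF assms(1) _ assms(3) Ck_on_powr]])
       (use assms(4) in auto)
  then show ?thesis
  proof (rule Ck_on_cong[OF assms(1), rotated])
    fix x assume "x \<in> U"
    with assms(4) have "G x > 0" .
    then show "F x * (1 * G x powr - 1) = F x / G x" by (simp add: powr_minus_divide)
  qed
qed


section \<open>Smooth maps on subsets of Euclidean spaces\<close>

lemma smooth_onI_open:
  assumes "open U" "\<And>k. Ck_on k U F"
  shows "smooth_on U F"
  using assms unfolding smooth_on_def by blast

lemma smooth_onE:
  assumes "smooth_on S F" "x \<in> S"
  obtains U G where "open U" "x \<in> U" "\<And>k. Ck_on k U G" "\<And>y. y \<in> U \<Longrightarrow> y \<in> S \<Longrightarrow> G y = F y"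
proof -
  from bspec[OF assms(1)[unfolded smooth_on_def] assms(2)] obtain U G
    where "open U" "x \<in> U" "\<forall>k. Ck_on k U G" "\<forall>y\<in>U \<inter> S. G y = F y" by (elim exE conjE)
  then show thesis by (intro that[of U G]) auto
qed

lemma smooth_onI:
  assumes "\<And>x. x \<in> S \<Longrightarrow> \<exists>U G. open U \<and> x \<in> U \<and> (\<forall>k. Ck_on k U G) \<and> (\<forall>y\<in>U. y \<in> S \<longrightarrow> G y = F y)"
  shows "smooth_on S F"
  unfolding smooth_on_def
proof
  fix x assume "x \<in> S"
  from assms[OF this] obtain U G
    where "open U" "x \<in> U" "\<forall>k. Ck_on k U G" "\<forall>y\<in>U. y \<in> S \<longrightarrow> G y = F y" by (elim exE conjE)
  then show "\<exists>U G. open U \<and> x \<in> U \<and> (\<forall>k. Ck_on k U G) \<and> (\<forall>y\<in>U \<inter> S. G y = F y)"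
    by (intro exI[of _ U] exI[of _ G]) auto
qed

lemma smooth_on_subset:
  assumes "smooth_on S F" "T \<subseteq> S"
  shows "smooth_on T F"
proof (rule smooth_onI)
  fix x assume "x \<in> T"
  with assms(2) have "x \<in> S" by blast
  from smooth_onE[OF assms(1) this] obtain U G
    where "open U" "x \<in> U" "\<And>k. Ck_on k U G" "\<And>y. y \<in> U \<Longrightarrow> y \<in> S \<Longrightarrow> G y = F y" by blast
  with assms(2) show "\<exists>U G. open U \<and> x \<in> U \<and> (\<forall>k. Ck_on k U G) \<and> (\<forall>y\<in>U. y \<in> T \<longrightarrow> G y = F y)"
    by (intro exI[of _ U] exI[of _ G]) auto
qed

lemma smooth_on_cong:
  assumes "smooth_on S F" "\<And>x. x \<in> S \<Longrightarrow> F x = G x"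
  shows "smooth_on S G"
proof (rule smooth_onI)
  fix x assume "x \<in> S"
  from smooth_onE[OF assms(1) this] obtain U H
    where "open U" "x \<in> U" "\<And>k. Ck_on k U H" "\<And>y. y \<in> U \<Longrightarrow> y \<in> S \<Longrightarrow> H y = F y" by blast
  with assms(2) show "\<exists>U H. open U \<and> x \<in> U \<and> (\<forall>k. Ck_on k U H) \<and> (\<forall>y\<in>U. y \<in> S \<longrightarrow> H y = G y)"
    by (intro exI[of _ U] exI[of _ H]) auto
qed

lemma smooth_on_locally:
  assumes "\<And>x. x \<in> S \<Longrightarrow> \<exists>U. open U \<and> x \<in> U \<and> smooth_on (S \<inter> U) F"
  shows "smooth_on S F"
proof (rule smooth_onI)
  fix x assume x: "x \<in> S"
  then obtain U where U: "open U" "x \<in> U" "smooth_on (S \<inter> U) F" using assms by blast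
  from smooth_onE[OF U(3), of x] obtain W G
    where W: "open W" "x \<in> W" "\<And>k. Ck_on k W G" "\<And>y. y \<in> W \<Longrightarrow> y \<in> S \<inter> U \<Longrightarrow> G y = F y"
    using x U(2) by blast
  have "Ck_on k (U \<inter> W) G" for k using Ck_on_subset[OF W(3)] by blast
  then show "\<exists>U G. open U \<and> x \<in> U \<and> (\<forall>k. Ck_on k U G) \<and> (\<forall>y\<in>U. y \<in> S \<longrightarrow> G y = F y)"
    using U W by (intro exI[of _ "U \<inter> W"] exI[of _ G]) auto
qed

lemma smooth_on_compose:
  fixes F :: "'e::euclidean_space \<Rightarrow> 'f::euclidean_space" and G :: "'f \<Rightarrow> 'b::real_normed_vector"
  assumes "smooth_on S F" "smooth_on T G" "F ` S \<subseteq> T"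
  shows "smooth_on S (\<lambda>x. G (F x))"
proof (rule smooth_onI)
  fix x assume x: "x \<in> S"
  obtain U F' where U: "open U" "x \<in> U" "\<And>k. Ck_on k U F'" "\<And>y. y \<in> U \<Longrightarrow> y \<in> S \<Longrightarrow> F' y = F y"
    using smooth_onE[OF assms(1) x] by blast
  obtain V G' where V: "open V" "F x \<in> V" "\<And>k. Ck_on k V G'" "\<And>y. y \<in> V \<Longrightarrow> y \<in> T \<Longrightarrow> G' y = G y"
    using smooth_onE[OF assms(2), of "F x"] assms(3) x by blast
  have "continuous_on U F'" by (rule Ck_on_continuous_on[OF U(3)])
  then have op: "open (U \<inter> F' -` V)"
    using U(1) V(1) continuous_open_preimage by blast
  have "Ck_on k (U \<inter> F' -` V) (\<lambda>y. G' (F' y))" for k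
    by (rule Ck_on_compose[OF op _ Ck_on_subset[OF U(3)] V(3)]) auto
  then show "\<exists>W H. open W \<and> x \<in> W \<and> (\<forall>k. Ck_on k W H) \<and> (\<forall>y\<in>W. y \<in> S \<longrightarrow> H y = G (F y))"
    using op U(2,4) V(2,4) x assms(3)
    by (intro exI[of _ "U \<inter> F' -` V"] exI[of _ "\<lambda>y. G' (F' y)"]) auto
qed

lemma smooth_on_Pair:
  assumes "smooth_on S F" "smooth_on S G"
  shows "smooth_on S (\<lambda>x. (F x, G x))"
proof (rule smooth_onI)
  fix x assume x: "x \<in> S"
  obtain U F' where U: "open U" "x \<in> U" "\<And>k. Ck_on k U F'" "\<And>y. y \<in> U \<Longrightarrow> y \<in> S \<Longrightarrow> F' y = F y"
    using smooth_onE[OF assms(1) x] by blast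
  obtain V G' where V: "open V" "x \<in> V" "\<And>k. Ck_on k V G'" "\<And>y. y \<in> V \<Longrightarrow> y \<in> S \<Longrightarrow> G' y = G y"
    using smooth_onE[OF assms(2) x] by blast
  have "Ck_on k (U \<inter> V) (\<lambda>x. (F' x, G' x))" for k
    by (rule Ck_on_Pair[OF open_Int[OF U(1) V(1)] Ck_on_subset[OF U(3)] Ck_on_subset[OF V(3)]]) auto
  then show "\<exists>W H. open W \<and> x \<in> W \<and> (\<forall>k. Ck_on k W H) \<and> (\<forall>y\<in>W. y \<in> S \<longrightarrow> H y = (F y, G y))"
    using U V by (intro exI[of _ "U \<inter> V"] exI[of _ "\<lambda>x. (F' x, G' x)"]) auto
qed

lemma smooth_on_linear: "bounded_linear L \<Longrightarrow> smooth_on S L"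
  using smooth_onI_open[OF open_UNIV Ck_on_linear[OF open_UNIV]] smooth_on_subset by blast

lemma smooth_on_const: "smooth_on S (\<lambda>x. c)"
  using smooth_onI_open[OF open_UNIV Ck_on_const[OF open_UNIV]] smooth_on_subset by blast

lemma smooth_on_continuous_on:
  assumes "smooth_on S F"
  shows "continuous_on S F"
proof (subst continuous_on_eq_continuous_within, intro ballI)
  fix x assume x: "x \<in> S"
  obtain U F' where U: "open U" "x \<in> U" "\<And>k. Ck_on k U F'" "\<And>y. y \<in> U \<Longrightarrow> y \<in> S \<Longrightarrow> F' y = F y"
    using smooth_onE[OF assms x] by blast
  have "continuous (at x within S) F'"
    using Ck_on_continuous_on[OF U(3)] U(1,2) continuous_on_eq_continuous_at continuous_at_imp_continuous_at_within by blast
  then show "continuous (at x within S) F"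
    by (rule continuous_transform_within_openin[of _ _ _ "S \<inter> U"]) (use U x in \<open>auto simp: openin_open\<close>)
qed

lemma smooth_on_differentiable:
  assumes "smooth_on S F" "open U" "x \<in> U" "U \<subseteq> S"
  shows "F differentiable (at x)"
proof -
  obtain W G where W: "open W" "x \<in> W" "\<And>k. Ck_on k W G" "\<And>y. y \<in> W \<Longrightarrow> y \<in> S \<Longrightarrow> G y = F y"
    using smooth_onE[OF assms(1), of x] assms by blast
  have "(G has_derivative frechet_derivative G (at x)) (at x)"
    by (rule Ck_on_Suc_derivative[OF W(3) W(2)])
  then have "(F has_derivative frechet_derivative G (at x)) (at x)"
    by (rule has_derivative_transform_within_open[of _ _ _ _ "W \<inter> U"]) (use W assms in auto)
  then show ?thesis by (auto simp: differentiable_def)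
qed

text \<open>On an open set the local extensions in the definition of smoothness must agree with the
  function itself, and being \<open>C\<^sup>k\<close> is a local property.\<close>

lemma smooth_on_open_Ck:
  assumes "smooth_on U F" "open U"
  shows "Ck_on k U F"
proof -
  have loc: "Ck_on k U F" if "\<forall>x\<in>U. \<exists>W. open W \<and> x \<in> W \<and> Ck_on k W F" for k
    and F :: "'a \<Rightarrow> 'b"
    using that
  proof (induction k arbitrary: F)
    case 0
    have "continuous (at x) F" if "x \<in> U" for x
      using 0 that Ck_on_continuous_on continuous_on_eq_continuous_at by blast
    then show ?case by (simp add: continuous_at_imp_continuous_on)
  next
    case (Suc k)
    have "F differentiable (at x)" if "x \<in> U" for x
      using Suc.prems that by auto
    moreover have "Ck_on k U (\<lambda>x. frechet_derivative F (at x) v)" for v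
    proof (intro Suc.IH ballI)
      fix x assume "x \<in> U"
      with Suc.prems obtain W where "open W" "x \<in> W" "Ck_on (Suc k) W F" by blast
      then show "\<exists>W. open W \<and> x \<in> W \<and> Ck_on k W (\<lambda>x. frechet_derivative F (at x) v)" by auto
    qed
    ultimately show ?case by simp
  qed
  show ?thesis
  proof (rule loc, intro ballI)
    fix x assume "x \<in> U"
    then obtain W G where W: "open W" "x \<in> W" "\<And>k. Ck_on k W G" "\<And>y. y \<in> W \<Longrightarrow> y \<in> U \<Longrightarrow> G y = F y"
      using smooth_onE[OF assms(1)] by blast
    have "Ck_on k (W \<inter> U) F"
      by (rule Ck_on_cong[OF _ _ Ck_on_subset[OF W(3)]]) (use W assms in auto)
    then show "\<exists>W. open W \<and> x \<in> W \<and> Ck_on k W F"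
      using W assms \<open>x \<in> U\<close> by (intro exI[of _ "W \<inter> U"]) auto
  qed
qed


section \<open>Smooth maps between manifolds\<close>

text \<open>The part of the notion of a manifold on which composition of smooth maps rests. It is shared
  by manifolds, intervals, products and regular level sets.\<close>

definition charted :: "('a, 'e::euclidean_space) atlas_space \<Rightarrow> bool" where
  "charted A \<longleftrightarrow> points A \<subseteq> (\<Union>c\<in>charts A. fst c) \<and>
     (\<forall>(U, \<phi>)\<in>charts A. openin (mtop A) U \<and>
        homeomorphic_map (subtopology (mtop A) U) (top_of_set (\<phi> ` U)) \<phi>)"

lemma charted_cover:
  assumes "charted A" "x \<in> points A"
  obtains U \<phi> where "(U, \<phi>) \<in> charts A" "x \<in> U"
  using assms unfolding charted_def by fastforce

lemma
  assumes "charted A" "(U, \<phi>) \<in> charts A"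
  shows charted_openin: "openin (mtop A) U"
    and charted_homeomorphic: "homeomorphic_map (subtopology (mtop A) U) (top_of_set (\<phi> ` U)) \<phi>"
  using assms unfolding charted_def by auto

lemma charted_subset: "charted A \<Longrightarrow> (U, \<phi>) \<in> charts A \<Longrightarrow> U \<subseteq> points A"
  using charted_openin openin_subset by blast

lemma charted_inj_on:
  assumes "charted A" "(U, \<phi>) \<in> charts A"
  shows "inj_on \<phi> U"
  using homeomorphic_imp_injective_map[OF charted_homeomorphic[OF assms]]
    charted_subset[OF assms] by (simp add: Int_absorb1)

lemma charted_open_image:
  assumes "charted A" "(U, \<phi>) \<in> charts A" "openin (mtop A) V" "V \<subseteq> U"
  obtains O' where "open O'" "\<phi> ` V = \<phi> ` U \<inter> O'"
proof -
  have "openin (subtopology (mtop A) U) V"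
    using assms(3,4) openin_subset_topspace_eq openin_subtopology_Int2 by (metis inf.absorb_iff2)
  then have "openin (top_of_set (\<phi> ` U)) (\<phi> ` V)"
    using homeomorphic_imp_open_map[OF charted_homeomorphic[OF assms(1,2)]]
    by (auto simp: open_map_def)
  then show thesis using that by (auto simp: openin_open)
qed

lemma smooth_mapI:
  assumes "continuous_map (mtop A) (mtop B) F"
    and "\<And>U \<phi> W \<psi>. (U, \<phi>) \<in> charts A \<Longrightarrow> (W, \<psi>) \<in> charts B \<Longrightarrow>
      smooth_on (\<phi> ` {x \<in> U. F x \<in> W}) (\<psi> \<circ> F \<circ> inv_into U \<phi>)"
  shows "smooth_map A B F"
  using assms unfolding smooth_map_def by auto

lemma smooth_mapD:
  assumes "smooth_map A B F"
  shows "continuous_map (mtop A) (mtop B) F"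
    and "(U, \<phi>) \<in> charts A \<Longrightarrow> (W, \<psi>) \<in> charts B \<Longrightarrow>
      smooth_on (\<phi> ` {x \<in> U. F x \<in> W}) (\<psi> \<circ> F \<circ> inv_into U \<phi>)"
  using assms unfolding smooth_map_def by auto

lemma smooth_map_points: "smooth_map A B F \<Longrightarrow> x \<in> points A \<Longrightarrow> F x \<in> points B"
  by (meson continuous_map_funspace funcset_mem smooth_mapD(1))

text \<open>Smoothness is tested in all charts, so at each point a chart of the intermediate space has to
  be inserted. This is possible near the point only; that the set where the chart applies is
  relatively open in coordinates is where continuity and the homeomorphism property of the charts
  enter.\<close>

lemma smooth_map_compose:
  assumes A: "charted A" and B: "charted B"
    and F: "smooth_map A B F" and G: "smooth_map B C G"
  shows "smooth_map A C (G \<circ> F)"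
proof (rule smooth_mapI)
  show "continuous_map (mtop A) (mtop C) (G \<circ> F)"
    using smooth_mapD(1)[OF F] smooth_mapD(1)[OF G] by (rule continuous_map_compose)
  fix U \<phi> Z \<zeta> assume U: "(U, \<phi>) \<in> charts A" and Z: "(Z, \<zeta>) \<in> charts C"
  note inj = charted_inj_on[OF A U]
  let ?S = "\<phi> ` {x \<in> U. (G \<circ> F) x \<in> Z}"
  show "smooth_on ?S (\<zeta> \<circ> (G \<circ> F) \<circ> inv_into U \<phi>)"
  proof (rule smooth_on_locally)
    fix p assume "p \<in> ?S"
    then obtain x where x: "x \<in> U" "G (F x) \<in> Z" "p = \<phi> x" by auto
    have "F x \<in> points B" using smooth_map_points[OF F] charted_subset[OF A U] x by blast
    then obtain W \<psi> where W: "(W, \<psi>) \<in> charts B" "F x \<in> W" using charted_cover[OF B] by blast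
    note injW = charted_inj_on[OF B W(1)]
    define V where "V = {x \<in> U. F x \<in> W}"
    have "openin (mtop A) {x \<in> points A. F x \<in> W}"
      using openin_continuous_map_preimage[OF smooth_mapD(1)[OF F] charted_openin[OF B W(1)]] .
    moreover have "V = U \<inter> {x \<in> points A. F x \<in> W}"
      using charted_subset[OF A U] by (auto simp: V_def)
    ultimately have "openin (mtop A) V"
      using charted_openin[OF A U] by auto
    moreover have "V \<subseteq> U" by (auto simp: V_def)
    ultimately obtain O' where O': "open O'" "\<phi> ` V = \<phi> ` U \<inter> O'"
      using charted_open_image[OF A U] by metis
    have sub: "?S \<inter> O' \<subseteq> \<phi> ` {x \<in> V. G (F x) \<in> Z}"
    proof
      fix q assume q: "q \<in> ?S \<inter> O'"
      then obtain y where y: "y \<in> U" "G (F y) \<in> Z" "q = \<phi> y" by auto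
      with q have "q \<in> \<phi> ` V" unfolding O'(2) by auto
      with y inj have "y \<in> V" by (auto simp: V_def inj_on_eq_iff)
      with y show "q \<in> \<phi> ` {x \<in> V. G (F x) \<in> Z}" by blast
    qed
    have "smooth_on (\<phi> ` {x \<in> V. G (F x) \<in> Z}) (\<lambda>q. (\<zeta> \<circ> G \<circ> inv_into W \<psi>) ((\<psi> \<circ> F \<circ> inv_into U \<phi>) q))"
    proof (rule smooth_on_compose[where F = "\<psi> \<circ> F \<circ> inv_into U \<phi>" and G = "\<zeta> \<circ> G \<circ> inv_into W \<psi>"])
      show "smooth_on (\<phi> ` {x \<in> V. G (F x) \<in> Z}) (\<psi> \<circ> F \<circ> inv_into U \<phi>)"
        by (rule smooth_on_subset[OF smooth_mapD(2)[OF F U W(1)]]) (auto simp: V_def)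
      show "smooth_on (\<psi> ` {y \<in> W. G y \<in> Z}) (\<zeta> \<circ> G \<circ> inv_into W \<psi>)"
        by (rule smooth_mapD(2)[OF G W(1) Z])
      show "(\<psi> \<circ> F \<circ> inv_into U \<phi>) ` \<phi> ` {x \<in> V. G (F x) \<in> Z} \<subseteq> \<psi> ` {y \<in> W. G y \<in> Z}"
        using inj by (auto simp: V_def inv_into_f_f)
    qed
    from smooth_on_subset[OF this sub]
    have "smooth_on (?S \<inter> O') (\<zeta> \<circ> (G \<circ> F) \<circ> inv_into U \<phi>)"
    proof (rule smooth_on_cong)
      fix q assume "q \<in> ?S \<inter> O'"
      with sub obtain y where y: "y \<in> V" "q = \<phi> y" by auto
      then show "(\<zeta> \<circ> G \<circ> inv_into W \<psi>) ((\<psi> \<circ> F \<circ> inv_into U \<phi>) q) = (\<zeta> \<circ> (G \<circ> F) \<circ> inv_into U \<phi>) q"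
        using inj injW by (auto simp: V_def inv_into_f_f)
    qed
    moreover have "p \<in> O'"
      using O'(2) x W by (auto simp: V_def)
    ultimately show "\<exists>O'. open O' \<and> p \<in> O' \<and> smooth_on (?S \<inter> O') (\<zeta> \<circ> (G \<circ> F) \<circ> inv_into U \<phi>)"
      using O'(1) by blast
  qed
qed

lemma charted_manifold: "smooth_manifold M \<Longrightarrow> charted M"
  unfolding smooth_manifold_def charted_def is_chart_def by fastforce

text \<open>A subset of a Euclidean space with its global coordinate; \<open>real_space\<close> is the one-dimensional
  case.\<close>

definition subset_space :: "'e::euclidean_space set \<Rightarrow> ('e, 'e) atlas_space" where
  "subset_space S = \<lparr>mtop = top_of_set S, charts = {(S, \<lambda>t. t)}\<rparr>"

lemma real_space_eq: "real_space S = subset_space S"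
  by (simp add: real_space_def subset_space_def)

lemma subset_space_simps [simp]:
  "mtop (subset_space S) = top_of_set S" "charts (subset_space S) = {(S, \<lambda>t. t)}"
  "mtop (real_space S') = top_of_set S'" "charts (real_space S') = {(S', \<lambda>t. t)}"
  by (simp_all add: subset_space_def real_space_def)

lemma charted_subset_space: "charted (subset_space S)"
  unfolding charted_def using homeomorphic_map_id[of "top_of_set S" "top_of_set S"]
  by (simp add: id_def subtopology_subtopology)

lemmas charted_real_space = charted_subset_space[where 'a = real, folded real_space_eq]

lemma inv_into_ident: "t \<in> S \<Longrightarrow> inv_into S (\<lambda>t. t) t = t"
  by (metis image_ident f_inv_into_f)

lemma smooth_map_subset_space:
  "smooth_map (subset_space S) (subset_space T) F \<longleftrightarrow> F ` S \<subseteq> T \<and> smooth_on S F"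
proof -
  have eq: "{x \<in> S. F x \<in> T} = S" if "\<forall>x\<in>S. F x \<in> T" using that by auto
  have "smooth_on S (F \<circ> inv_into S (\<lambda>t. t)) \<longleftrightarrow> smooth_on S F"
    using smooth_on_cong[of S F "F \<circ> inv_into S (\<lambda>t. t)"]
      smooth_on_cong[of S "F \<circ> inv_into S (\<lambda>t. t)" F] by (auto simp: inv_into_ident)
  moreover have "smooth_map (subset_space S) (subset_space T) F \<longleftrightarrow> continuous_on S F \<and> (\<forall>x\<in>S. F x \<in> T) \<and>
      smooth_on {x \<in> S. F x \<in> T} (F \<circ> inv_into S (\<lambda>t. t))"
    unfolding smooth_map_def by (auto simp: continuous_map_in_subtopology o_def)
  ultimately show ?thesis
    using eq smooth_on_continuous_on[of S F] by (cases "\<forall>x\<in>S. F x \<in> T") (simp_all add: image_subset_iff, blast)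
qed

lemmas smooth_map_real_space = smooth_map_subset_space[where 'a = real and 'b = real, folded real_space_eq]

text \<open>Restricting the codomain lets positive functions be composed with functions that are smooth on
  \<open>{0<..}\<close> only, such as real powers.\<close>

lemma smooth_map_real_codomain:
  assumes "charted A"
  shows "smooth_map A (real_space T) h \<longleftrightarrow> smooth_map A (real_space UNIV) h \<and> h ` points A \<subseteq> T"
proof -
  have eq: "{x \<in> U. h x \<in> T} = U" if "h ` points A \<subseteq> T" "(U, \<phi>) \<in> charts A" for U and \<phi> :: "'a \<Rightarrow> 'b"
    using that charted_subset[OF assms that(2)] by auto
  have cont: "continuous_map (mtop A) (top_of_set T) h \<longleftrightarrow>
      continuous_map (mtop A) (top_of_set UNIV) h \<and> h ` points A \<subseteq> T"
    by (simp add: continuous_map_in_subtopology image_subset_iff_funcset)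
  show ?thesis
  proof (cases "h ` points A \<subseteq> T")
    case True
    then show ?thesis unfolding smooth_map_def using cont eq[OF True]
      by (auto cong: conj_cong ball_cong split: prod.splits)
  next
    case False
    then show ?thesis unfolding smooth_map_def using cont by simp
  qed
qed

lemma charted_prod_space:
  assumes A: "charted A" and B: "charted B"
  shows "charted (prod_space A B)"
proof -
  have "openin (prod_topology (mtop A) (mtop B)) (U \<times> W) \<and>
      homeomorphic_map (subtopology (prod_topology (mtop A) (mtop B)) (U \<times> W))
        (top_of_set (map_prod \<phi> \<psi> ` (U \<times> W))) (map_prod \<phi> \<psi>)"
    if U: "(U, \<phi>) \<in> charts A" and W: "(W, \<psi>) \<in> charts B" for U \<phi> W \<psi>
  proof
    show "openin (prod_topology (mtop A) (mtop B)) (U \<times> W)"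
      using charted_openin[OF A U] charted_openin[OF B W] by (simp add: openin_prod_Times_iff)
    obtain \<phi>' where \<phi>': "homeomorphic_maps (subtopology (mtop A) U) (top_of_set (\<phi> ` U)) \<phi> \<phi>'"
      using charted_homeomorphic[OF A U] homeomorphic_map_maps by blast
    obtain \<psi>' where \<psi>': "homeomorphic_maps (subtopology (mtop B) W) (top_of_set (\<psi> ` W)) \<psi> \<psi>'"
      using charted_homeomorphic[OF B W] homeomorphic_map_maps by blast
    have "homeomorphic_maps (prod_topology (subtopology (mtop A) U) (subtopology (mtop B) W))
       (prod_topology (top_of_set (\<phi> ` U)) (top_of_set (\<psi> ` W))) (\<lambda>(x, y). (\<phi> x, \<psi> y)) (\<lambda>(x, y). (\<phi>' x, \<psi>' y))"
      using homeomorphic_maps_prod[of _ _ _ _ \<phi> \<psi> \<phi>' \<psi>'] \<phi>' \<psi>' by blast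
    moreover have "map_prod \<phi> \<psi> ` (U \<times> W) = \<phi> ` U \<times> \<psi> ` W"
      by force
    then have "prod_topology (top_of_set (\<phi> ` U)) (top_of_set (\<psi> ` W)) = top_of_set (map_prod \<phi> \<psi> ` (U \<times> W))"
      by (simp flip: subtopology_Times)
    moreover have "prod_topology (subtopology (mtop A) U) (subtopology (mtop B) W) =
       subtopology (prod_topology (mtop A) (mtop B)) (U \<times> W)"
      by (simp flip: subtopology_Times)
    moreover have "(\<lambda>(x, y). (\<phi> x, \<psi> y)) = map_prod \<phi> \<psi>" by auto
    ultimately show "homeomorphic_map (subtopology (prod_topology (mtop A) (mtop B)) (U \<times> W))
        (top_of_set (map_prod \<phi> \<psi> ` (U \<times> W))) (map_prod \<phi> \<psi>)"
      using homeomorphic_maps_imp_map by metis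
  qed
  moreover have "points (prod_space A B) \<subseteq> (\<Union>c\<in>charts (prod_space A B). fst c)"
  proof
    fix p assume "p \<in> points (prod_space A B)"
    then have "fst p \<in> points A" "snd p \<in> points B" by (auto simp: prod_space_def)
    then obtain U \<phi> W \<psi> where "(U, \<phi>) \<in> charts A" "fst p \<in> U" "(W, \<psi>) \<in> charts B" "snd p \<in> W"
      using charted_cover[OF A] charted_cover[OF B] by metis
    then have "(U \<times> W, map_prod \<phi> \<psi>) \<in> charts (prod_space A B)" "p \<in> U \<times> W"
      by (auto simp: prod_space_def mem_Times_iff)
    then show "p \<in> (\<Union>c\<in>charts (prod_space A B). fst c)" by force
  qed
  ultimately show ?thesis unfolding charted_def by (auto simp: prod_space_def)
qed

lemma smooth_map_Pair:
  assumes F: "smooth_map A B F" and G: "smooth_map A C G"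
  shows "smooth_map A (prod_space B C) (\<lambda>x. (F x, G x))"
proof (rule smooth_mapI)
  show "continuous_map (mtop A) (mtop (prod_space B C)) (\<lambda>x. (F x, G x))"
    using smooth_mapD(1)[OF F] smooth_mapD(1)[OF G]
    by (simp add: prod_space_def continuous_map_pairedI)
  fix U \<phi> Z \<zeta> assume U: "(U, \<phi>) \<in> charts A" and "(Z, \<zeta>) \<in> charts (prod_space B C)"
  then obtain W \<psi> V \<eta> where W: "(W, \<psi>) \<in> charts B" "(V, \<eta>) \<in> charts C"
    and Z: "Z = W \<times> V" "\<zeta> = map_prod \<psi> \<eta>" by (auto simp: prod_space_def)
  have "smooth_on (\<phi> ` {x \<in> U. (F x, G x) \<in> Z})
      (\<lambda>x. ((\<psi> \<circ> F \<circ> inv_into U \<phi>) x, (\<eta> \<circ> G \<circ> inv_into U \<phi>) x))"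
    using smooth_mapD(2)[OF F U W(1)] smooth_mapD(2)[OF G U W(2)]
    by (intro smooth_on_Pair; elim smooth_on_subset) (auto simp: Z)
  then show "smooth_on (\<phi> ` {x \<in> U. (F x, G x) \<in> Z}) (\<zeta> \<circ> (\<lambda>x. (F x, G x)) \<circ> inv_into U \<phi>)"
    by (rule smooth_on_cong) (simp add: Z)
qed

lemma smooth_map_manifold_ident:
  assumes "smooth_manifold M"
  shows "smooth_map M M (\<lambda>x. x)"
proof (rule smooth_mapI)
  fix U \<phi> W \<psi> assume "(U, \<phi>) \<in> charts M" "(W, \<psi>) \<in> charts M"
  then have "compatible (U, \<phi>) (W, \<psi>)" using assms unfolding smooth_manifold_def by blast
  then show "smooth_on (\<phi> ` {x \<in> U. x \<in> W}) (\<psi> \<circ> (\<lambda>x. x) \<circ> inv_into U \<phi>)"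
    by (auto simp: compatible_def o_def Int_def)
qed simp

lemma smooth_map_const:
  assumes "c \<in> points B"
  shows "smooth_map A B (\<lambda>x. c)"
  by (rule smooth_mapI) (use assms in \<open>auto simp: o_def smooth_on_const\<close>)

lemma smooth_map_cong:
  assumes "charted A" "smooth_map A B F" "\<And>x. x \<in> points A \<Longrightarrow> F x = G x"
  shows "smooth_map A B G"
proof (rule smooth_mapI)
  show "continuous_map (mtop A) (mtop B) G"
    using smooth_mapD(1)[OF assms(2)] assms(3) continuous_map_eq by blast
  fix U \<phi> W \<psi> assume U: "(U, \<phi>) \<in> charts A" and W: "(W, \<psi>) \<in> charts B"
  have eq: "F x = G x" if "x \<in> U" for x
    using assms(3) charted_subset[OF assms(1) U] that by blast
  have "{x \<in> U. F x \<in> W} = {x \<in> U. G x \<in> W}" using eq by auto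
  then have "smooth_on (\<phi> ` {x \<in> U. G x \<in> W}) (\<psi> \<circ> F \<circ> inv_into U \<phi>)"
    using smooth_mapD(2)[OF assms(2) U W] by simp
  then show "smooth_on (\<phi> ` {x \<in> U. G x \<in> W}) (\<psi> \<circ> G \<circ> inv_into U \<phi>)"
    by (rule smooth_on_cong) (auto simp: inv_into_f_f[OF charted_inj_on[OF assms(1) U]] eq)
qed

text \<open>A chart of the maximal atlas is compatible with all charts of \<open>M\<close>, so the identity remains
  smooth when it is taken as the only chart of the target.\<close>

lemma smooth_map_max_atlas:
  assumes M: "smooth_manifold M" and A: "charted A" and F: "smooth_map A M F"
    and U: "(U, \<phi>) \<in> charts A" and W: "(W, \<psi>) \<in> max_atlas M"
  shows "smooth_on (\<phi> ` {x \<in> U. F x \<in> W}) (\<psi> \<circ> F \<circ> inv_into U \<phi>)"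
proof -
  let ?M' = "\<lparr>mtop = mtop M, charts = {(W, \<psi>)}\<rparr>"
  have "smooth_map M ?M' (\<lambda>x. x)"
  proof (rule smooth_mapI)
    fix V \<eta> W' \<psi>' assume "(V, \<eta>) \<in> charts M" "(W', \<psi>') \<in> charts ?M'"
    then have "compatible (W, \<psi>) (V, \<eta>)" "W' = W" "\<psi>' = \<psi>" using W by (auto simp: max_atlas_def)
    then show "smooth_on (\<eta> ` {x \<in> V. x \<in> W'}) (\<psi>' \<circ> (\<lambda>x. x) \<circ> inv_into V \<eta>)"
      by (auto simp: compatible_def o_def Int_def conj_commute)
  qed simp
  from smooth_map_compose[OF A charted_manifold[OF M] F this]
  have "smooth_map A ?M' F" by (simp add: o_def)
  from smooth_mapD(2)[OF this U, of W \<psi>] show ?thesis by simp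
qed


section \<open>Regular level sets\<close>

text \<open>Straightening a function with non-zero differential: in a direction \<open>n\<close> along which \<open>F\<close>
  increases, the map \<open>\<Psi>\<close> replaces the \<open>n\<close>-coordinate of a point \<open>p\<close> by \<open>F p - l\<close>. It is injective
  since \<open>F\<close> is monotone along \<open>n\<close>, so invariance of domain gives the open image and the continuous
  inverse. The inverse of \<open>D\<Psi>(p)\<close> can be written down, and it expresses \<open>D(\<Psi>\<inverse>)\<close> by \<open>\<Psi>\<inverse>\<close> and \<open>DF\<close>;
  hence \<open>\<Psi>\<inverse>\<close> is \<open>C\<^sup>k\<close> for all \<open>k\<close> by induction.\<close>

lemma straighten_function:
  fixes F :: "'e::euclidean_space \<Rightarrow> real"
  assumes \<Omega>: "open \<Omega>" "smooth_on \<Omega> F" "p0 \<in> \<Omega>" and v0: "frechet_derivative F (at p0) v0 \<noteq> 0"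
  obtains \<Omega>' n and \<Psi> :: "'e \<Rightarrow> 'e" where "open \<Omega>'" "p0 \<in> \<Omega>'" "\<Omega>' \<subseteq> \<Omega>" "n \<noteq> 0" "inj_on \<Psi> \<Omega>'" "open (\<Psi> ` \<Omega>')"
    "smooth_on \<Omega>' \<Psi>" "smooth_on (\<Psi> ` \<Omega>') (inv_into \<Omega>' \<Psi>)" "\<And>p. \<Psi> p \<bullet> n = F p - l"
proof -
  define DF where "DF p = frechet_derivative F (at p)" for p
  note Ck = smooth_on_open_Ck[OF \<Omega>(2,1)]
  have dF: "(F has_derivative DF p) (at p)" if "p \<in> \<Omega>" for p
    unfolding DF_def by (rule Ck_on_Suc_derivative[OF Ck that])
  have CkDF: "Ck_on k \<Omega> (\<lambda>p. DF p w)" for k w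
    using Ck[of "Suc k"] by (simp add: DF_def)
  have lin: "linear (DF p)" if "p \<in> \<Omega>" for p using has_derivative_linear[OF dF[OF that]] .
  have "v0 \<noteq> 0" using v0 linear_0[OF lin[OF \<Omega>(3)]] by (auto simp: DF_def)
  define n where "n = (sgn (DF p0 v0) / norm v0) *\<^sub>R v0"
  have sgn: "\<bar>sgn (DF p0 v0)\<bar> = 1" using v0 by (simp add: DF_def abs_sgn_eq)
  have n1: "n \<bullet> n = 1"
    using \<open>v0 \<noteq> 0\<close> sgn by (simp add: n_def dot_square_norm power2_eq_square norm_sgn abs_mult)
  have "DF p0 n = \<bar>DF p0 v0\<bar> / norm v0"
    using linear_scale[OF lin[OF \<Omega>(3)]] by (simp add: n_def sgn_real_def)
  then have pos0: "DF p0 n > 0" using v0 \<open>v0 \<noteq> 0\<close> by (simp add: DF_def)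
  have "continuous_on \<Omega> (\<lambda>p. DF p n)" by (rule Ck_on_continuous_on[OF CkDF])
  then have "open (\<Omega> \<inter> (\<lambda>p. DF p n) -` {0<..})" using \<Omega>(1) by (intro continuous_open_preimage) auto
  then obtain e where e: "e > 0" "ball p0 e \<subseteq> \<Omega> \<inter> (\<lambda>p. DF p n) -` {0<..}"
    using \<Omega>(3) pos0 open_contains_ball by (metis IntI greaterThan_iff vimageI)
  define \<Omega>' where "\<Omega>' = ball p0 e"
  have \<Omega>': "open \<Omega>'" "p0 \<in> \<Omega>'" "\<Omega>' \<subseteq> \<Omega>" and pos: "\<And>p. p \<in> \<Omega>' \<Longrightarrow> DF p n > 0"
    using e by (auto simp: \<Omega>'_def)
  define \<Psi> where "\<Psi> p = p + (F p - l - p \<bullet> n) *\<^sub>R n" for p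
  have \<Psi>n: "\<Psi> p \<bullet> n = F p - l" for p by (simp add: \<Psi>_def inner_left_distrib n1)
  have ne: "F p \<noteq> F (p + t *\<^sub>R n)" if p: "p \<in> \<Omega>'" "p + t *\<^sub>R n \<in> \<Omega>'" and "t > 0" for p t
  proof -
    have "F (p + 0 *\<^sub>R n) < F (p + t *\<^sub>R n)"
    proof (rule DERIV_pos_imp_increasing[of 0 t "\<lambda>s. F (p + s *\<^sub>R n)"])
      fix s :: real assume s: "0 \<le> s" "s \<le> t"
      have "(1 - s / t) *\<^sub>R p + (s / t) *\<^sub>R (p + t *\<^sub>R n) \<in> \<Omega>'"
        using convexD_alt[OF convex_ball, OF p[unfolded \<Omega>'_def], of "s / t"] s \<open>t > 0\<close>
        by (simp add: \<Omega>'_def)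
      then have in': "p + s *\<^sub>R n \<in> \<Omega>'" using \<open>t > 0\<close> by (simp add: algebra_simps)
      have "((\<lambda>s. p + s *\<^sub>R n) has_derivative (\<lambda>h. h *\<^sub>R n)) (at s)"
        by (auto intro!: derivative_eq_intros)
      moreover have "(F has_derivative DF (p + s *\<^sub>R n)) (at (p + s *\<^sub>R n))"
        using in' \<Omega>'(3) dF by blast
      ultimately have "((\<lambda>s. F (p + s *\<^sub>R n)) has_derivative (\<lambda>h. DF (p + s *\<^sub>R n) (h *\<^sub>R n))) (at s)"
        by (rule has_derivative_compose)
      then have "((\<lambda>s. F (p + s *\<^sub>R n)) has_real_derivative DF (p + s *\<^sub>R n) n) (at s)"
        unfolding has_field_derivative_def
        by (rule has_derivative_eq_rhs) (use in' \<Omega>'(3) in \<open>auto simp: linear_scale[OF lin] fun_eq_iff mult.commute\<close>)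
      then show "\<exists>y. ((\<lambda>s. F (p + s *\<^sub>R n)) has_real_derivative y) (at s) \<and> 0 < y"
        using pos[OF in'] by blast
    qed (use \<open>t > 0\<close> in auto)
    then show ?thesis by simp
  qed
  have inj: "inj_on \<Psi> \<Omega>'"
  proof (rule inj_onI)
    fix p q assume p: "p \<in> \<Omega>'" "q \<in> \<Omega>'" "\<Psi> p = \<Psi> q"
    then have F: "F p = F q" using \<Psi>n[of p] \<Psi>n[of q] by simp
    define t where "t = q \<bullet> n - p \<bullet> n"
    have "q - p = t *\<^sub>R n" using p(3) F unfolding \<Psi>_def t_def by (simp add: algebra_simps)
    then have q: "q = p + t *\<^sub>R n" "p = q + (- t) *\<^sub>R n" by (simp_all add: algebra_simps)
    show "p = q"
    proof (cases t "0::real" rule: linorder_cases)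
      case less
      have "F q \<noteq> F (q + (- t) *\<^sub>R n)" by (rule ne) (use less p q(2) in auto)
      with F q(2) show ?thesis by metis
    next
      case greater
      have "F p \<noteq> F (p + t *\<^sub>R n)" by (rule ne) (use greater p q(1) in auto)
      with F q(1) show ?thesis by metis
    qed (use q(1) in simp)
  qed
  have lin\<Psi>: "bounded_linear (\<lambda>p. p \<bullet> n)" by (rule bounded_linear_inner_left)
  have Ck\<Psi>: "Ck_on k \<Omega>' \<Psi>" for k
  proof -
    have "Ck_on k \<Omega>' (\<lambda>p. p + (F p + (- l + - (p \<bullet> n))) *\<^sub>R n)"
      by (intro Ck_on_add Ck_on_scaleR Ck_on_const Ck_on_linear[OF _ bounded_linear_ident]
          Ck_on_linear[OF _ bounded_linear_minus[OF lin\<Psi>]] \<Omega>'(1) Ck_on_subset[OF Ck \<Omega>'(3)])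
    then show ?thesis by (rule Ck_on_cong[OF \<Omega>'(1), rotated]) (simp add: \<Psi>_def)
  qed
  have cont: "continuous_on \<Omega>' \<Psi>" by (rule Ck_on_continuous_on[OF Ck\<Psi>])
  have op: "open (\<Psi> ` \<Omega>')" by (rule invariance_of_domain[OF cont \<Omega>'(1) inj])
  define G where "G = inv_into \<Omega>' \<Psi>"
  have G: "G (\<Psi> p) = p" if "p \<in> \<Omega>'" for p using that inj by (simp add: G_def inv_into_f_f)
  have GI: "G q \<in> \<Omega>'" if "q \<in> \<Psi> ` \<Omega>'" for q using that G by auto
  define E where "E p w = w + ((w \<bullet> n + - DF p w) / DF p n) *\<^sub>R n" for p w
  have dG: "(G has_derivative E (G q)) (at q)" if q: "q \<in> \<Psi> ` \<Omega>'" for q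
  proof -
    obtain p where p: "p \<in> \<Omega>'" "q = \<Psi> p" using q by blast
    let ?D = "\<lambda>p v. v + (DF p v - v \<bullet> n) *\<^sub>R n"
    have "(G has_derivative E p) (at (\<Psi> p))"
    proof (rule has_derivative_inverse_on[where f = \<Psi> and f' = ?D and g' = E, OF \<Omega>'(1) _ G _ p(1)])
      show "(\<Psi> has_derivative ?D x) (at x)" if "x \<in> \<Omega>'" for x
        unfolding \<Psi>_def using that \<Omega>'(3) by (auto intro!: derivative_eq_intros dF)
      have "p \<in> \<Omega>" using p \<Omega>' by blast
      then show "?D p \<circ> E p = id"
        using pos[OF p(1)] n1
        by (auto simp: fun_eq_iff E_def linear_add[OF lin] linear_scale[OF lin] inner_left_distrib
            algebra_simps scaleR_left_distrib[symmetric] divide_simps)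
    qed
    then show ?thesis using G[OF p(1)] p(2) by simp
  qed
  have CkG: "Ck_on k (\<Psi> ` \<Omega>') G" for k
  proof (induction k)
    case 0
    show ?case using continuous_on_inverse_open[OF \<Omega>'(1) cont order_refl] G by auto
  next
    case (Suc k)
    show ?case
    proof (rule Ck_on_SucI[OF op dG])
      fix w
      have "Ck_on k \<Omega>' (E\<^sub>w w)" if "E\<^sub>w = (\<lambda>w p. E p w)" for E\<^sub>w
        unfolding that E_def
        by (intro Ck_on_add Ck_on_scaleR Ck_on_divide Ck_on_const Ck_on_subset[OF CkDF \<Omega>'(3)] \<Omega>'(1)
            Ck_on_compose_linear[OF \<Omega>'(1) bounded_linear_minus[OF bounded_linear_ident] Ck_on_subset[OF CkDF \<Omega>'(3)]] pos)
      then have "Ck_on k (\<Psi> ` \<Omega>') (\<lambda>q. (\<lambda>p. E p w) (G q))"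
        by (intro Ck_on_compose[OF op _ Suc]) (use GI in auto)
      then show "Ck_on k (\<Psi> ` \<Omega>') (\<lambda>q. E (G q) w)" by simp
    qed
  qed
  show thesis
  proof (rule that[of \<Omega>' n \<Psi>])
    show "n \<noteq> 0" using n1 by auto
    show "smooth_on (\<Psi> ` \<Omega>') (inv_into \<Omega>' \<Psi>)"
      using smooth_onI_open[OF op CkG] by (simp add: G_def)
  qed (use \<Omega>' inj op smooth_onI_open[OF \<Omega>'(1) Ck\<Psi>] \<Psi>n in auto)
qed

lemma smooth_funs_iff:
  "h \<in> smooth_funs M \<longleftrightarrow> continuous_map (mtop M) euclidean h \<and>
     (\<forall>(U, \<phi>)\<in>charts M. smooth_on (\<phi> ` U) (h \<circ> inv_into U \<phi>))"
  by (simp add: smooth_funs_def smooth_map_def o_def)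

text \<open>The slice chart is a given chart followed by the straightening map. It belongs to the maximal
  atlas because the straightening map and its inverse are smooth.\<close>

lemma slice_chart_exists:
  fixes M :: "('a, 'e::euclidean_space) atlas_space"
  assumes M: "smooth_manifold M" and h: "h \<in> smooth_funs M"
    and U0: "(U0, \<phi>0) \<in> charts M" and x0: "x0 \<in> U0" "h x0 = l"
    and reg: "frechet_derivative (h \<circ> inv_into U0 \<phi>0) (at (\<phi>0 x0)) v0 \<noteq> 0"
  obtains U \<phi> V where "(U, \<phi>) \<in> max_atlas M" "x0 \<in> U" "subspace V" "Suc (dim V) = DIM('e)"
    "\<phi> ` (U \<inter> {x \<in> points M. h x = l}) = \<phi> ` U \<inter> V"
proof -
  note chM = charted_manifold[OF M]
  note inj0 = charted_inj_on[OF chM U0]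
  have ch0: "open (\<phi>0 ` U0)" using M U0 unfolding smooth_manifold_def is_chart_def by blast
  let ?F = "h \<circ> inv_into U0 \<phi>0"
  have smF: "smooth_on (\<phi>0 ` U0) ?F" using h U0 by (auto simp: smooth_funs_iff)
  obtain \<Omega> and n :: 'e and \<Psi> :: "'e \<Rightarrow> 'e" where \<Omega>: "open \<Omega>" "\<phi>0 x0 \<in> \<Omega>" "\<Omega> \<subseteq> \<phi>0 ` U0" and n: "n \<noteq> 0"
    and inj: "inj_on \<Psi> \<Omega>" and op: "open (\<Psi> ` \<Omega>)"
    and sm: "smooth_on \<Omega> \<Psi>" "smooth_on (\<Psi> ` \<Omega>) (inv_into \<Omega> \<Psi>)" and \<Psi>n: "\<And>p. \<Psi> p \<bullet> n = ?F p - l"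
    using straighten_function[OF ch0 smF imageI[OF x0(1)] reg, of l] by blast
  define U where "U = {x \<in> U0. \<phi>0 x \<in> \<Omega>}"
  define \<phi> where "\<phi> = \<Psi> \<circ> \<phi>0"
  note hom0 = charted_homeomorphic[OF chM U0]
  have UU0: "U \<subseteq> U0" by (auto simp: U_def)
  have im0: "\<phi>0 ` U = \<Omega>" using \<Omega>(3) by (auto simp: U_def)
  have top: "topspace (subtopology (mtop M) U0) = U0" using charted_subset[OF chM U0] by auto
  have "openin (subtopology (mtop M) U0) {x \<in> topspace (subtopology (mtop M) U0). \<phi>0 x \<in> \<Omega>}"
    by (rule openin_continuous_map_preimage[OF homeomorphic_imp_continuous_map[OF hom0]])
       (use \<Omega> in \<open>auto simp: openin_open\<close>)
  then have opU: "openin (mtop M) U"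
    using charted_openin[OF chM U0] openin_trans_full unfolding top U_def by blast
  have im: "\<phi> ` U = \<Psi> ` \<Omega>" by (simp add: \<phi>_def image_comp[symmetric] im0 del: image_comp o_apply)
  have hom: "homeomorphic_map (subtopology (mtop M) U) (top_of_set (\<phi> ` U)) \<phi>"
  proof -
    have "homeomorphic_map (subtopology (subtopology (mtop M) U0) U)
        (subtopology (top_of_set (\<phi>0 ` U0)) \<Omega>) \<phi>0"
      by (rule homeomorphic_map_subtopologies[OF hom0]) (use UU0 top im0 \<Omega>(3) in auto)
    then have 1: "homeomorphic_map (subtopology (mtop M) U) (top_of_set \<Omega>) \<phi>0"
      using UU0 \<Omega>(3) by (simp add: subtopology_subtopology Int_absorb1)
    have 2: "homeomorphic_map (top_of_set \<Omega>) (top_of_set (\<Psi> ` \<Omega>)) \<Psi>"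
    proof (rule homeomorphic_maps_imp_map)
      show "homeomorphic_maps (top_of_set \<Omega>) (top_of_set (\<Psi> ` \<Omega>)) \<Psi> (inv_into \<Omega> \<Psi>)"
        using smooth_on_continuous_on[OF sm(1)] smooth_on_continuous_on[OF sm(2)] inj
        by (auto simp: homeomorphic_maps_def continuous_map_in_subtopology inv_into_f_f)
    qed
    show ?thesis unfolding im unfolding \<phi>_def by (rule homeomorphic_map_compose[OF 1 2])
  qed
  have inj\<phi>: "inj_on \<phi> U"
    unfolding \<phi>_def using inj inj_on_subset[OF inj0 UU0] im0 by (simp add: comp_inj_on)
  have inv: "inv_into U0 \<phi>0 (inv_into \<Omega> \<Psi> (\<phi> x)) = x" if "x \<in> U" for x
    using that inj inj0 by (auto simp: U_def \<phi>_def inv_into_f_f)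
  have max: "(U, \<phi>) \<in> max_atlas M"
    unfolding max_atlas_def
  proof (intro CollectI conjI ballI)
    show "is_chart (mtop M) (U, \<phi>)" using opU hom op by (simp add: is_chart_def im)
    fix d assume "d \<in> charts M"
    then obtain W \<psi> where W: "d = (W, \<psi>)" "(W, \<psi>) \<in> charts M" by (cases d) auto
    then have c: "compatible (U0, \<phi>0) (W, \<psi>)" using M U0 unfolding smooth_manifold_def by blast
    note injW = charted_inj_on[OF chM W(2)]
    have "smooth_on (\<phi> ` (U \<inter> W)) (\<lambda>q. (\<psi> \<circ> inv_into U0 \<phi>0) (inv_into \<Omega> \<Psi> q))"
    proof (rule smooth_on_compose[where F = "inv_into \<Omega> \<Psi>" and G = "\<psi> \<circ> inv_into U0 \<phi>0"])
      show "smooth_on (\<phi> ` (U \<inter> W)) (inv_into \<Omega> \<Psi>)"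
        by (rule smooth_on_subset[OF sm(2)]) (use im in auto)
      show "smooth_on (\<phi>0 ` (U0 \<inter> W)) (\<psi> \<circ> inv_into U0 \<phi>0)" using c by (simp add: compatible_def)
      show "inv_into \<Omega> \<Psi> ` \<phi> ` (U \<inter> W) \<subseteq> \<phi>0 ` (U0 \<inter> W)"
        using inj by (auto simp: U_def \<phi>_def inv_into_f_f)
    qed
    then have 1: "smooth_on (\<phi> ` (U \<inter> W)) (\<psi> \<circ> inv_into U \<phi>)"
      by (rule smooth_on_cong) (auto simp: inv inv_into_f_f[OF inj\<phi>])
    have "smooth_on (\<psi> ` (U \<inter> W)) (\<lambda>q. \<Psi> ((\<phi>0 \<circ> inv_into W \<psi>) q))"
    proof (rule smooth_on_compose[where F = "\<phi>0 \<circ> inv_into W \<psi>" and G = \<Psi>])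
      show "smooth_on (\<psi> ` (U \<inter> W)) (\<phi>0 \<circ> inv_into W \<psi>)"
        by (rule smooth_on_subset[of "\<psi> ` (U0 \<inter> W)"]) (use c UU0 in \<open>auto simp: compatible_def\<close>)
      show "(\<phi>0 \<circ> inv_into W \<psi>) ` \<psi> ` (U \<inter> W) \<subseteq> \<Omega>"
        by (auto simp: inv_into_f_f[OF injW] U_def)
    qed (rule sm(1))
    then have "smooth_on (\<psi> ` (U \<inter> W)) (\<phi> \<circ> inv_into W \<psi>)"
      by (rule smooth_on_cong) (simp add: \<phi>_def)
    with 1 W(1) show "compatible (U, \<phi>) d" by (simp add: compatible_def)
  qed
  have hx: "\<phi> x \<bullet> n = h x - l" if "x \<in> U" for x
    using that UU0 by (auto simp: \<phi>_def \<Psi>n inv_into_f_f[OF inj0])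
  show thesis
  proof (rule that[OF max])
    show "x0 \<in> U" using x0 \<Omega> by (simp add: U_def)
    show "subspace {p. p \<bullet> n = 0}" by (rule subspace_hyperplane2)
    show "Suc (dim {p. p \<bullet> n = 0}) = DIM('e)"
      using dim_hyperplane[OF n] DIM_positive[where 'a = 'e] by (simp add: inner_commute)
    show "\<phi> ` (U \<inter> {x \<in> points M. h x = l}) = \<phi> ` U \<inter> {p. p \<bullet> n = 0}"
      using hx charted_subset[OF chM U0] UU0 by force
  qed
qed

lemma hypersurface_simps [simp]: "mtop (hypersurface M S) = subtopology (mtop M) S"
  by (simp add: hypersurface_def)

lemma hypersurface_chartE:
  assumes "(W, \<psi>) \<in> charts (hypersurface M S)"
  obtains U where "W = U \<inter> S" "(U, \<psi>) \<in> max_atlas M"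
  using assms by (auto simp: hypersurface_def)

lemma max_atlas_inj_on: "(U, \<phi>) \<in> max_atlas M \<Longrightarrow> inj_on \<phi> U"
  and max_atlas_homeomorphic:
    "(U, \<phi>) \<in> max_atlas M \<Longrightarrow> homeomorphic_map (subtopology (mtop M) U) (top_of_set (\<phi> ` U)) \<phi>"
  and max_atlas_openin: "(U, \<phi>) \<in> max_atlas M \<Longrightarrow> openin (mtop M) U"
proof -
  assume "(U, \<phi>) \<in> max_atlas M"
  then show h: "homeomorphic_map (subtopology (mtop M) U) (top_of_set (\<phi> ` U)) \<phi>" and o: "openin (mtop M) U"
    by (auto simp: max_atlas_def is_chart_def)
  show "inj_on \<phi> U"
    using homeomorphic_imp_injective_map[OF h] openin_subset[OF o] by (simp add: Int_absorb1)
qed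

text \<open>By definition a hypersurface has only slice charts, so it is covered by charts only if slice
  charts exist at all of its points.\<close>

lemma charted_hypersurface:
  fixes M :: "('a, 'e::euclidean_space) atlas_space"
  assumes cover: "\<And>x. x \<in> S \<Longrightarrow> \<exists>U \<phi> V. (U, \<phi>) \<in> max_atlas M \<and> x \<in> U \<and> subspace V \<and>
      Suc (dim V) = DIM('e) \<and> \<phi> ` (U \<inter> S) = \<phi> ` U \<inter> V"
  shows "charted (hypersurface M S)"
proof -
  have "openin (subtopology (mtop M) S) W \<and>
      homeomorphic_map (subtopology (subtopology (mtop M) S) W) (top_of_set (\<psi> ` W)) \<psi>"
    if W: "(W, \<psi>) \<in> charts (hypersurface M S)" for W \<psi>
  proof -
    obtain U where U: "W = U \<inter> S" "(U, \<psi>) \<in> max_atlas M"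
      by (rule hypersurface_chartE[OF W])
    have sub: "U \<subseteq> points M" using openin_subset[OF max_atlas_openin[OF U(2)]] .
    have "homeomorphic_map (subtopology (subtopology (mtop M) U) (U \<inter> S)) (subtopology (top_of_set (\<psi> ` U)) (\<psi> ` (U \<inter> S))) \<psi>"
      by (rule homeomorphic_map_subtopologies[OF max_atlas_homeomorphic[OF U(2)]])
         (use sub max_atlas_inj_on[OF U(2)] in \<open>auto simp: inj_on_eq_iff\<close>)
    moreover have "\<psi> ` U \<inter> \<psi> ` (U \<inter> S) = \<psi> ` (U \<inter> S)" by auto
    ultimately show ?thesis
      using max_atlas_openin[OF U(2)] unfolding U(1)
      by (simp add: subtopology_subtopology openin_subtopology_Int2 Int_ac)
  qed
  moreover have "points (hypersurface M S) \<subseteq> (\<Union>c\<in>charts (hypersurface M S). fst c)"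
  proof
    fix x assume "x \<in> points (hypersurface M S)"
    then have "x \<in> S" by simp
    from cover[OF this] obtain U \<phi> V where "(U, \<phi>) \<in> max_atlas M" "x \<in> U" "subspace V"
      "Suc (dim V) = DIM('e)" "\<phi> ` (U \<inter> S) = \<phi> ` U \<inter> V" by blast
    then have "(U \<inter> S, \<phi>) \<in> charts (hypersurface M S)" "x \<in> U \<inter> S"
      using \<open>x \<in> S\<close> by (auto simp: hypersurface_def)
    then show "x \<in> (\<Union>c\<in>charts (hypersurface M S). fst c)" by force
  qed
  ultimately show ?thesis unfolding charted_def by auto
qed

lemma smooth_map_hypersurface_inclusion:
  assumes M: "smooth_manifold M"
  shows "smooth_map (hypersurface M S) M (\<lambda>x. x)"
proof (rule smooth_mapI)
  show "continuous_map (mtop (hypersurface M S)) (mtop M) (\<lambda>x. x)"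
    by (simp add: continuous_map_from_subtopology)
  fix W' \<psi>' W \<psi> assume "(W', \<psi>') \<in> charts (hypersurface M S)" and W: "(W, \<psi>) \<in> charts M"
  then obtain U where U: "W' = U \<inter> S" "(U, \<psi>') \<in> max_atlas M" by (elim hypersurface_chartE)
  note inj = max_atlas_inj_on[OF U(2)]
  have "compatible (U, \<psi>') (W, \<psi>)" using U(2) W by (auto simp: max_atlas_def)
  then have "smooth_on (\<psi>' ` (U \<inter> W)) (\<psi> \<circ> inv_into U \<psi>')" by (simp add: compatible_def)
  then have "smooth_on (\<psi>' ` {x \<in> W'. x \<in> W}) (\<psi> \<circ> inv_into U \<psi>')"
    by (rule smooth_on_subset) (auto simp: U(1))
  then show "smooth_on (\<psi>' ` {x \<in> W'. x \<in> W}) (\<psi> \<circ> (\<lambda>x. x) \<circ> inv_into W' \<psi>')"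
  proof (rule smooth_on_cong)
    fix q assume "q \<in> \<psi>' ` {x \<in> W'. x \<in> W}"
    then obtain x where x: "x \<in> W'" "q = \<psi>' x" by auto
    moreover have "inj_on \<psi>' W'" using inj U(1) by (meson Int_lower1 inj_on_subset)
    ultimately show "(\<psi> \<circ> inv_into U \<psi>') q = (\<psi> \<circ> (\<lambda>x. x) \<circ> inv_into W' \<psi>') q"
      using inj U(1) by (simp add: inv_into_f_f)
  qed
qed

text \<open>The inclusion is smooth, and slice charts are charts of the maximal atlas of the ambient
  manifold. This turns paths in a level set into paths of the manifold that stay in the level set.\<close>

lemma smooth_map_hypersurface_iff:
  assumes M: "smooth_manifold M" and S: "charted (hypersurface M S)" and A: "charted A"
    and SM: "S \<subseteq> points M"
  shows "smooth_map A (hypersurface M S) F \<longleftrightarrow> smooth_map A M F \<and> F ` points A \<subseteq> S"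
proof
  assume F: "smooth_map A (hypersurface M S) F"
  have "smooth_map A M F"
    using smooth_map_compose[OF A S F smooth_map_hypersurface_inclusion[OF M]] by (simp add: o_def)
  moreover have "F ` points A \<subseteq> S" using smooth_map_points[OF F] SM by auto
  ultimately show "smooth_map A M F \<and> F ` points A \<subseteq> S" by blast
next
  assume F: "smooth_map A M F \<and> F ` points A \<subseteq> S"
  show "smooth_map A (hypersurface M S) F"
  proof (rule smooth_mapI)
    show "continuous_map (mtop A) (mtop (hypersurface M S)) F"
      using F smooth_mapD(1) by (auto simp: continuous_map_in_subtopology)
    fix U \<phi> W \<psi> assume U: "(U, \<phi>) \<in> charts A" and "(W, \<psi>) \<in> charts (hypersurface M S)"
    then obtain V where V: "W = V \<inter> S" "(V, \<psi>) \<in> max_atlas M" by (elim hypersurface_chartE)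
    have "{x \<in> U. F x \<in> W} = {x \<in> U. F x \<in> V}"
      using V(1) F charted_subset[OF A U] by auto
    then show "smooth_on (\<phi> ` {x \<in> U. F x \<in> W}) (\<psi> \<circ> F \<circ> inv_into U \<phi>)"
      using smooth_map_max_atlas[OF M A _ U V(2)] F by simp
  qed
qed


section \<open>Tangent vectors and velocities\<close>

lemma Ck_on_exp: "Ck_on k UNIV (\<lambda>x::real. c * exp x)"
proof (induction k arbitrary: c)
  case (Suc k)
  show ?case
  proof (rule Ck_on_SucI)
    show "((\<lambda>x::real. c * exp x) has_derivative (\<lambda>v. (v * c) * exp x)) (at x)" for x
      by (auto intro!: derivative_eq_intros)
  qed (use Suc in auto)
qed (auto intro!: continuous_intros)

lemma smooth_on_exp: "smooth_on S (\<lambda>x::real. exp x)"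
  using smooth_onI_open[OF open_UNIV, of "\<lambda>x::real. 1 * exp x"] Ck_on_exp[of _ 1] smooth_on_subset by fastforce

lemma smooth_on_powr: "smooth_on {0<..} (\<lambda>x::real. c * x powr \<beta>)"
  by (rule smooth_onI_open[OF _ Ck_on_powr]) simp

lemma smooth_funs_bilinear:
  assumes "smooth_on UNIV (\<lambda>(x, y). B x y)" and h: "h \<in> smooth_funs M" and k: "k \<in> smooth_funs M"
  shows "(\<lambda>y. B (h y) (k y)) \<in> smooth_funs M"
proof -
  have "continuous_on UNIV (\<lambda>(x, y). B x y)" by (rule smooth_on_continuous_on[OF assms(1)])
  then have "continuous_map (prod_topology euclideanreal euclideanreal) euclideanreal (\<lambda>(x, y). B x y)"
    by (simp add: euclidean_product_topology)
  moreover have "continuous_map (mtop M) (prod_topology euclideanreal euclideanreal) (\<lambda>y. (h y, k y))"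
    by (rule continuous_map_pairedI) (use h k in \<open>auto simp: smooth_funs_iff\<close>)
  ultimately have "continuous_map (mtop M) euclideanreal ((\<lambda>(x, y). B x y) \<circ> (\<lambda>y. (h y, k y)))"
    using continuous_map_compose by blast
  moreover have "smooth_on (\<phi> ` U) ((\<lambda>y. B (h y) (k y)) \<circ> inv_into U \<phi>)" if "(U, \<phi>) \<in> charts M" for U \<phi>
  proof -
    have "smooth_on (\<phi> ` U) (\<lambda>p. (\<lambda>(x, y). B x y) ((h \<circ> inv_into U \<phi>) p, (k \<circ> inv_into U \<phi>) p))"
      using h k that
      by (intro smooth_on_compose[where F = "\<lambda>p. ((h \<circ> inv_into U \<phi>) p, (k \<circ> inv_into U \<phi>) p)", OF smooth_on_Pair assms(1)])
         (fastforce simp: smooth_funs_iff o_def)+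
    then show ?thesis by (simp add: o_def)
  qed
  ultimately show ?thesis by (auto simp: smooth_funs_iff o_def)
qed

lemma smooth_funs_mult: "h \<in> smooth_funs M \<Longrightarrow> k \<in> smooth_funs M \<Longrightarrow> (\<lambda>y. h y * k y) \<in> smooth_funs M"
proof (rule smooth_funs_bilinear[where B = "\<lambda>x y. x * y"])
  show "smooth_on UNIV (\<lambda>(x, y). x * y :: real)"
    unfolding case_prod_beta
    by (rule smooth_onI_open[OF open_UNIV]) (intro Ck_on_mult Ck_on_linear bounded_linear_fst bounded_linear_snd open_UNIV)
qed

lemma smooth_funs_lincomb:
  "h \<in> smooth_funs M \<Longrightarrow> k \<in> smooth_funs M \<Longrightarrow> (\<lambda>y. a * h y + b * k y) \<in> smooth_funs M"
proof (rule smooth_funs_bilinear[where B = "\<lambda>x y. a * x + b * y"])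
  show "smooth_on UNIV (\<lambda>(x, y). a * x + b * y :: real)"
    unfolding case_prod_beta
    by (intro smooth_on_linear bounded_linear_add bounded_linear_const_mult bounded_linear_fst bounded_linear_snd)
qed

lemma tangent_space_lincomb:
  assumes "u \<in> tangent_space M x" "w \<in> tangent_space M x"
  shows "(\<lambda>h. a * u h + b * w h) \<in> tangent_space M x"
  using assms by (auto simp: tangent_space_def algebra_simps)

lemma tangent_space_zero: "(\<lambda>h. 0) \<in> tangent_space M x"
  by (simp add: tangent_space_def)

lemma tangent_space_sum:
  assumes "\<And>i. i \<in> I \<Longrightarrow> w i \<in> tangent_space M x"
  shows "(\<lambda>h. \<Sum>i\<in>I. a i * w i h) \<in> tangent_space M x"
  using assms
proof (induction I rule: infinite_finite_induct)
  case (insert i I)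
  then have "(\<lambda>h. a i * w i h + 1 * (\<Sum>i\<in>I. a i * w i h)) \<in> tangent_space M x"
    by (intro tangent_space_lincomb) auto
  then show ?case using insert by simp
qed (simp_all add: tangent_space_zero)

text \<open>Tangent vectors are derivations; differentiation along a curve is one by the product rule.\<close>

lemma derivation_in_tangent_space:
  assumes D: "\<And>h. h \<in> smooth_funs M \<Longrightarrow> ((\<lambda>s. h (c s)) has_real_derivative v h) (at t)"
    and v0: "\<And>h. h \<notin> smooth_funs M \<Longrightarrow> v h = 0"
  shows "v \<in> tangent_space M (c t)"
  unfolding tangent_space_def
proof (intro CollectI conjI ballI allI impI)
  fix h k and a b :: real assume h: "h \<in> smooth_funs M" and k: "k \<in> smooth_funs M"
  show "v (\<lambda>y. a * h y + b * k y) = a * v h + b * v k"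
    by (rule DERIV_unique[OF D[OF smooth_funs_lincomb[OF h k]]])
       (intro DERIV_add DERIV_cmult D h k)
  show "v (\<lambda>y. h y * k y) = h (c t) * v k + k (c t) * v h"
    by (rule DERIV_unique[OF D[OF smooth_funs_mult[OF h k]]])
       (rule DERIV_cong[OF DERIV_mult[OF D[OF h] D[OF k]]], simp)
qed (use v0 in auto)

context
  fixes M :: "('a, 'e::euclidean_space) atlas_space"
  assumes M: "smooth_manifold M"
begin

lemma smooth_fun_chart_derivative:
  assumes U: "(U, \<phi>) \<in> charts M" and x: "x \<in> U" and h: "h \<in> smooth_funs M"
  shows "((h \<circ> inv_into U \<phi>) has_derivative frechet_derivative (h \<circ> inv_into U \<phi>) (at (\<phi> x))) (at (\<phi> x))"
proof -
  have "open (\<phi> ` U)" using M U unfolding smooth_manifold_def is_chart_def by blast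
  moreover have "smooth_on (\<phi> ` U) (h \<circ> inv_into U \<phi>)" using h U by (auto simp: smooth_funs_iff)
  ultimately have "(h \<circ> inv_into U \<phi>) differentiable (at (\<phi> x))"
    using smooth_on_differentiable x by blast
  then show ?thesis by (simp add: frechet_derivative_works[symmetric])
qed

text \<open>A coordinate vector differentiates along the coordinate line through the point.\<close>

lemma coord_vector_tangent:
  assumes U: "(U, \<phi>) \<in> charts M" and x: "x \<in> U"
  shows "coord_vector M (U, \<phi>) x e \<in> tangent_space M x"
proof -
  let ?c = "\<lambda>s. inv_into U \<phi> (\<phi> x + s *\<^sub>R e)"
  have "coord_vector M (U, \<phi>) x e \<in> tangent_space M (?c 0)"
  proof (rule derivation_in_tangent_space)
    fix h assume h: "h \<in> smooth_funs M"
    have 1: "((\<lambda>s. \<phi> x + s *\<^sub>R e) has_derivative (\<lambda>s. s *\<^sub>R e)) (at 0)"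
      by (auto intro!: derivative_eq_intros)
    have 2: "((h \<circ> inv_into U \<phi>) has_derivative frechet_derivative (h \<circ> inv_into U \<phi>) (at (\<phi> x))) (at (\<phi> x + 0 *\<^sub>R e))"
      using smooth_fun_chart_derivative[OF U x h] by simp
    have "((\<lambda>s. (h \<circ> inv_into U \<phi>) (\<phi> x + s *\<^sub>R e)) has_derivative
        (\<lambda>s. frechet_derivative (h \<circ> inv_into U \<phi>) (at (\<phi> x)) (s *\<^sub>R e))) (at 0)"
      by (rule has_derivative_compose[OF 1 2])
    then show "((\<lambda>s. h (?c s)) has_real_derivative coord_vector M (U, \<phi>) x e h) (at 0)"
      unfolding has_field_derivative_def o_def
      by (rule has_derivative_eq_rhs)
         (use h linear_scale[OF has_derivative_linear[OF smooth_fun_chart_derivative[OF U x h]]] in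
           \<open>auto simp: coord_vector_def fun_eq_iff mult.commute o_def\<close>)
  qed (simp add: coord_vector_def)
  then show ?thesis using charted_inj_on[OF charted_manifold[OF M] U] x by (simp add: inv_into_f_f)
qed

lemma coord_vector_expand:
  assumes U: "(U, \<phi>) \<in> charts M" and x: "x \<in> U"
  shows "coord_vector M (U, \<phi>) x e = (\<lambda>h. \<Sum>b\<in>Basis. (e \<bullet> b) * coord_vector M (U, \<phi>) x b h)"
proof
  fix h
  show "coord_vector M (U, \<phi>) x e h = (\<Sum>b\<in>Basis. (e \<bullet> b) * coord_vector M (U, \<phi>) x b h)"
  proof (cases "h \<in> smooth_funs M")
    case True
    let ?D = "frechet_derivative (h \<circ> inv_into U \<phi>) (at (\<phi> x))"
    have "linear ?D" by (rule has_derivative_linear[OF smooth_fun_chart_derivative[OF U x True]])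
    then have "?D (\<Sum>b\<in>Basis. (e \<bullet> b) *\<^sub>R b) = (\<Sum>b\<in>Basis. (e \<bullet> b) * ?D b)"
      by (simp add: linear_sum linear_scale)
    then show ?thesis using True by (simp add: coord_vector_def euclidean_representation)
  qed (simp add: coord_vector_def)
qed

lemma smooth_fun_along_curve:
  assumes "smooth_map (real_space S) M c" "h \<in> smooth_funs M"
  shows "smooth_on S (\<lambda>t. h (c t))"
  using smooth_map_compose[OF charted_real_space charted_manifold[OF M] assms(1), of "real_space UNIV" h] assms(2)
  by (simp add: smooth_funs_def smooth_map_real_space o_def)

lemma velocity_works:
  assumes "smooth_map (real_space S) M c" "h \<in> smooth_funs M" "open U" "t \<in> U" "U \<subseteq> S"
  shows "((\<lambda>s. h (c s)) has_real_derivative velocity M c t h) (at t)"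
proof -
  have "(\<lambda>s. h (c s)) differentiable (at t)"
    by (rule smooth_on_differentiable[OF smooth_fun_along_curve[OF assms(1,2)] assms(3-5)])
  then obtain D where "((\<lambda>s. h (c s)) has_real_derivative D) (at t)" by (auto simp: real_differentiable_def)
  then show ?thesis using assms(2) DERIV_imp_deriv by (fastforce simp: velocity_def)
qed

lemma velocity_tangent:
  assumes "smooth_map (real_space S) M c" "open U" "t \<in> U" "U \<subseteq> S"
  shows "velocity M c t \<in> tangent_space M (c t)"
  using velocity_works[OF assms(1) _ assms(2-4)]
  by (rule derivation_in_tangent_space) (auto simp: velocity_def)

text \<open>The velocity of a curve in coordinates. The local parametrisation \<open>G\<close> need not be \<open>\<phi> \<circ> c\<close>
  itself, so that it may be a smooth extension of \<open>\<phi> \<circ> c\<close> beyond an end point of a smooth piece.\<close>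

lemma velocity_coord:
  assumes U: "(U, \<phi>) \<in> charts M" and dG: "(G has_derivative G') (at t)"
    and O': "open O'" "t \<in> O'" and G: "\<And>s. s \<in> O' \<Longrightarrow> c s \<in> U \<and> G s = \<phi> (c s)"
  shows "velocity M c t = coord_vector M (U, \<phi>) (c t) (G' 1)"
proof
  fix h
  note inj = charted_inj_on[OF charted_manifold[OF M] U]
  show "velocity M c t h = coord_vector M (U, \<phi>) (c t) (G' 1) h"
  proof (cases "h \<in> smooth_funs M")
    case True
    let ?D = "frechet_derivative (h \<circ> inv_into U \<phi>) (at (\<phi> (c t)))"
    have dh: "((h \<circ> inv_into U \<phi>) has_derivative ?D) (at (G t))"
      using smooth_fun_chart_derivative[OF U _ True, of "c t"] G[OF O'(2)] by simp
    have "((\<lambda>s. (h \<circ> inv_into U \<phi>) (G s)) has_derivative (\<lambda>w. ?D (G' w))) (at t)"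
      by (rule has_derivative_compose[OF dG dh])
    then have "((\<lambda>s. h (c s)) has_derivative (\<lambda>w. ?D (G' w))) (at t)"
      by (rule has_derivative_transform_within_open[OF _ O']) (use G inj in \<open>auto simp: inv_into_f_f\<close>)
    moreover have "(\<lambda>w. ?D (G' w)) = (*) (?D (G' 1))"
    proof
      fix w :: real
      have "?D (G' (w *\<^sub>R 1)) = w * ?D (G' 1)"
        unfolding linear_scale[OF has_derivative_linear[OF dG]] linear_scale[OF has_derivative_linear[OF dh]] by simp
      then show "?D (G' w) = ?D (G' 1) * w" by (simp add: mult.commute)
    qed
    ultimately have "((\<lambda>s. h (c s)) has_real_derivative ?D (G' 1)) (at t)"
      by (simp add: has_field_derivative_def)
    then show ?thesis using True by (simp add: velocity_def coord_vector_def DERIV_imp_deriv)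
  qed (simp add: velocity_def coord_vector_def)
qed

end

lemma velocity_cong_open:
  fixes c c' :: "real \<Rightarrow> 'a"
  assumes "open U" "t \<in> U" "\<And>s. s \<in> U \<Longrightarrow> c s = c' s"
  shows "velocity M c t = velocity M c' t"
proof
  fix h :: "'a \<Rightarrow> real"
  have "eventually (\<lambda>s. s \<in> U) (nhds t)" using assms(1,2) by (rule eventually_nhds_in_open)
  then have "eventually (\<lambda>s. h (c s) = h (c' s)) (nhds t)"
    by (rule eventually_mono) (simp add: assms(3))
  then have "deriv (\<lambda>s. h (c s)) t = deriv (\<lambda>s. h (c' s)) t"
    by (rule deriv_cong_ev) simp
  then show "velocity M c t h = velocity M c' t h" by (simp add: velocity_def)
qed


section \<open>Homogeneous Riemannian pairs\<close>

locale homogeneous_riemannian =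
  fixes M :: "('a, 'e::euclidean_space) atlas_space"
    and m :: "real \<Rightarrow> 'a \<Rightarrow> 'a" and g :: "'a tensor2" and f :: "'a \<Rightarrow> real" and \<alpha> :: real
  assumes M: "smooth_manifold M"
    and action: "free_smooth_action M m"
    and pair: "homogeneous_pair M m g f \<alpha>"
    and pos: "positive_definite M g"
begin

lemmas charted_M = charted_manifold[OF M]

lemma f_smooth: "f \<in> smooth_funs M"
  and f_pos: "x \<in> points M \<Longrightarrow> f x > 0"
  and f_action: "s > 0 \<Longrightarrow> x \<in> points M \<Longrightarrow> f (m s x) = s powr \<alpha> * f x"
  and g_action: "s > 0 \<Longrightarrow> x \<in> points M \<Longrightarrow> u \<in> tangent_space M x \<Longrightarrow> w \<in> tangent_space M x \<Longrightarrow>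
      g (m s x) (pushforward M (m s) u) (pushforward M (m s) w) = s powr \<alpha> * g x u w"
  and g_field: "x \<in> points M \<Longrightarrow> u \<in> tangent_space M x \<Longrightarrow> g x (action_field M m x) u = u f"
  using pair by (auto simp: homogeneous_pair_def pullback_def)

lemma g_sym: "x \<in> points M \<Longrightarrow> u \<in> tangent_space M x \<Longrightarrow> w \<in> tangent_space M x \<Longrightarrow> g x u w = g x w u"
  and g_linear: "x \<in> points M \<Longrightarrow> u \<in> tangent_space M x \<Longrightarrow> v \<in> tangent_space M x \<Longrightarrow> w \<in> tangent_space M x \<Longrightarrow>
      g x (\<lambda>h. a * u h + b * v h) w = a * g x u w + b * g x v w"
  using pair by (auto simp: homogeneous_pair_def pseudo_riemannian_def)

lemma g_linear_right:
  assumes "x \<in> points M" "u \<in> tangent_space M x" "v \<in> tangent_space M x" "w \<in> tangent_space M x"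
  shows "g x w (\<lambda>h. a * u h + b * v h) = a * g x w u + b * g x w v"
  using g_linear[OF assms] g_sym[OF assms(1,4)] tangent_space_lincomb[OF assms(2,3)] assms by metis

lemma g_zero: "x \<in> points M \<Longrightarrow> w \<in> tangent_space M x \<Longrightarrow> g x (\<lambda>h. 0) w = 0"
  using g_linear[of x w w w 0 0] by simp

lemma g_nonneg: "x \<in> points M \<Longrightarrow> u \<in> tangent_space M x \<Longrightarrow> g x u u \<ge> 0"
  using pos g_zero[of x u] unfolding positive_definite_def by (metis less_eq_real_def)

lemma g_sum:
  assumes x: "x \<in> points M" and w: "\<And>i. i \<in> I \<Longrightarrow> w i \<in> tangent_space M x" and u: "u \<in> tangent_space M x"
  shows "g x (\<lambda>h. \<Sum>i\<in>I. a i * w i h) u = (\<Sum>i\<in>I. a i * g x (w i) u)"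
  using w
proof (induction I rule: infinite_finite_induct)
  case (insert i I)
  then have "g x (\<lambda>h. a i * w i h + 1 * (\<Sum>i\<in>I. a i * w i h)) u = a i * g x (w i) u + 1 * g x (\<lambda>h. \<Sum>i\<in>I. a i * w i h) u"
    by (intro g_linear x u tangent_space_sum) auto
  with insert show ?case by simp
qed (simp_all add: g_zero x u)

lemma action_one: "x \<in> points M \<Longrightarrow> m 1 x = x"
  and action_mult: "s > 0 \<Longrightarrow> t > 0 \<Longrightarrow> x \<in> points M \<Longrightarrow> m (s * t) x = m s (m t x)"
  and action_smooth: "smooth_map (prod_space (real_space {0<..}) M) M (\<lambda>(t, x). m t x)"
  using action by (auto simp: free_smooth_action_def)

lemma smooth_map_action:
  assumes A: "charted A" and \<mu>: "smooth_map A (real_space {0<..}) \<mu>" and c: "smooth_map A M c"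
  shows "smooth_map A M (\<lambda>x. m (\<mu> x) (c x))"
  using smooth_map_compose[OF A charted_prod_space[OF charted_real_space charted_M] smooth_map_Pair[OF \<mu> c] action_smooth]
  by (simp add: o_def)

lemma smooth_map_m: "s > 0 \<Longrightarrow> smooth_map M M (m s)"
  using smooth_map_action[OF charted_M smooth_map_const smooth_map_manifold_ident[OF M]] by simp

lemma action_in: "s > 0 \<Longrightarrow> x \<in> points M \<Longrightarrow> m s x \<in> points M"
  using smooth_map_points[OF smooth_map_m] .

lemma smooth_funs_action: "s > 0 \<Longrightarrow> h \<in> smooth_funs M \<Longrightarrow> h \<circ> m s \<in> smooth_funs M"
  unfolding smooth_funs_def using smooth_map_compose[OF charted_M charted_M smooth_map_m] by auto

lemma orbit_smooth:
  assumes "x \<in> points M"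
  shows "smooth_map (real_space S) M (\<lambda>t. m (exp t) x)"
proof (rule smooth_map_action[OF charted_real_space _ smooth_map_const[OF assms]])
  show "smooth_map (real_space S) (real_space {0<..}) exp"
    by (auto simp: smooth_map_real_space intro: smooth_on_exp)
qed

lemma action_field_tangent: "x \<in> points M \<Longrightarrow> action_field M m x \<in> tangent_space M x"
  using velocity_tangent[OF M orbit_smooth[of x UNIV] open_UNIV, of 0]
  by (simp add: action_field_def action_one)

lemma action_field_works:
  "x \<in> points M \<Longrightarrow> h \<in> smooth_funs M \<Longrightarrow>
    ((\<lambda>t. h (m (exp t) x)) has_real_derivative action_field M m x h) (at 0)"
  unfolding action_field_def using velocity_works[OF M orbit_smooth[of x UNIV] _ open_UNIV, of h 0] by simp

text \<open>Euler's identity for the homogeneous function \<open>f\<close>.\<close>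

lemma action_field_f:
  assumes "x \<in> points M"
  shows "action_field M m x f = \<alpha> * f x"
proof (rule DERIV_unique[OF action_field_works[OF assms f_smooth]])
  have "((\<lambda>t. exp (t * \<alpha>) * f x) has_real_derivative \<alpha> * f x) (at 0)"
    by (auto intro!: derivative_eq_intros)
  then show "((\<lambda>t. f (m (exp t) x)) has_real_derivative \<alpha> * f x) (at 0)"
    by (simp add: f_action[OF _ assms] powr_def mult.commute)
qed

lemma g_field_field: "x \<in> points M \<Longrightarrow> g x (action_field M m x) (action_field M m x) = \<alpha> * f x"
  using g_field action_field_tangent action_field_f by simp

text \<open>Since \<open>g(P, P) = df(P) = \<alpha> f\<close>, positivity of \<open>g\<close> determines the sign of the degree.\<close>

lemma \<alpha>_pos: "\<alpha> > 0"
proof -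
  obtain x where x: "x \<in> points M" using M unfolding smooth_manifold_def by blast
  have "\<alpha> \<noteq> 0" using pair by (simp add: homogeneous_pair_def)
  then have "action_field M m x \<noteq> (\<lambda>h. 0)" using action_field_f[OF x] f_pos[OF x] by auto
  then have "g x (action_field M m x) (action_field M m x) > 0"
    using pos x action_field_tangent[OF x] unfolding positive_definite_def by blast
  then show ?thesis using g_field_field[OF x] f_pos[OF x] by (simp add: zero_less_mult_iff)
qed

text \<open>The product rule for a curve moved by a variable group element: the derivative of
  \<open>m (\<mu> t) (c t)\<close> is the sum of the partial derivatives, and moving the group element alone
  differentiates along the orbit, i.e. in the direction of the action field.\<close>

lemma velocity_action:
  assumes c: "smooth_map (real_space S) M c"
    and \<mu>: "(\<mu> has_real_derivative \<mu>') (at t)" "\<mu> t > 0"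
    and U: "open U" "t \<in> U" "U \<subseteq> S" and h: "h \<in> smooth_funs M"
  shows "((\<lambda>s. h (m (\<mu> s) (c s))) has_real_derivative
     velocity M c t (h \<circ> m (\<mu> t)) + (\<mu>' / \<mu> t) * action_field M m (c t) (h \<circ> m (\<mu> t))) (at t)"
proof -
  have ct: "c t \<in> points M" using smooth_map_points[OF c] U by auto
  have hm: "h \<circ> m (\<mu> t) \<in> smooth_funs M" by (rule smooth_funs_action[OF \<mu>(2) h])
  define H where "H p = h (m (fst p) (c (snd p)))" for p
  let ?A = "subset_space ({0<..} \<times> S)"
  have "smooth_map ?A M (\<lambda>p. m (fst p) (c (snd p)))"
  proof (rule smooth_map_action[OF charted_subset_space])
    show "smooth_map ?A (real_space {0<..}) fst"
      by (auto simp: real_space_eq smooth_map_subset_space intro: smooth_on_linear bounded_linear_fst)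
    have "smooth_map ?A (real_space S) snd"
      by (auto simp: real_space_eq smooth_map_subset_space intro: smooth_on_linear bounded_linear_snd)
    from smooth_map_compose[OF charted_subset_space charted_real_space this c]
    show "smooth_map ?A M (\<lambda>p. c (snd p))" by (simp add: o_def)
  qed
  from smooth_map_compose[OF charted_subset_space charted_M this, of "real_space UNIV" h] h
  have "smooth_on ({0<..} \<times> S) H"
    by (simp add: smooth_funs_def real_space_eq smooth_map_subset_space o_def H_def[abs_def])
  then have "H differentiable (at (\<mu> t, t))"
    by (rule smooth_on_differentiable[of _ _ "{0<..} \<times> U"]) (use U \<mu>(2) in \<open>auto simp: open_Times\<close>)
  then obtain D where D: "(H has_derivative D) (at (\<mu> t, t))" by (auto simp: differentiable_def)
  note lin = has_derivative_linear[OF D]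
  have along: "((\<lambda>s. H (a s, b s)) has_real_derivative D (a', b')) (at s0)"
    if "(a has_real_derivative a') (at s0)" "(b has_real_derivative b') (at s0)" "a s0 = \<mu> t" "b s0 = t"
    for a b a' b' s0
  proof -
    have 1: "((\<lambda>s. (a s, b s)) has_derivative (\<lambda>v. (a' * v, b' * v))) (at s0)"
      using that(1,2) by (auto simp: has_field_derivative_def intro: has_derivative_Pair)
    have 2: "(H has_derivative D) (at (a s0, b s0))" using D that(3,4) by simp
    have "(\<lambda>v. D (a' * v, b' * v)) = (*) (D (a', b'))"
      using linear_scale[OF lin, of _ "(a', b')"] by (auto simp: fun_eq_iff mult.commute)
    with has_derivative_compose[OF 1 2] show ?thesis by (simp add: has_field_derivative_def)
  qed
  have D01: "D (0, 1) = velocity M c t (h \<circ> m (\<mu> t))"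
  proof (rule DERIV_unique)
    show "((\<lambda>s. H (\<mu> t, s)) has_real_derivative D (0, 1)) (at t)"
      by (rule along) (auto intro!: derivative_eq_intros)
    show "((\<lambda>s. H (\<mu> t, s)) has_real_derivative velocity M c t (h \<circ> m (\<mu> t))) (at t)"
      using velocity_works[OF M c hm U] by (simp add: H_def)
  qed
  have D10: "D (\<mu> t, 0) = action_field M m (c t) (h \<circ> m (\<mu> t))"
  proof (rule DERIV_unique)
    show "((\<lambda>s. H (\<mu> t * exp s, t)) has_real_derivative D (\<mu> t, 0)) (at 0)"
      by (rule along) (auto intro!: derivative_eq_intros)
    have eq: "(\<lambda>s. H (\<mu> t * exp s, t)) = (\<lambda>s. (h \<circ> m (\<mu> t)) (m (exp s) (c t)))"
      using action_mult[OF \<mu>(2) exp_gt_zero ct] by (simp add: H_def fun_eq_iff)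
    show "((\<lambda>s. H (\<mu> t * exp s, t)) has_real_derivative action_field M m (c t) (h \<circ> m (\<mu> t))) (at 0)"
      unfolding eq by (rule action_field_works[OF ct hm])
  qed
  have "D (\<mu>', 1) = (\<mu>' / \<mu> t) * D (\<mu> t, 0) + D (0, 1)"
    using linear_add[OF lin, of "(\<mu>' / \<mu> t) *\<^sub>R (\<mu> t, 0)" "(0, 1)"] linear_scale[OF lin, of "\<mu>' / \<mu> t" "(\<mu> t, 0)"] \<mu>(2)
    by simp
  moreover have "((\<lambda>s. H (\<mu> s, s)) has_real_derivative D (\<mu>', 1)) (at t)"
    by (rule along) (auto intro!: derivative_eq_intros \<mu>)
  ultimately show ?thesis by (simp add: H_def D01 D10 add.commute)
qed


subsection \<open>The splitting of the metric\<close>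

text \<open>The point of the orbit of \<open>x\<close> that lies on the level \<open>f = l\<close>.\<close>

definition proj :: "real \<Rightarrow> 'a \<Rightarrow> 'a" where
  "proj l x = m ((f x / l) powr (- (1 / \<alpha>))) x"

definition speed_sq :: "(real \<Rightarrow> 'a) \<Rightarrow> real \<Rightarrow> real" where
  "speed_sq c t = g (c t) (velocity M c t) (velocity M c t)"

lemma f_smooth_pos: "smooth_map M (real_space {0<..}) f"
  using f_smooth f_pos by (subst smooth_map_real_codomain[OF charted_M]) (auto simp: smooth_funs_def)

lemma smooth_map_proj:
  assumes "l > 0"
  shows "smooth_map M M (proj l)"
proof -
  have "smooth_on {0<..} (\<lambda>r. (1 / l) powr (- (1 / \<alpha>)) * r powr (- (1 / \<alpha>)))" by (rule smooth_on_powr)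
  then have "smooth_on {0<..} (\<lambda>r. (r / l) powr (- (1 / \<alpha>)))"
    by (rule smooth_on_cong) (use assms in \<open>simp add: powr_mult[symmetric] powr_divide\<close>)
  then have "smooth_map (real_space {0<..}) (real_space {0<..}) (\<lambda>r. (r / l) powr (- (1 / \<alpha>)))"
    using assms by (auto simp: smooth_map_real_space)
  from smooth_map_action[OF charted_M smooth_map_compose[OF charted_M charted_real_space f_smooth_pos this]
      smooth_map_manifold_ident[OF M]]
  show ?thesis by (simp add: proj_def[abs_def])
qed

lemma powr_proj:
  assumes "r > 0" "l > 0"
  shows "((r / l) powr (- (1 / \<alpha>))) powr \<alpha> = l / r"
proof -
  have "((r / l) powr (- (1 / \<alpha>))) powr \<alpha> = (r / l) powr (- 1)"
    unfolding powr_powr using \<alpha>_pos by simp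
  also have "\<dots> = l / r" using assms by (simp add: powr_minus_divide)
  finally show ?thesis .
qed

lemma f_proj:
  assumes "l > 0" "x \<in> points M"
  shows "f (proj l x) = l"
proof -
  have "f x > 0" using f_pos assms by blast
  then show ?thesis using assms by (simp add: proj_def f_action powr_proj)
qed

text \<open>The tangent vector of a curve splits into its component along the orbit, of squared length
  \<open>(f \<circ> c)'\<^sup>2 / (\<alpha> f)\<close>, and the component in \<open>ker df\<close>. These are orthogonal because \<open>g(P, \<cdot>) = df\<close>,
  and the second one is carried isometrically up to the factor \<open>l / f\<close> to the velocity of the curve
  projected to the level set \<open>f = l\<close>. So \<open>g\<close> is the warped product metric
  \<open>dr\<^sup>2 / (\<alpha> r) + (r / l) g\<^sub>l\<close>.\<close>

lemma speed_sq_split: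
  assumes c: "smooth_map (real_space S) M c" and U: "open U" "t \<in> U" "U \<subseteq> S" and "l > 0"
  shows "speed_sq c t = (deriv (\<lambda>s. f (c s)) t)\<^sup>2 / (\<alpha> * f (c t)) + (f (c t) / l) * speed_sq (proj l \<circ> c) t"
proof -
  define x where "x = c t"
  have x: "x \<in> points M" using smooth_map_points[OF c] U by (auto simp: x_def)
  have fx: "f x > 0" by (rule f_pos[OF x])
  define u where "u = velocity M c t"
  have u: "u \<in> tangent_space M x" unfolding u_def x_def by (rule velocity_tangent[OF M c U])
  have df: "((\<lambda>s. f (c s)) has_real_derivative u f) (at t)"
    unfolding u_def by (rule velocity_works[OF M c f_smooth U])
  define P where "P = action_field M m x"
  have P: "P \<in> tangent_space M x" unfolding P_def by (rule action_field_tangent[OF x])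
  have PP: "g x P P = \<alpha> * f x" unfolding P_def by (rule g_field_field[OF x])
  have Pu: "g x P u = u f" unfolding P_def by (rule g_field[OF x u])
  \<comment> \<open>\<open>a\<close> is chosen such that \<open>w = u - a P\<close> satisfies \<open>df(w) = 0\<close>.\<close>
  define a where "a = u f / (\<alpha> * f x)"
  define w where "w = (\<lambda>h. 1 * u h + (- a) * P h)"
  have w: "w \<in> tangent_space M x" unfolding w_def by (rule tangent_space_lincomb[OF u P])
  have "g x w w = g x u w - a * g x P w"
    using g_linear[OF x u P w, of 1 "- a"] by (simp add: w_def)
  also have "g x u w = g x u u - a * u f"
    using g_linear_right[OF x u P u, of 1 "- a"] Pu g_sym[OF x u P] by (simp add: w_def)
  also have "g x P w = u f - a * (\<alpha> * f x)"
    using g_linear_right[OF x u P P, of 1 "- a"] Pu PP by (simp add: w_def)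
  also have "\<dots> = 0" using \<alpha>_pos fx by (simp add: a_def)
  finally have guu: "g x u u = a * u f + g x w w" by simp
  define \<mu> where "\<mu> s = (f (c s) / l) powr (- (1 / \<alpha>))" for s
  have \<mu>0: "\<mu> t > 0" using fx \<open>l > 0\<close> by (simp add: \<mu>_def x_def)
  have d\<mu>: "(\<mu> has_real_derivative - a * \<mu> t) (at t)"
  proof -
    have "((\<lambda>s. (f (c s) / l) powr (- (1 / \<alpha>))) has_real_derivative
       (- (1 / \<alpha>)) * (f (c t) / l) powr (- (1 / \<alpha>) - 1) * (u f / l)) (at t)"
      using fx \<open>l > 0\<close> by (auto intro!: derivative_eq_intros df simp: x_def)
    moreover have "(- (1 / \<alpha>)) * (f (c t) / l) powr (- (1 / \<alpha>) - 1) * (u f / l) = - a * \<mu> t"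
      using fx \<open>l > 0\<close> \<alpha>_pos by (simp add: \<mu>_def a_def x_def powr_diff)
    ultimately show ?thesis by (simp add: \<mu>_def[abs_def])
  qed
  have y: "proj l (c s) = m (\<mu> s) (c s)" for s by (simp add: proj_def \<mu>_def)
  have vy: "velocity M (proj l \<circ> c) t = pushforward M (m (\<mu> t)) w"
  proof
    fix h
    show "velocity M (proj l \<circ> c) t h = pushforward M (m (\<mu> t)) w h"
    proof (cases "h \<in> smooth_funs M")
      case True
      have "deriv (\<lambda>s. h (m (\<mu> s) (c s))) t = u (h \<circ> m (\<mu> t)) + (- a * \<mu> t / \<mu> t) * P (h \<circ> m (\<mu> t))"
        using DERIV_imp_deriv[OF velocity_action[OF c d\<mu> \<mu>0 U True]] by (simp add: u_def P_def x_def)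
      then show ?thesis using True \<mu>0 by (simp add: velocity_def pushforward_def w_def y)
    qed (simp add: velocity_def pushforward_def)
  qed
  have "speed_sq (proj l \<circ> c) t = g (m (\<mu> t) x) (pushforward M (m (\<mu> t)) w) (pushforward M (m (\<mu> t)) w)"
    by (simp add: speed_sq_def vy y x_def)
  also have "\<dots> = \<mu> t powr \<alpha> * g x w w" by (rule g_action[OF \<mu>0 x w w])
  also have "\<mu> t powr \<alpha> = l / f x"
    using fx \<open>l > 0\<close> by (simp add: \<mu>_def powr_proj x_def)
  finally have gww: "g x w w = (f x / l) * speed_sq (proj l \<circ> c) t"
    using fx \<open>l > 0\<close> by (simp add: field_simps del: o_apply)
  have "a * u f = (u f)\<^sup>2 / (\<alpha> * f x)" by (simp add: a_def power2_eq_square)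
  moreover have "deriv (\<lambda>s. f (c s)) t = u f" by (rule DERIV_imp_deriv[OF df])
  ultimately show ?thesis using guu gww by (simp add: speed_sq_def u_def x_def)
qed

lemma speed_sq_nonneg:
  assumes "smooth_map (real_space S) M c" "open U" "t \<in> U" "U \<subseteq> S"
  shows "speed_sq c t \<ge> 0"
proof -
  have "c t \<in> points M" using smooth_map_points[OF assms(1)] assms by auto
  then show ?thesis unfolding speed_sq_def by (intro g_nonneg velocity_tangent[OF M assms])
qed

text \<open>The orbits are flow lines of the action field, and \<open>g(P, P) = \<alpha> f\<close>.\<close>

lemma speed_sq_orbit:
  assumes x: "x \<in> points M"
  shows "speed_sq (\<lambda>t. m (exp t) x) t = \<alpha> * f (m (exp t) x)"
proof -
  have y: "m (exp t) x \<in> points M" by (rule action_in[OF exp_gt_zero x])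
  have "velocity M (\<lambda>t. m (exp t) x) t h = action_field M m (m (exp t) x) h" for h
  proof (cases "h \<in> smooth_funs M")
    case True
    have "((\<lambda>s. h (m (exp s) (m (exp t) x))) has_real_derivative velocity M (\<lambda>t. m (exp t) x) t h) (at 0)"
    proof -
      have "((\<lambda>s. h (m (exp s) x)) has_real_derivative velocity M (\<lambda>t. m (exp t) x) t h) (at (0 + t))"
        using velocity_works[OF M orbit_smooth[OF x, of UNIV] True open_UNIV, of t] by simp
      then have "((\<lambda>s. h (m (exp (s + t)) x)) has_real_derivative velocity M (\<lambda>t. m (exp t) x) t h) (at 0)"
        by (subst (asm) DERIV_shift)
      then show ?thesis by (simp add: exp_add action_mult x)
    qed
    then show ?thesis using DERIV_unique action_field_works[OF y True] by blast
  qed (simp add: velocity_def action_field_def)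
  then have "velocity M (\<lambda>t. m (exp t) x) t = action_field M m (m (exp t) x)" by (rule ext)
  then show ?thesis by (simp add: speed_sq_def g_field_field[OF y])
qed

lemma speed_sq_action:
  assumes c: "smooth_map (real_space S) M c" and U: "open U" "t \<in> U" "U \<subseteq> S" and s: "s > 0"
  shows "speed_sq (m s \<circ> c) t = s powr \<alpha> * speed_sq c t"
proof -
  have x: "c t \<in> points M" using smooth_map_points[OF c] U by auto
  have "velocity M (m s \<circ> c) t = pushforward M (m s) (velocity M c t)"
    using smooth_funs_action[OF s] by (auto simp: velocity_def pushforward_def fun_eq_iff)
  then show ?thesis
    using g_action[OF s x velocity_tangent[OF M c U] velocity_tangent[OF M c U]] by (simp add: speed_sq_def)
qed


subsection \<open>Lengths of paths\<close>

text \<open>In a chart the speed of a smooth piece is a continuous function up to the end points of the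
  piece.\<close>

lemma speed_integrable_locally:
  assumes c: "smooth_map (real_space {s..t}) M c" and x: "x \<in> {s..t}" and \<kappa>: "continuous_on {0<..} \<kappa>"
  obtains d where "d > 0" "\<And>u v. s \<le> u \<Longrightarrow> v \<le> t \<Longrightarrow> {u..v} \<subseteq> ball x d \<Longrightarrow>
     (\<lambda>\<tau>. sqrt (\<kappa> (f (c \<tau>)) * speed_sq c \<tau>)) integrable_on {u..v}"
proof -
  have "c x \<in> points M" using smooth_map_points[OF c] x by auto
  then obtain U \<phi> where U: "(U, \<phi>) \<in> charts M" "c x \<in> U" using charted_cover[OF charted_M] by blast
  note inj = charted_inj_on[OF charted_M U(1)]
  have opU: "open (\<phi> ` U)" using M U(1) unfolding smooth_manifold_def is_chart_def by blast
  define K where "K = {\<tau> \<in> {s..t}. c \<tau> \<in> U}"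
  have "smooth_on K (\<phi> \<circ> c \<circ> inv_into {s..t} (\<lambda>t. t))"
    using smooth_mapD(2)[OF c _ U(1), of "{s..t}" "\<lambda>t. t"] by (simp add: K_def)
  then have smK: "smooth_on K (\<lambda>\<tau>. \<phi> (c \<tau>))"
    by (rule smooth_on_cong) (simp add: inv_into_ident K_def)
  have xK: "x \<in> K" using x U by (simp add: K_def)
  obtain O1 G where O1: "open O1" "x \<in> O1" and G: "\<And>k. Ck_on k O1 G" "\<And>\<tau>. \<tau> \<in> O1 \<Longrightarrow> \<tau> \<in> K \<Longrightarrow> G \<tau> = \<phi> (c \<tau>)"
    using smooth_onE[OF smK xK] by blast
  have "openin (top_of_set {s..t}) {\<tau> \<in> topspace (top_of_set {s..t}). c \<tau> \<in> U}"
    by (rule openin_continuous_map_preimage[OF _ charted_openin[OF charted_M U(1)]])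
       (use smooth_mapD(1)[OF c] in simp)
  then obtain O2 where O2: "open O2" "K = {s..t} \<inter> O2" by (auto simp: K_def openin_open)
  obtain d where d: "d > 0" "ball x d \<subseteq> O1 \<inter> O2"
    using open_contains_ball[of "O1 \<inter> O2"] O1 O2 xK by blast
  define G' where "G' \<tau> = frechet_derivative G (at \<tau>) 1" for \<tau>
  define \<Gamma> where "\<Gamma> i j p = g (inv_into U \<phi> p) (coord_vector M (U, \<phi>) (inv_into U \<phi> p) i)
      (coord_vector M (U, \<phi>) (inv_into U \<phi> p) j)" for i j p
  have cont\<Gamma>: "continuous_on (\<phi> ` U) (\<Gamma> i j)" for i j
  proof (rule smooth_on_continuous_on)
    show "smooth_on (\<phi> ` U) (\<Gamma> i j)"
      using pair U(1) unfolding homogeneous_pair_def pseudo_riemannian_def \<Gamma>_def Let_def by fastforce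
  qed
  show thesis
  proof (rule that[OF d(1)])
    fix u v assume uv: "s \<le> u" "v \<le> t" "{u..v} \<subseteq> ball x d"
    have sub: "{u..v} \<subseteq> K" "{u..v} \<subseteq> O1" using uv d(2) O2(2) by auto
    have contG': "continuous_on {u..v} G'"
      using continuous_on_subset[OF Ck_on_continuous_on sub(2), of 0 G'] G(1)[of "Suc 0"] by (simp add: G'_def[abs_def])
    have cont\<phi>: "continuous_on {u..v} (\<lambda>\<tau>. \<phi> (c \<tau>))"
      by (rule continuous_on_subset[OF smooth_on_continuous_on[OF smK] sub(1)])
    have contf: "continuous_on {u..v} (\<lambda>\<tau>. f (c \<tau>))"
      by (rule continuous_on_subset[OF smooth_on_continuous_on[OF smooth_fun_along_curve[OF M c f_smooth]]])
         (use uv in auto)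
    have cU: "c \<tau> \<in> U" if "\<tau> \<in> {u..v}" for \<tau> using sub that by (auto simp: K_def)
    have cM: "c \<tau> \<in> points M" if "\<tau> \<in> {u..v}" for \<tau> using cU[OF that] charted_subset[OF charted_M U(1)] by blast
    define \<gamma> where "\<gamma> \<tau> = sqrt (\<kappa> (f (c \<tau>)) *
        (\<Sum>i\<in>Basis. \<Sum>j\<in>Basis. (G' \<tau> \<bullet> i) * ((G' \<tau> \<bullet> j) * \<Gamma> i j (\<phi> (c \<tau>)))))" for \<tau>
    have "continuous_on {u..v} \<gamma>"
      unfolding \<gamma>_def
      by (intro continuous_intros contG' continuous_on_compose2[OF cont\<Gamma> cont\<phi>] continuous_on_compose2[OF \<kappa> contf])
         (use cU f_pos cM in auto)
    then have int: "\<gamma> integrable_on {u..v}" by (rule integrable_continuous_real)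
    have "sqrt (\<kappa> (f (c \<tau>)) * speed_sq c \<tau>) = \<gamma> \<tau>" if \<tau>: "\<tau> \<in> {u..v} - {u, v}" for \<tau>
    proof -
      have \<tau>': "\<tau> \<in> {u<..<v}" "\<tau> \<in> {u..v}" using \<tau> by auto
      have vel: "velocity M c \<tau> = coord_vector M (U, \<phi>) (c \<tau>) (G' \<tau>)"
        unfolding G'_def
      proof (rule velocity_coord[OF M U(1) Ck_on_Suc_derivative[OF G(1)] open_greaterThanLessThan \<tau>'(1)])
        show "c \<sigma> \<in> U \<and> G \<sigma> = \<phi> (c \<sigma>)" if "\<sigma> \<in> {u<..<v}" for \<sigma>
        proof -
          have "\<sigma> \<in> {u..v}" using that by auto
          then show ?thesis using cU G(2) sub by blast
        qed
      qed (use sub \<tau>' in auto)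
      let ?E = "coord_vector M (U, \<phi>) (c \<tau>)"
      note T = coord_vector_tangent[OF M U(1) cU[OF \<tau>'(2)]]
      note E = coord_vector_expand[OF M U(1) cU[OF \<tau>'(2)]]
      have inner: "g (c \<tau>) (?E i) (?E (G' \<tau>)) = (\<Sum>j\<in>Basis. (G' \<tau> \<bullet> j) * g (c \<tau>) (?E i) (?E j))" for i
      proof -
        have "g (c \<tau>) (?E i) (?E (G' \<tau>)) = g (c \<tau>) (?E (G' \<tau>)) (?E i)"
          by (rule g_sym[OF cM[OF \<tau>'(2)] T T])
        also have "\<dots> = (\<Sum>j\<in>Basis. (G' \<tau> \<bullet> j) * g (c \<tau>) (?E j) (?E i))"
          unfolding E[of "G' \<tau>"] by (rule g_sum[OF cM[OF \<tau>'(2)] T T])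
        also have "\<dots> = (\<Sum>j\<in>Basis. (G' \<tau> \<bullet> j) * g (c \<tau>) (?E i) (?E j))"
          by (intro sum.cong refl arg_cong[where f = "(*) _"] g_sym[OF cM[OF \<tau>'(2)] T T])
        finally show ?thesis .
      qed
      have "speed_sq c \<tau> = g (c \<tau>) (\<lambda>h. \<Sum>i\<in>Basis. (G' \<tau> \<bullet> i) * ?E i h) (?E (G' \<tau>))"
        unfolding speed_sq_def vel E[of "G' \<tau>", symmetric] by (rule refl)
      also have "\<dots> = (\<Sum>i\<in>Basis. (G' \<tau> \<bullet> i) * g (c \<tau>) (?E i) (?E (G' \<tau>)))"
        by (rule g_sum[OF cM[OF \<tau>'(2)] T T])
      also have "\<dots> = (\<Sum>i\<in>Basis. \<Sum>j\<in>Basis. (G' \<tau> \<bullet> i) * ((G' \<tau> \<bullet> j) * \<Gamma> i j (\<phi> (c \<tau>))))"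
        using cU[OF \<tau>'(2)] inj by (simp add: inner sum_distrib_left \<Gamma>_def inv_into_f_f)
      finally show ?thesis by (simp add: \<gamma>_def)
    qed
    then show "(\<lambda>\<tau>. sqrt (\<kappa> (f (c \<tau>)) * speed_sq c \<tau>)) integrable_on {u..v}"
      by (intro integrable_spike_finite[OF _ _ int, of "{u, v}"]) simp_all
  qed
qed

end


section \<open>Operations on piecewise smooth paths\<close>

definition smooth_pieces :: "('a, 'e::euclidean_space) atlas_space \<Rightarrow> real set \<Rightarrow> (real \<Rightarrow> 'a) \<Rightarrow> bool" where
  "smooth_pieces M D c \<longleftrightarrow>
     (\<forall>s\<in>D. \<forall>t\<in>D. s < t \<and> {s<..<t} \<inter> D = {} \<longrightarrow> smooth_map (real_space {s..t}) M c)"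

lemma smooth_piecesD:
  "smooth_pieces M D c \<Longrightarrow> s \<in> D \<Longrightarrow> t \<in> D \<Longrightarrow> s < t \<Longrightarrow> {s<..<t} \<inter> D = {} \<Longrightarrow>
    smooth_map (real_space {s..t}) M c"
  by (simp add: smooth_pieces_def)

lemma piecewise_smooth_path_iff:
  "piecewise_smooth_path M a b c \<longleftrightarrow> a < b \<and> continuous_map (top_of_set {a..b}) (mtop M) c \<and>
     (\<exists>D. finite D \<and> {a, b} \<subseteq> D \<and> D \<subseteq> {a..b} \<and> smooth_pieces M D c)"
  by (simp add: piecewise_smooth_path_def smooth_pieces_def)

lemma piecewise_smooth_path_dest:
  assumes "piecewise_smooth_path M a b c"
  obtains D where "a < b" "continuous_map (top_of_set {a..b}) (mtop M) c" "finite D" "{a, b} \<subseteq> D" "D \<subseteq> {a..b}"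
    "smooth_pieces M D c"
  using assms unfolding piecewise_smooth_path_iff by blast

text \<open>The smooth piece around a parameter is bounded by the neighbouring break points.\<close>

lemma piecewise_smooth_pathE:
  assumes "piecewise_smooth_path M a b c"
  obtains D where "finite D" "\<forall>x\<in>{a..b} - D. \<exists>s t. s < x \<and> x < t \<and> smooth_map (real_space {s..t}) M c"
proof -
  obtain D where D: "finite D" "{a, b} \<subseteq> D" "smooth_pieces M D c"
    by (rule piecewise_smooth_path_dest[OF assms])
  have "\<exists>s t. s < x \<and> x < t \<and> smooth_map (real_space {s..t}) M c" if x: "x \<in> {a..b} - D" for x
  proof -
    let ?L = "{d \<in> D. d < x}" and ?R = "{d \<in> D. x < d}"
    have L: "finite ?L" "a \<in> ?L" and R: "finite ?R" "b \<in> ?R"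
      using D(1,2) x by (auto simp: less_le)
    have s: "Max ?L \<in> ?L" using L Max_in by blast
    have t: "Min ?R \<in> ?R" using R Min_in by blast
    have False if d: "d \<in> D" "Max ?L < d" "d < Min ?R" for d
    proof (cases d x rule: linorder_cases)
      case less then show False using d Max_ge[OF L(1), of d] by simp
    next
      case equal then show False using d(1) x by simp
    next
      case greater then show False using d Min_le[OF R(1), of d] by simp
    qed
    then have "{Max ?L<..<Min ?R} \<inter> D = {}" by auto
    then have "smooth_map (real_space {Max ?L..Min ?R}) M c"
      by (intro smooth_piecesD[OF D(3)]) (use s t in auto)
    then show ?thesis using s t by blast
  qed
  then show thesis using that[OF D(1)] by blast
qed

text \<open>Stated for an arbitrary finite set of break points, so that the last one can be split off.\<close>

lemma integrable_on_pieces: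
  fixes h :: "real \<Rightarrow> real"
  assumes "finite D" "D \<noteq> {}"
    and "\<And>s t. s \<in> D \<Longrightarrow> t \<in> D \<Longrightarrow> s < t \<Longrightarrow> {s<..<t} \<inter> D = {} \<Longrightarrow> h integrable_on {s..t}"
  shows "h integrable_on {Min D..Max D}"
  using assms
proof (induction D rule: finite_linorder_max_induct)
  case (insert b A)
  show ?case
  proof (cases "A = {}")
    case True
    then show ?thesis using integrable_on_refl[of h b] by simp
  next
    case False
    note A = \<open>finite A\<close> False
    have "h integrable_on {Min A..Max A}"
      by (rule insert.IH[OF False insert.prems(2)]) (use insert.hyps(2) in fastforce)+
    moreover have "h integrable_on {Max A..b}"
      by (rule insert.prems(2)) (use Max_in[OF A] Max_ge[OF A(1)] insert.hyps(2) in fastforce)+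
    moreover have "Max A < b" using insert.hyps(2) Max_in[OF A] by blast
    moreover have "Min A \<le> Max A" using Min_le[OF A(1) Max_in[OF A]] .
    ultimately have "h integrable_on {Min A..b}"
      using Henstock_Kurzweil_Integration.integrable_combine[of "Min A" "Max A" b h] by simp
    moreover have "Min (insert b A) = Min A" "Max (insert b A) = b"
      using A \<open>Max A < b\<close> \<open>Min A \<le> Max A\<close> by (simp_all add: min_absorb2 max_absorb1)
    ultimately show ?thesis by simp
  qed
qed simp

lemma piecewise_smooth_path_compose:
  assumes c: "piecewise_smooth_path M a b c" and M: "charted M" and F: "smooth_map M N F"
  shows "piecewise_smooth_path N a b (F \<circ> c)"
proof -
  have "smooth_map (real_space S) N (F \<circ> c)" if "smooth_map (real_space S) M c" for S
    by (rule smooth_map_compose[OF charted_real_space M that F])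
  moreover have "continuous_map (top_of_set {a..b}) (mtop N) (F \<circ> c)"
    using c continuous_map_compose[OF _ smooth_mapD(1)[OF F]] by (auto simp: piecewise_smooth_path_def)
  ultimately show ?thesis using c unfolding piecewise_smooth_path_def by meson
qed

lemma piecewise_smooth_path_smooth:
  assumes "a < b" "smooth_map (real_space {a..b}) M c"
  shows "piecewise_smooth_path M a b c"
  unfolding piecewise_smooth_path_def
proof (intro conjI exI[of _ "{a, b}"] ballI impI)
  show "continuous_map (top_of_set {a..b}) (mtop M) c" using smooth_mapD(1)[OF assms(2)] by simp
  fix s t assume "s \<in> {a, b}" "t \<in> {a, b}" "s < t \<and> {s<..<t} \<inter> {a, b} = {}"
  then have "s = a" "t = b" using assms(1) by auto
  then show "smooth_map (real_space {s..t}) M c" using assms(2) by simp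
qed (use assms in auto)

lemma piecewise_smooth_path_points:
  "piecewise_smooth_path M a b c \<Longrightarrow> t \<in> {a..b} \<Longrightarrow> c t \<in> points M"
  unfolding piecewise_smooth_path_def by (metis continuous_map_funspace funcset_mem topspace_euclidean_subtopology)

text \<open>Reflections give the symmetry of the distance. Two of them make a translation of the
  parameter, which is what the concatenation of paths requires.\<close>

lemma piecewise_smooth_path_reflect:
  assumes c: "piecewise_smooth_path M a b c"
  shows "piecewise_smooth_path M (k - b) (k - a) (\<lambda>t. c (k - t))"
proof -
  obtain D where D: "a < b" "continuous_map (top_of_set {a..b}) (mtop M) c"
    "finite D" "{a, b} \<subseteq> D" "D \<subseteq> {a..b}" "smooth_pieces M D c"
    by (rule piecewise_smooth_path_dest[OF c])
  let ?D = "(\<lambda>d. k - d) ` D"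
  have sh: "smooth_map (real_space {s..t}) (real_space {k - t..k - s}) (\<lambda>x. k - x)" for s t :: real
  proof -
    have "Ck_on j UNIV (\<lambda>x. k + - x)" for j
      by (intro Ck_on_add Ck_on_const Ck_on_linear bounded_linear_minus bounded_linear_ident open_UNIV)
    then have "smooth_on UNIV (\<lambda>x. k + - x)" by (rule smooth_onI_open[OF open_UNIV])
    then have "smooth_on {s..t} (\<lambda>x. k - x)" using smooth_on_subset[OF _ subset_UNIV] by simp
    then show ?thesis by (auto simp: smooth_map_real_space)
  qed
  show ?thesis
    unfolding piecewise_smooth_path_iff smooth_pieces_def
  proof (intro conjI exI[of _ ?D] ballI impI)
    show "continuous_map (top_of_set {k - b..k - a}) (mtop M) (\<lambda>t. c (k - t))"
      using continuous_map_compose[OF smooth_mapD(1)[OF sh[of "k - b" "k - a"]], of "mtop M" c] D(2)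
      by (simp add: o_def)
    fix s t assume st: "s \<in> ?D" "t \<in> ?D" "s < t \<and> {s<..<t} \<inter> ?D = {}"
    have "False" if "d \<in> D" "k - t < d" "d < k - s" for d
    proof -
      have "k - d \<in> {s<..<t} \<inter> ?D" using that by auto
      with st show False by blast
    qed
    then have "{k - t<..<k - s} \<inter> D = {}" by auto
    then have "smooth_map (real_space {k - t..k - s}) M c"
      using st by (intro smooth_piecesD[OF D(6)]) auto
    from smooth_map_compose[OF charted_real_space charted_real_space sh this]
    show "smooth_map (real_space {s..t}) M (\<lambda>t. c (k - t))" by (simp add: o_def)
  qed (use D in auto)
qed

lemma piecewise_smooth_path_join:
  assumes c1: "piecewise_smooth_path M a b c1" and c2: "piecewise_smooth_path M b d c2" and eq: "c1 b = c2 b"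
  shows "piecewise_smooth_path M a d (\<lambda>t. if t \<le> b then c1 t else c2 t)" (is "piecewise_smooth_path M a d ?c")
proof -
  obtain D where D: "a < b" "continuous_map (top_of_set {a..b}) (mtop M) c1"
    "finite D" "{a, b} \<subseteq> D" "D \<subseteq> {a..b}"
    "smooth_pieces M D c1"
    by (rule piecewise_smooth_path_dest[OF c1])
  obtain E where E: "b < d" "continuous_map (top_of_set {b..d}) (mtop M) c2"
    "finite E" "{b, d} \<subseteq> E" "E \<subseteq> {b..d}"
    "smooth_pieces M E c2"
    by (rule piecewise_smooth_path_dest[OF c2])
  show ?thesis
    unfolding piecewise_smooth_path_iff smooth_pieces_def
  proof (intro conjI exI[of _ "D \<union> E"] ballI impI)
    show "continuous_map (top_of_set {a..d}) (mtop M) ?c"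
    proof (rule continuous_map_cases_le)
      have "{x \<in> topspace (top_of_set {a..d}). x \<le> b} = {a..b}" "{x \<in> topspace (top_of_set {a..d}). b \<le> x} = {b..d}"
        using D(1) E(1) by auto
      then show "continuous_map (subtopology (top_of_set {a..d}) {x \<in> topspace (top_of_set {a..d}). x \<le> b}) (mtop M) c1"
        "continuous_map (subtopology (top_of_set {a..d}) {x \<in> topspace (top_of_set {a..d}). b \<le> x}) (mtop M) c2"
        using D(1,2) E(1,2) by (simp_all add: subtopology_subtopology)
    qed (use eq in auto)
    fix s t assume st: "s \<in> D \<union> E" "t \<in> D \<union> E" "s < t \<and> {s<..<t} \<inter> (D \<union> E) = {}"
    have "b \<in> D" using D by auto
    with st have "b \<notin> {s<..<t}" by blast
    then consider "t \<le> b" | "b \<le> s" by fastforce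
    then show "smooth_map (real_space {s..t}) M ?c"
    proof cases
      case 1
      then have "s \<in> D" "t \<in> D" using st D(4) E(5) by fastforce+
      then have "smooth_map (real_space {s..t}) M c1" using st by (intro smooth_piecesD[OF D(6)]) auto
      then show ?thesis by (rule smooth_map_cong[OF charted_real_space]) (use 1 in auto)
    next
      case 2
      then have "s \<in> E" "t \<in> E" using st E(4) D(5) by fastforce+
      then have "smooth_map (real_space {s..t}) M c2" using st by (intro smooth_piecesD[OF E(6)]) auto
      then show ?thesis
      proof (rule smooth_map_cong[OF charted_real_space])
        fix x assume "x \<in> points (real_space {s..t})"
        with 2 have "b \<le> x" by simp
        with eq show "c2 x = (if x \<le> b then c1 x else c2 x)" by (cases "x = b") auto
      qed
    qed
  qed (use D E in auto)
qed

text \<open>At the break points of a path the velocity is the derivative of a function that need not be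
  differentiable, hence meaningless. Comparisons of integrands are available only away from these
  points.\<close>

lemma integral_mono_except_finite:
  fixes h k :: "real \<Rightarrow> real"
  assumes "finite D" "h integrable_on S" "k integrable_on S" "\<And>x. x \<in> S - D \<Longrightarrow> h x \<le> k x"
  shows "integral S h \<le> integral S k"
proof -
  define h' where "h' x = (if x \<in> D then 0 else h x)" for x
  define k' where "k' x = (if x \<in> D then 0 else k x)" for x
  have "h' integrable_on S" "k' integrable_on S"
    by (rule integrable_spike_finite[OF assms(1) _ assms(2)], simp add: h'_def,
        rule integrable_spike_finite[OF assms(1) _ assms(3)], simp add: k'_def)
  then have "integral S h' \<le> integral S k'"
    by (rule integral_le) (use assms(4) in \<open>auto simp: h'_def k'_def\<close>)
  moreover have "integral S h' = integral S h" "integral S k' = integral S k"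
    by (rule integral_spike[OF negligible_finite[OF assms(1)]]; simp add: h'_def k'_def)+
  ultimately show ?thesis by simp
qed


section \<open>Lengths and distances of a homogeneous pair\<close>

context homogeneous_riemannian
begin

text \<open>The length for the metric \<open>(\<kappa> \<circ> f) g\<close>.\<close>

definition len :: "(real \<Rightarrow> real) \<Rightarrow> real \<Rightarrow> real \<Rightarrow> (real \<Rightarrow> 'a) \<Rightarrow> real" where
  "len \<kappa> a b c = integral {a..b} (\<lambda>t. sqrt (\<kappa> (f (c t)) * speed_sq c t))"

lemma speed_integrable:
  assumes c: "piecewise_smooth_path M a b c" and \<kappa>: "continuous_on {0<..} \<kappa>"
  shows "(\<lambda>t. sqrt (\<kappa> (f (c t)) * speed_sq c t)) integrable_on {a..b}" (is "?F integrable_on _")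
proof -
  obtain D where D: "finite D" "{a, b} \<subseteq> D" "D \<subseteq> {a..b}" "smooth_pieces M D c"
    by (rule piecewise_smooth_path_dest[OF c])
  have "?F integrable_on {s..t}" if c: "smooth_map (real_space {s..t}) M c" for s t
    unfolding box_real(2)[symmetric]
  proof (rule integrable_on_little_subintervals, intro ballI)
    fix x assume "x \<in> cbox s t"
    then have "x \<in> {s..t}" by simp
    from speed_integrable_locally[OF c this \<kappa>] obtain d where d: "d > 0"
      "\<And>u v. s \<le> u \<Longrightarrow> v \<le> t \<Longrightarrow> {u..v} \<subseteq> ball x d \<Longrightarrow> ?F integrable_on {u..v}" by blast
    then show "\<exists>d>0. \<forall>u v. x \<in> cbox u v \<and> cbox u v \<subseteq> ball x d \<and> cbox u v \<subseteq> cbox s t \<longrightarrow> ?F integrable_on cbox u v"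
      by (intro exI[of _ d]) auto
  qed
  then have "?F integrable_on {Min D..Max D}"
    using D smooth_piecesD[OF D(4)] by (intro integrable_on_pieces) auto
  moreover have "Min D = a" "Max D = b" using D by (auto intro!: Min_eqI Max_eqI)
  ultimately show ?thesis by simp
qed

text \<open>At the end points the velocity depends on the curve outside of the interval, where the two
  curves may differ.\<close>

lemma len_cong:
  assumes "\<And>t. t \<in> {a..b} \<Longrightarrow> c t = c' t"
  shows "len \<kappa> a b c = len \<kappa> a b c'"
  unfolding len_def
proof (rule integral_spike[of "{a, b}"])
  fix t assume t: "t \<in> {a..b} - {a, b}"
  then have "velocity M c t = velocity M c' t"
    by (intro velocity_cong_open[of "{a<..<b}"]) (use assms in auto)
  then show "sqrt (\<kappa> (f (c' t)) * speed_sq c' t) = sqrt (\<kappa> (f (c t)) * speed_sq c t)"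
    using t assms by (simp add: speed_sq_def)
qed simp

lemma smooth_interior:
  assumes "s < x" "x < t" "smooth_map (real_space {s..t}) M c"
  shows "speed_sq c x \<ge> 0" "f (c x) > 0"
proof -
  show "speed_sq c x \<ge> 0"
    by (rule speed_sq_nonneg[OF assms(3) open_greaterThanLessThan[of s t]]) (use assms in auto)
  show "f (c x) > 0"
    by (rule f_pos[OF smooth_map_points[OF assms(3)]]) (use assms in auto)
qed

lemma len_nonneg:
  assumes c: "piecewise_smooth_path M a b c" and \<kappa>: "continuous_on {0<..} \<kappa>" "\<And>r. r > 0 \<Longrightarrow> \<kappa> r > 0"
    and sub: "{a'..b'} \<subseteq> {a..b}"
  shows "len \<kappa> a' b' c \<ge> 0"
proof -
  obtain D where D: "finite D"
    "\<forall>x\<in>{a..b} - D. \<exists>s t. s < x \<and> x < t \<and> smooth_map (real_space {s..t}) M c"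
    by (rule piecewise_smooth_pathE[OF c])
  have "integral {a'..b'} (\<lambda>t. 0) \<le> len \<kappa> a' b' c"
    unfolding len_def
  proof (rule integral_mono_except_finite[OF D(1)])
    show "(\<lambda>t. sqrt (\<kappa> (f (c t)) * speed_sq c t)) integrable_on {a'..b'}"
      by (rule integrable_on_subinterval[OF speed_integrable[OF c \<kappa>(1)] sub])
    fix x assume x: "x \<in> {a'..b'} - D"
    then obtain s t where "s < x" "x < t" "smooth_map (real_space {s..t}) M c" using D(2)[rule_format, of x] sub by auto
    from smooth_interior[OF this] show "0 \<le> sqrt (\<kappa> (f (c x)) * speed_sq c x)"
      using \<kappa>(2) by (simp add: less_imp_le)
  qed (rule integrable_0)
  then show ?thesis by simp
qed

lemma len_combine:
  assumes c: "piecewise_smooth_path M a b c" and \<kappa>: "continuous_on {0<..} \<kappa>" and x: "a \<le> x" "x \<le> b"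
  shows "len \<kappa> a x c + len \<kappa> x b c = len \<kappa> a b c"
  unfolding len_def by (rule Henstock_Kurzweil_Integration.integral_combine[OF x speed_integrable[OF c \<kappa>]])

lemma len_reflect:
  assumes c: "piecewise_smooth_path M a b c"
  shows "len \<kappa> (k - b) (k - a) (\<lambda>t. c (k - t)) = len \<kappa> a b c"
proof -
  obtain D where D: "finite D"
    "\<forall>x\<in>{a..b} - D. \<exists>s t. s < x \<and> x < t \<and> smooth_map (real_space {s..t}) M c"
    by (rule piecewise_smooth_pathE[OF c])
  let ?F = "\<lambda>t. sqrt (\<kappa> (f (c t)) * speed_sq c t)"
  have "len \<kappa> (k - b) (k - a) (\<lambda>t. c (k - t)) = integral {k - b..k - a} (\<lambda>t. ?F (k - t))"
    unfolding len_def
  proof (rule integral_spike[of "(\<lambda>d. k - d) ` D"])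
    show "negligible ((\<lambda>d. k - d) ` D)" using D(1) by (intro negligible_finite) simp
    fix t assume t: "t \<in> {k - b..k - a} - (\<lambda>d. k - d) ` D"
    have "k - t \<notin> D"
    proof
      assume "k - t \<in> D"
      then have "k - (k - t) \<in> (\<lambda>d. k - d) ` D" by (rule imageI)
      then show False using t by simp
    qed
    then obtain s u where su: "s < k - t" "k - t < u" "smooth_map (real_space {s..u}) M c"
      using D(2)[rule_format, of "k - t"] t by auto
    have U: "open {s<..<u}" "k - t \<in> {s<..<u}" "{s<..<u} \<subseteq> {s..u}" using su by auto
    have ct: "c (k - t) \<in> points M" using smooth_map_points[OF su(3)] su by simp
    let ?v = "velocity M c (k - t)"
    have v: "?v \<in> tangent_space M (c (k - t))" by (rule velocity_tangent[OF M su(3) U])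
    have "velocity M (\<lambda>t. c (k - t)) t h = - 1 * ?v h + 0 * ?v h" for h
    proof (cases "h \<in> smooth_funs M")
      case True
      have "((\<lambda>t. h (c (k - t))) has_real_derivative ?v h * - 1) (at t)"
        by (rule DERIV_chain'[of "\<lambda>t. k - t"]) (use velocity_works[OF M su(3) True U] in \<open>auto intro!: derivative_eq_intros\<close>)
      then show ?thesis using True DERIV_imp_deriv by (fastforce simp: velocity_def)
    qed (simp add: velocity_def)
    then have vel: "velocity M (\<lambda>t. c (k - t)) t = (\<lambda>h. - 1 * ?v h + 0 * ?v h)" by (rule ext)
    have "speed_sq (\<lambda>t. c (k - t)) t = speed_sq c (k - t)"
      unfolding speed_sq_def vel g_linear[OF ct v v tangent_space_lincomb[OF v v]] g_linear_right[OF ct v v v]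
      by simp
    then show "?F (k - t) = sqrt (\<kappa> (f (c (k - t))) * speed_sq (\<lambda>t. c (k - t)) t)" by simp
  qed
  also have "\<dots> = integral {- b..- a} (\<lambda>t. ?F (- t))"
    using integral_shift_cbox[of "- b" "- k" "- a" "\<lambda>t. ?F (- t)"] by (simp add: algebra_simps)
  also have "\<dots> = len \<kappa> a b c" unfolding len_def by (rule Henstock_Kurzweil_Integration.integral_reflect_real[where f = ?F])
  finally show ?thesis .
qed

text \<open>Shifting the parameter is reflecting twice.\<close>

lemma
  assumes "piecewise_smooth_path M a b c"
  shows piecewise_smooth_path_shift: "piecewise_smooth_path M (a - k) (b - k) (\<lambda>t. c (t + k))"
    and len_shift: "len \<kappa> (a - k) (b - k) (\<lambda>t. c (t + k)) = len \<kappa> a b c"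
proof -
  note r = piecewise_smooth_path_reflect[OF assms, of 0]
  show "piecewise_smooth_path M (a - k) (b - k) (\<lambda>t. c (t + k))"
    using piecewise_smooth_path_reflect[OF r, of "- k"] by (simp add: add.commute)
  show "len \<kappa> (a - k) (b - k) (\<lambda>t. c (t + k)) = len \<kappa> a b c"
    using len_reflect[OF r, of \<kappa> "- k"] len_reflect[OF assms, of \<kappa> 0] by (simp add: add.commute)
qed

text \<open>Dropping the part of the speed tangential to the level sets leaves the speed of \<open>T \<circ> f \<circ> c\<close>,
  whose integral is at least the difference of its end values. The intermediate parameter \<open>t0\<close> is
  allowed for the sake of paths that leave a shell and come back.\<close>

lemma radial_length_le:
  assumes c: "piecewise_smooth_path M a b c" and \<kappa>: "continuous_on {0<..} \<kappa>" "\<And>r. r > 0 \<Longrightarrow> \<kappa> r > 0"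
    and T: "\<And>r. r > 0 \<Longrightarrow> (T has_real_derivative sqrt (\<kappa> r / (\<alpha> * r))) (at r)"
    and t0: "a \<le> t0" "t0 \<le> b"
  shows "\<bar>T (f (c t0)) - T (f (c a))\<bar> \<le> len \<kappa> a b c"
proof -
  obtain D where D: "finite D"
    "\<forall>x\<in>{a..b} - D. \<exists>s t. s < x \<and> x < t \<and> smooth_map (real_space {s..t}) M c"
    by (rule piecewise_smooth_pathE[OF c])
  have contT: "continuous_on {0<..} T"
    by (rule DERIV_continuous_on[where D = "\<lambda>r. sqrt (\<kappa> r / (\<alpha> * r))"]) (rule has_field_derivative_at_within[OF T], simp)
  have contf: "continuous_on {a..b} (\<lambda>t. f (c t))"
  proof -
    have "continuous_map (top_of_set {a..b}) (mtop M) c" using c by (auto simp: piecewise_smooth_path_def)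
    moreover have "continuous_map (mtop M) euclidean f" using f_smooth by (auto simp: smooth_funs_iff)
    ultimately have "continuous_map (top_of_set {a..b}) euclidean (f \<circ> c)" by (rule continuous_map_compose)
    then show ?thesis by (simp add: o_def)
  qed
  have fpos: "f (c t) > 0" if "t \<in> {a..b}" for t
    using f_pos[OF piecewise_smooth_path_points[OF c that]] .
  define F' where "F' t = sqrt (\<kappa> (f (c t)) / (\<alpha> * f (c t))) * deriv (\<lambda>s. f (c s)) t" for t
  have sub: "{a..t0} \<subseteq> {a..b}" using t0 by auto
  have F': "(F' has_integral (T (f (c t0)) - T (f (c a)))) {a..t0}"
  proof (rule fundamental_theorem_of_calculus_interior_strong[OF D(1) t0(1)])
    show "continuous_on {a..t0} (\<lambda>t. T (f (c t)))"
      by (rule continuous_on_compose2[OF contT continuous_on_subset[OF contf sub]]) (use fpos t0 in auto)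
    fix x assume x: "x \<in> {a<..<t0} - D"
    then obtain s u where su: "s < x" "x < u" "smooth_map (real_space {s..u}) M c"
      using D(2)[rule_format, of x] t0 by auto
    have "((\<lambda>s. f (c s)) has_real_derivative velocity M c x f) (at x)"
      by (rule velocity_works[OF M su(3) f_smooth open_greaterThanLessThan]) (use su in auto)
    then have "((\<lambda>s. f (c s)) has_real_derivative deriv (\<lambda>s. f (c s)) x) (at x)"
      by (simp add: DERIV_imp_deriv)
    moreover have "f (c x) > 0" using x t0 by (intro fpos) auto
    ultimately have "((\<lambda>t. T (f (c t))) has_real_derivative F' x) (at x)"
      unfolding F'_def by (intro DERIV_chain'[OF _ T])
    then show "((\<lambda>t. T (f (c t))) has_vector_derivative F' x) (at x)"
      by (rule has_real_derivative_iff_has_vector_derivative[THEN iffD1])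
  qed
  have le: "\<bar>F' x\<bar> \<le> sqrt (\<kappa> (f (c x)) * speed_sq c x)" if x: "x \<in> {a..b} - D" for x
  proof -
    obtain s u where su: "s < x" "x < u" "smooth_map (real_space {s..u}) M c"
      using D(2)[rule_format, of x] x by auto
    have U: "open {s<..<u}" "x \<in> {s<..<u}" "{s<..<u} \<subseteq> {s..u}" using su by auto
    have fx: "f (c x) > 0" using smooth_interior[OF su] by simp
    have "smooth_map (real_space {s..u}) M (proj 1 \<circ> c)"
      using smooth_map_compose[OF charted_real_space charted_M su(3) smooth_map_proj[of 1]] by simp
    from speed_sq_nonneg[OF this U] speed_sq_split[OF su(3) U, of 1] fx
    have "(deriv (\<lambda>s. f (c s)) x)\<^sup>2 / (\<alpha> * f (c x)) \<le> speed_sq c x" by simp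
    then have "\<kappa> (f (c x)) * ((deriv (\<lambda>s. f (c s)) x)\<^sup>2 / (\<alpha> * f (c x))) \<le> \<kappa> (f (c x)) * speed_sq c x"
      using \<kappa>(2)[OF fx] by (intro mult_left_mono) auto
    moreover have "\<bar>F' x\<bar> = sqrt (\<kappa> (f (c x)) * ((deriv (\<lambda>s. f (c s)) x)\<^sup>2 / (\<alpha> * f (c x))))"
      using \<kappa>(2)[OF fx] fx \<alpha>_pos by (simp add: F'_def abs_mult real_sqrt_mult real_sqrt_divide)
    ultimately show ?thesis by simp
  qed
  have int: "(\<lambda>t. sqrt (\<kappa> (f (c t)) * speed_sq c t)) integrable_on {a..t0}"
    by (rule integrable_on_subinterval[OF speed_integrable[OF c \<kappa>(1)] sub])
  have intF: "F' integrable_on {a..t0}" using F' by blast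
  have "T (f (c t0)) - T (f (c a)) \<le> len \<kappa> a t0 c"
    unfolding len_def integral_unique[OF F', symmetric]
    by (rule integral_mono_except_finite[OF D(1) intF int]) (use le sub in fastforce)
  moreover have "integral {a..t0} (\<lambda>t. - F' t) \<le> len \<kappa> a t0 c"
    unfolding len_def
    by (rule integral_mono_except_finite[OF D(1) integrable_neg[OF intF] int]) (use le sub in fastforce)
  moreover have "integral {a..t0} (\<lambda>t. - F' t) = - (T (f (c t0)) - T (f (c a)))"
    using integral_unique[OF F'] by simp
  moreover have "len \<kappa> a t0 c \<le> len \<kappa> a b c"
    using len_combine[OF c \<kappa>(1) t0] len_nonneg[OF c \<kappa>, of t0 b] t0 by simp
  ultimately show ?thesis by linarith
qed

text \<open>Dropping the radial part of the speed instead leaves the speed of the projected path times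
  \<open>sqrt (\<kappa>(f) * f / l)\<close>.\<close>

lemma proj_length_le:
  assumes c: "piecewise_smooth_path M a b c" and \<kappa>: "continuous_on {0<..} \<kappa>" "\<And>r. r > 0 \<Longrightarrow> \<kappa> r > 0"
    and l: "l > 0" and \<beta>: "\<beta> \<ge> 0" "\<And>t. t \<in> {a..b} \<Longrightarrow> \<beta> \<le> sqrt (\<kappa> (f (c t)) * (f (c t) / l))"
  shows "\<beta> * len (\<lambda>_. 1) a b (proj l \<circ> c) \<le> len \<kappa> a b c"
proof -
  obtain D where D: "finite D"
    "\<forall>x\<in>{a..b} - D. \<exists>s t. s < x \<and> x < t \<and> smooth_map (real_space {s..t}) M c"
    by (rule piecewise_smooth_pathE[OF c])
  have c': "piecewise_smooth_path M a b (proj l \<circ> c)"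
    by (rule piecewise_smooth_path_compose[OF c charted_M smooth_map_proj[OF l]])
  have int: "(\<lambda>t. \<beta> * sqrt (1 * speed_sq (proj l \<circ> c) t)) integrable_on {a..b}"
    using integrable_on_mult_right[OF speed_integrable[OF c' continuous_on_const, of 1]] by simp
  have "integral {a..b} (\<lambda>t. \<beta> * sqrt (1 * speed_sq (proj l \<circ> c) t)) \<le> len \<kappa> a b c"
    unfolding len_def
  proof (rule integral_mono_except_finite[OF D(1) int speed_integrable[OF c \<kappa>(1)]])
    fix x assume x: "x \<in> {a..b} - D"
    then obtain s u where su: "s < x" "x < u" "smooth_map (real_space {s..u}) M c"
      using D(2)[rule_format, of x] by auto
    have U: "open {s<..<u}" "x \<in> {s<..<u}" "{s<..<u} \<subseteq> {s..u}" using su by auto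
    have fx: "f (c x) > 0" using smooth_interior[OF su] by simp
    have "smooth_map (real_space {s..u}) M (proj l \<circ> c)"
      by (rule smooth_map_compose[OF charted_real_space charted_M su(3) smooth_map_proj[OF l]])
    from speed_sq_nonneg[OF this U] have nn: "speed_sq (proj l \<circ> c) x \<ge> 0" .
    have "\<beta> * sqrt (speed_sq (proj l \<circ> c) x) \<le> sqrt (\<kappa> (f (c x)) * (f (c x) / l)) * sqrt (speed_sq (proj l \<circ> c) x)"
      using \<beta>(2)[of x] x nn by (intro mult_right_mono) auto
    also have "\<dots> = sqrt (\<kappa> (f (c x)) * ((f (c x) / l) * speed_sq (proj l \<circ> c) x))"
      by (simp add: real_sqrt_mult[symmetric] mult.assoc)
    also have "\<dots> \<le> sqrt (\<kappa> (f (c x)) * speed_sq c x)"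
      using speed_sq_split[OF su(3) U l] \<kappa>(2)[OF fx] fx \<alpha>_pos by (intro real_sqrt_le_mono mult_left_mono) auto
    finally show "\<beta> * sqrt (1 * speed_sq (proj l \<circ> c) x) \<le> sqrt (\<kappa> (f (c x)) * speed_sq c x)" by simp
  qed
  then show ?thesis by (simp add: len_def)
qed

text \<open>Along an orbit there is no tangential part, so the estimate for the radial length is an
  equality.\<close>

lemma orbit_length:
  assumes x: "x \<in> points M" and \<kappa>: "continuous_on {0<..} \<kappa>" "\<And>r. r > 0 \<Longrightarrow> \<kappa> r > 0"
    and T: "\<And>r. r > 0 \<Longrightarrow> (T has_real_derivative sqrt (\<kappa> r / (\<alpha> * r))) (at r)" and "\<tau> > 0"
  shows "len \<kappa> 0 \<tau> (\<lambda>t. m (exp t) x) = T (f (m (exp \<tau>) x)) - T (f x)"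
proof -
  let ?f = "\<lambda>t. f (m (exp t) x)"
  have f: "?f t = exp (t * \<alpha>) * f x" for t by (simp add: f_action[OF _ x] powr_def mult.commute)
  have fp: "?f t > 0" for t by (rule f_pos[OF action_in[OF exp_gt_zero x]])
  have "((\<lambda>t. sqrt (\<kappa> (?f t) * speed_sq (\<lambda>t. m (exp t) x) t)) has_integral (T (?f \<tau>) - T (?f 0))) {0..\<tau>}"
  proof (rule fundamental_theorem_of_calculus)
    fix t
    have "((\<lambda>t. exp (t * \<alpha>) * f x) has_real_derivative \<alpha> * (exp (t * \<alpha>) * f x)) (at t)"
      by (auto intro!: derivative_eq_intros)
    then have df: "(?f has_real_derivative \<alpha> * ?f t) (at t)" by (simp only: f)
    have "sqrt (\<kappa> (?f t) / (\<alpha> * ?f t)) * (\<alpha> * ?f t) = sqrt (\<kappa> (?f t) * speed_sq (\<lambda>t. m (exp t) x) t)"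
    proof -
      have "\<alpha> * ?f t > 0" using fp \<alpha>_pos by simp
      then have "\<alpha> * ?f t / sqrt (\<alpha> * ?f t) = sqrt (\<alpha> * ?f t)" by (simp add: real_div_sqrt)
      moreover have "sqrt (\<kappa> (?f t) / (\<alpha> * ?f t)) * (\<alpha> * ?f t) = sqrt (\<kappa> (?f t)) * (\<alpha> * ?f t / sqrt (\<alpha> * ?f t))"
        by (simp only: real_sqrt_divide times_divide_eq_left times_divide_eq_right)
      ultimately show ?thesis by (simp only: speed_sq_orbit[OF x] real_sqrt_mult)
    qed
    then have "((\<lambda>t. T (?f t)) has_real_derivative sqrt (\<kappa> (?f t) * speed_sq (\<lambda>t. m (exp t) x) t)) (at t)"
      using DERIV_chain'[OF df T[OF fp]] by simp
    then show "((\<lambda>t. T (?f t)) has_vector_derivative sqrt (\<kappa> (?f t) * speed_sq (\<lambda>t. m (exp t) x) t)) (at t within {0..\<tau>})"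
      using has_real_derivative_iff_has_vector_derivative has_vector_derivative_at_within by blast
  qed (use \<open>\<tau> > 0\<close> in simp)
  from integral_unique[OF this] show ?thesis by (simp only: len_def exp_zero action_one[OF x])
qed

text \<open>A level set is carried to another one by a homothety of \<open>g\<close>, while \<open>\<kappa> \<circ> f\<close> is constant on each
  of them.\<close>

lemma action_length:
  assumes c: "piecewise_smooth_path M a b c" and fl: "\<And>t. t \<in> {a..b} \<Longrightarrow> f (c t) = l" and "l > 0" "s > 0"
    and \<kappa>: "continuous_on {0<..} \<kappa>" "\<And>r. r > 0 \<Longrightarrow> \<kappa> r > 0"
  shows "len \<kappa> a b (m s \<circ> c) = sqrt (\<kappa> (s powr \<alpha> * l) * s powr \<alpha>) * len (\<lambda>_. 1) a b c"
proof -
  obtain D where D: "finite D"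
    "\<forall>x\<in>{a..b} - D. \<exists>s t. s < x \<and> x < t \<and> smooth_map (real_space {s..t}) M c"
    by (rule piecewise_smooth_pathE[OF c])
  have "len \<kappa> a b (m s \<circ> c) =
      integral {a..b} (\<lambda>t. sqrt (\<kappa> (s powr \<alpha> * l) * s powr \<alpha>) * sqrt (1 * speed_sq c t))"
    unfolding len_def
  proof (rule integral_spike[OF negligible_finite[OF D(1)]])
    fix x assume x: "x \<in> {a..b} - D"
    then obtain r u where su: "r < x" "x < u" "smooth_map (real_space {r..u}) M c"
      using D(2)[rule_format, of x] by auto
    have U: "open {r<..<u}" "x \<in> {r<..<u}" "{r<..<u} \<subseteq> {r..u}" using su by auto
    have "c x \<in> points M" using piecewise_smooth_path_points[OF c] x by simp
    then have "f ((m s \<circ> c) x) = s powr \<alpha> * l" using f_action[OF \<open>s > 0\<close>] fl x by simp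
    then show "sqrt (\<kappa> (s powr \<alpha> * l) * s powr \<alpha>) * sqrt (1 * speed_sq c x) =
        sqrt (\<kappa> (f ((m s \<circ> c) x)) * speed_sq (m s \<circ> c) x)"
      unfolding speed_sq_action[OF su(3) U \<open>s > 0\<close>] by (simp add: real_sqrt_mult mult.assoc del: o_apply)
  qed
  then show ?thesis by (simp add: len_def)
qed

end


context homogeneous_riemannian
begin

definition weight :: "(real \<Rightarrow> real) \<Rightarrow> bool" where
  "weight \<kappa> \<longleftrightarrow> continuous_on {0<..} \<kappa> \<and> (\<forall>r>0. \<kappa> r > 0)"

lemma weight_one: "weight (\<lambda>_. 1)"
  by (simp add: weight_def)

definition path_in :: "'a set \<Rightarrow> real \<Rightarrow> real \<Rightarrow> (real \<Rightarrow> 'a) \<Rightarrow> bool" where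
  "path_in S a b c \<longleftrightarrow> piecewise_smooth_path M a b c \<and> c ` {a..b} \<subseteq> S"

text \<open>Taking for \<open>S\<close> the whole manifold or a level set covers both distances of the theorem.\<close>

definition pdist :: "(real \<Rightarrow> real) \<Rightarrow> 'a set \<Rightarrow> 'a \<Rightarrow> 'a \<Rightarrow> ennreal" where
  "pdist \<kappa> S x y = (INF (a, b, c)\<in>{(a, b, c). path_in S a b c \<and> c a = x \<and> c b = y}. ennreal (len \<kappa> a b c))"

text \<open>The real-valued form of the distance, which is 0 between points that are not joined by a path.\<close>

definition sdist :: "(real \<Rightarrow> real) \<Rightarrow> 'a set \<Rightarrow> 'a \<Rightarrow> 'a \<Rightarrow> real" where
  "sdist \<kappa> S x y = enn2real (pdist \<kappa> S x y)"

lemma pdist_le: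
  assumes "path_in S a b c"
  shows "pdist \<kappa> S (c a) (c b) \<le> ennreal (len \<kappa> a b c)"
  unfolding pdist_def by (rule INF_lower2[of "(a, b, c)"]) (use assms in auto)

lemma path_in_len_nonneg: "weight \<kappa> \<Longrightarrow> path_in S a b c \<Longrightarrow> len \<kappa> a b c \<ge> 0"
  by (rule len_nonneg[of a b c]) (auto simp: weight_def path_in_def)

lemma sdist_le:
  assumes "weight \<kappa>" "path_in S a b c"
  shows "sdist \<kappa> S (c a) (c b) \<le> len \<kappa> a b c"
proof -
  have "enn2real (pdist \<kappa> S (c a) (c b)) \<le> enn2real (ennreal (len \<kappa> a b c))"
    by (rule enn2real_mono[OF pdist_le[OF assms(2)]]) simp
  then show ?thesis using path_in_len_nonneg[OF assms] by (simp add: sdist_def)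
qed

lemma pdist_finite_iff: "pdist \<kappa> S x y \<noteq> \<infinity> \<longleftrightarrow> (\<exists>a b c. path_in S a b c \<and> c a = x \<and> c b = y)"
proof
  assume "\<exists>a b c. path_in S a b c \<and> c a = x \<and> c b = y"
  then obtain a b c where c: "path_in S a b c" "c a = x" "c b = y" by blast
  then show "pdist \<kappa> S x y \<noteq> \<infinity>" using pdist_le[OF c(1), of \<kappa>] by (auto simp: top_unique)
next
  assume *: "pdist \<kappa> S x y \<noteq> \<infinity>"
  show "\<exists>a b c. path_in S a b c \<and> c a = x \<and> c b = y"
  proof (rule ccontr)
    assume "\<nexists>a b c. path_in S a b c \<and> c a = x \<and> c b = y"
    then have "{(a, b, c). path_in S a b c \<and> c a = x \<and> c b = y} = {}" by auto
    with * show False by (simp add: pdist_def)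
  qed
qed

lemma sdist_lessE:
  assumes "pdist \<kappa> S x y \<noteq> \<infinity>" "sdist \<kappa> S x y < L" "weight \<kappa>"
  obtains a b c where "path_in S a b c" "c a = x" "c b = y" "len \<kappa> a b c < L"
proof -
  have "ennreal (sdist \<kappa> S x y) = pdist \<kappa> S x y"
    using assms(1) by (simp add: sdist_def less_top)
  moreover have "ennreal (sdist \<kappa> S x y) < ennreal L"
    using assms(2) by (intro ennreal_lessI) (auto simp: sdist_def intro: le_less_trans[OF enn2real_nonneg])
  ultimately have "pdist \<kappa> S x y < ennreal L" by simp
  then obtain a b c where c: "path_in S a b c" "c a = x" "c b = y" "ennreal (len \<kappa> a b c) < ennreal L"
    unfolding pdist_def INF_less_iff by auto
  moreover have "len \<kappa> a b c < L"
    using c(4) path_in_len_nonneg[OF assms(3) c(1)] ennreal_less_iff by blast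
  ultimately show thesis using that by blast
qed

lemma sdist_ge:
  assumes "pdist \<kappa> S x y \<noteq> \<infinity>" "weight \<kappa>"
    and "\<And>a b c. path_in S a b c \<Longrightarrow> c a = x \<Longrightarrow> c b = y \<Longrightarrow> B \<le> len \<kappa> a b c"
  shows "B \<le> sdist \<kappa> S x y"
proof (rule ccontr)
  assume "\<not> ?thesis"
  then have "sdist \<kappa> S x y < B" by simp
  from sdist_lessE[OF assms(1) this assms(2)] obtain a b c
    where "path_in S a b c" "c a = x" "c b = y" "len \<kappa> a b c < B" .
  with assms(3) show False by fastforce
qed

lemma sdist_commute:
  shows "sdist \<kappa> S x y = sdist \<kappa> S y x"
proof -
  have "pdist \<kappa> S x y \<le> pdist \<kappa> S y x" for x y
    unfolding pdist_def[of \<kappa> S y x]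
  proof (rule INF_greatest, clarsimp)
    fix a b c assume c: "path_in S a b c"
    then have "path_in S (0 - b) (0 - a) (\<lambda>t. c (0 - t))"
      using piecewise_smooth_path_reflect[of M a b c 0] by (force simp: path_in_def)
    from pdist_le[OF this, of \<kappa>] show "pdist \<kappa> S (c b) (c a) \<le> ennreal (len \<kappa> a b c)"
      using c len_reflect[of a b c \<kappa> 0] by (simp add: path_in_def)
  qed
  then have "pdist \<kappa> S x y = pdist \<kappa> S y x" by (intro antisym)
  then show ?thesis by (simp add: sdist_def)
qed

lemma sdist_refl:
  assumes "S \<subseteq> points M" "x \<in> S" "weight \<kappa>"
  shows "sdist \<kappa> S x x = 0"
proof -
  have x: "x \<in> points M" using assms by blast
  have "piecewise_smooth_path M 0 1 (\<lambda>_. x)"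
    by (intro piecewise_smooth_path_smooth smooth_map_const x) simp
  then have p: "path_in S 0 1 (\<lambda>_. x)" using assms by (auto simp: path_in_def)
  have "velocity M (\<lambda>_. x) t = (\<lambda>h. 0)" for t by (simp add: velocity_def fun_eq_iff)
  then have "len \<kappa> 0 1 (\<lambda>_. x) = 0"
    by (simp add: len_def speed_sq_def g_zero[OF x tangent_space_zero])
  then show ?thesis using sdist_le[OF assms(3) p] by (simp add: sdist_def antisym)
qed

lemma sdist_triangle:
  assumes S: "S \<subseteq> points M" and \<kappa>: "weight \<kappa>"
    and fin: "pdist \<kappa> S x y \<noteq> \<infinity>" "pdist \<kappa> S y z \<noteq> \<infinity>"
  shows "sdist \<kappa> S x z \<le> sdist \<kappa> S x y + sdist \<kappa> S y z"
proof (rule field_le_epsilon)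
  fix e :: real assume "e > 0"
  obtain a b c where c: "path_in S a b c" "c a = x" "c b = y" "len \<kappa> a b c < sdist \<kappa> S x y + e / 2"
    using sdist_lessE[OF fin(1) _ \<kappa>, of "sdist \<kappa> S x y + e / 2"] \<open>e > 0\<close> by auto
  obtain a' b' c' where c': "path_in S a' b' c'" "c' a' = y" "c' b' = z" "len \<kappa> a' b' c' < sdist \<kappa> S y z + e / 2"
    using sdist_lessE[OF fin(2) _ \<kappa>, of "sdist \<kappa> S y z + e / 2"] \<open>e > 0\<close> by auto
  define k where "k = a' - b"
  define c2 where "c2 t = c' (t + k)" for t
  have "piecewise_smooth_path M (a' - k) (b' - k) c2"
    unfolding c2_def using piecewise_smooth_path_shift c'(1) by (simp add: path_in_def)
  then have c2: "piecewise_smooth_path M b (b' - k) c2" by (simp add: k_def)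
  let ?c = "\<lambda>t. if t \<le> b then c t else c2 t"
  have c2b: "c b = c2 b" using c(3) c'(2) by (simp add: c2_def k_def)
  have pc: "piecewise_smooth_path M a b c" using c(1) by (simp add: path_in_def)
  have j: "piecewise_smooth_path M a (b' - k) ?c" by (rule piecewise_smooth_path_join[OF pc c2 c2b])
  have ab: "a < b" "b < b' - k" using pc c2 by (auto simp: piecewise_smooth_path_def)
  have "?c ` {a..b' - k} \<subseteq> S"
  proof (rule image_subsetI)
    fix t assume t: "t \<in> {a..b' - k}"
    show "?c t \<in> S"
    proof (cases "t \<le> b")
      case True then show ?thesis using c(1) t by (auto simp: path_in_def)
    next
      case False
      then have "t + k \<in> {a'..b'}" using t by (auto simp: k_def)
      then show ?thesis using c'(1) False by (auto simp: path_in_def c2_def)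
    qed
  qed
  with j have p: "path_in S a (b' - k) ?c" by (simp add: path_in_def)
  have \<kappa>c: "continuous_on {0<..} \<kappa>" using \<kappa> by (simp add: weight_def)
  have "len \<kappa> a (b' - k) ?c = len \<kappa> a b ?c + len \<kappa> b (b' - k) ?c"
    using len_combine[OF j \<kappa>c, of b] ab by simp
  also have "len \<kappa> a b ?c = len \<kappa> a b c" by (rule len_cong) simp
  also have "len \<kappa> b (b' - k) ?c = len \<kappa> b (b' - k) c2"
  proof (rule len_cong)
    fix t assume "t \<in> {b..b' - k}"
    then show "?c t = c2 t" using c2b by (cases "t = b") auto
  qed
  also have "\<dots> = len \<kappa> a' b' c'"
    using len_shift[of a' b' c' \<kappa> k] c'(1) by (simp add: c2_def[abs_def] k_def path_in_def)
  finally have "len \<kappa> a (b' - k) ?c < sdist \<kappa> S x y + sdist \<kappa> S y z + e" using c(4) c'(4) by simp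
  moreover have "sdist \<kappa> S x z \<le> len \<kappa> a (b' - k) ?c"
    using sdist_le[OF \<kappa> p] ab c(2) c'(3) by (simp add: c2_def)
  ultimately show "sdist \<kappa> S x z \<le> sdist \<kappa> S x y + sdist \<kappa> S y z + e" by simp
qed

lemma Metric_space_sdist:
  assumes S: "S \<subseteq> points M" and \<kappa>: "weight \<kappa>"
    and fin: "\<And>x y. x \<in> S \<Longrightarrow> y \<in> S \<Longrightarrow> pdist \<kappa> S x y \<noteq> \<infinity>"
    and sep: "\<And>x y. x \<in> S \<Longrightarrow> y \<in> S \<Longrightarrow> sdist \<kappa> S x y = 0 \<Longrightarrow> x = y"
  shows "Metric_space S (sdist \<kappa> S)"
proof
  show "0 \<le> sdist \<kappa> S x y" for x y by (simp add: sdist_def)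
  show "sdist \<kappa> S x y = sdist \<kappa> S y x" for x y by (rule sdist_commute)
  show "sdist \<kappa> S x y = 0 \<longleftrightarrow> x = y" if "x \<in> S" "y \<in> S" for x y
    using sep[OF that] sdist_refl[OF S _ \<kappa>] that by blast
  show "sdist \<kappa> S x z \<le> sdist \<kappa> S x y + sdist \<kappa> S y z" if "x \<in> S" "y \<in> S" "z \<in> S" for x y z
    by (rule sdist_triangle[OF S \<kappa> fin fin]) (use that in auto)
qed

lemma path_dist_conformal: "path_dist M (conformal \<kappa> f g) x y = pdist \<kappa> (points M) x y"
proof -
  have "piecewise_smooth_path M a b c = path_in (points M) a b c" for a b c
    unfolding path_in_def using piecewise_smooth_path_points[of M a b c] by auto
  then show ?thesis
    by (simp add: path_dist_def pdist_def path_length_def len_def conformal_def speed_sq_def)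
qed

lemma path_dist_self: "path_dist M g x y = pdist (\<lambda>_. 1) (points M) x y"
  unfolding path_dist_conformal[symmetric] path_dist_def path_length_def conformal_def by simp


subsection \<open>The level sets\<close>

definition level :: "real \<Rightarrow> 'a set" where
  "level l = {x \<in> points M. f x = l}"

lemma level_subset: "level l \<subseteq> points M"
  by (auto simp: level_def)

text \<open>Every level is regular because \<open>P f = \<alpha> f\<close> does not vanish.\<close>

lemma charted_level: "charted (level_set M f l)"
  unfolding level_set_def
proof (rule charted_hypersurface)
  fix x assume "x \<in> {x \<in> points M. f x = l}"
  then have x: "x \<in> points M" "f x = l" by auto
  obtain U \<phi> where U: "(U, \<phi>) \<in> charts M" "x \<in> U" using charted_cover[OF charted_M x(1)] by blast
  let ?c = "\<lambda>t. m (exp t) x"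
  define K where "K = {t. ?c t \<in> U}"
  have c: "smooth_map (real_space UNIV) M ?c" by (rule orbit_smooth[OF x(1)])
  have "smooth_on K (\<phi> \<circ> ?c \<circ> inv_into UNIV (\<lambda>t. t))"
    using smooth_mapD(2)[OF c _ U(1), of UNIV "\<lambda>t. t"] by (simp add: K_def)
  then have smK: "smooth_on K (\<lambda>t. \<phi> (?c t))" by (rule smooth_on_cong) (simp add: inv_into_ident)
  have "openin (top_of_set UNIV) {t \<in> topspace (top_of_set UNIV). ?c t \<in> U}"
    by (rule openin_continuous_map_preimage[OF _ charted_openin[OF charted_M U(1)]])
       (use smooth_mapD(1)[OF c] in simp)
  then have opK: "open K" by (simp add: K_def)
  have 0: "0 \<in> K" using U(2) by (simp add: K_def action_one[OF x(1)])
  have "(\<lambda>t. \<phi> (?c t)) differentiable (at 0)" by (rule smooth_on_differentiable[OF smK opK 0 order_refl])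
  then obtain D where D: "((\<lambda>t. \<phi> (?c t)) has_derivative D) (at 0)" by (auto simp: differentiable_def)
  have "velocity M ?c 0 = coord_vector M (U, \<phi>) (?c 0) (D 1)"
    by (rule velocity_coord[OF M U(1) D opK 0]) (simp add: K_def)
  then have "action_field M m x f = coord_vector M (U, \<phi>) x (D 1) f"
    by (simp add: action_field_def action_one[OF x(1)])
  then have "frechet_derivative (f \<circ> inv_into U \<phi>) (at (\<phi> x)) (D 1) = \<alpha> * f x"
    using action_field_f[OF x(1)] f_smooth by (simp add: coord_vector_def)
  then have "frechet_derivative (f \<circ> inv_into U \<phi>) (at (\<phi> x)) (D 1) \<noteq> 0"
    using \<alpha>_pos f_pos[OF x(1)] by simp
  from slice_chart_exists[OF M f_smooth U x(2) this] obtain W \<psi> V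
    where "(W, \<psi>) \<in> max_atlas M" "x \<in> W" "subspace V" "Suc (dim V) = DIM('e)"
      "\<psi> ` (W \<inter> {x \<in> points M. f x = l}) = \<psi> ` W \<inter> V" .
  then show "\<exists>U \<phi> V. (U, \<phi>) \<in> max_atlas M \<and> x \<in> U \<and> subspace V \<and> Suc (dim V) = DIM('e) \<and>
      \<phi> ` (U \<inter> {x \<in> points M. f x = l}) = \<phi> ` U \<inter> V" by blast
qed

lemma smooth_map_level_iff:
  "smooth_map (real_space S) (level_set M f l) c \<longleftrightarrow> smooth_map (real_space S) M c \<and> c ` S \<subseteq> level l"
  using smooth_map_hypersurface_iff[OF M charted_level[of l, unfolded level_set_def] charted_real_space[of S], of c]
  by (simp add: level_set_def level_def)

lemma points_level [simp]: "points (level_set M f l) = level l"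
  by (auto simp: level_set_def level_def)

lemma piecewise_smooth_path_level:
  "piecewise_smooth_path (level_set M f l) a b c \<longleftrightarrow> path_in (level l) a b c"
proof
  assume c: "piecewise_smooth_path (level_set M f l) a b c"
  have "smooth_map (level_set M f l) M (\<lambda>x. x)"
    unfolding level_set_def by (rule smooth_map_hypersurface_inclusion[OF M])
  from piecewise_smooth_path_compose[OF c charted_level this]
  have "piecewise_smooth_path M a b c" by (simp add: o_def)
  moreover have "c ` {a..b} \<subseteq> level l" using piecewise_smooth_path_points[OF c] by auto
  ultimately show "path_in (level l) a b c" by (simp add: path_in_def)
next
  assume c: "path_in (level l) a b c"
  then have "piecewise_smooth_path M a b c" by (simp add: path_in_def)
  then obtain D where D: "a < b" "continuous_map (top_of_set {a..b}) (mtop M) c" "finite D" "{a, b} \<subseteq> D" "D \<subseteq> {a..b}"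
    "smooth_pieces M D c" by (rule piecewise_smooth_path_dest)
  have im: "c ` {a..b} \<subseteq> level l" using c by (simp add: path_in_def)
  have "continuous_map (top_of_set {a..b}) (mtop (level_set M f l)) c"
    using D(2) im by (auto simp: level_set_def level_def continuous_map_in_subtopology)
  moreover have "smooth_pieces (level_set M f l) D c"
    unfolding smooth_pieces_def
  proof (intro ballI impI)
    fix s t assume st: "s \<in> D" "t \<in> D" "s < t \<and> {s<..<t} \<inter> D = {}"
    then have "{s..t} \<subseteq> {a..b}" using D(5) by auto
    then show "smooth_map (real_space {s..t}) (level_set M f l) c"
      using smooth_piecesD[OF D(6) st(1,2)] st(3) im by (auto simp: smooth_map_level_iff)
  qed
  ultimately show "piecewise_smooth_path (level_set M f l) a b c"
    unfolding piecewise_smooth_path_iff using D by blast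
qed

text \<open>A smooth function on the manifold restricts to a smooth function on the level set, so a
  velocity computed in the level set is pushed forward to the velocity in the manifold. Hence the
  two notions of length agree.\<close>

lemma path_dist_level: "path_dist (level_set M f l) (level_metric M g) x y = pdist (\<lambda>_. 1) (level l) x y"
proof -
  have "h \<in> smooth_funs (level_set M f l)" if "h \<in> smooth_funs M" for h
    using smooth_map_compose[OF charted_level charted_M smooth_map_hypersurface_inclusion[OF M, of "{x \<in> points M. f x = l}",
          folded level_set_def], of "real_space UNIV" h] that
    by (simp add: smooth_funs_def o_def)
  then have "pushforward M (\<lambda>x. x) (velocity (level_set M f l) c t) = velocity M c t" for c t
    by (auto simp: pushforward_def velocity_def fun_eq_iff o_def)
  then have "path_length (level_set M f l) (level_metric M g) a b c = len (\<lambda>_. 1) a b c" for a b c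
    by (simp add: path_length_def len_def level_metric_def pullback_def speed_sq_def)
  then show ?thesis by (simp add: path_dist_def pdist_def piecewise_smooth_path_level)
qed

text \<open>The point over \<open>y\<close> at radius \<open>r\<close>. For \<open>y\<close> in the level \<open>l\<close> it is the inverse of
  \<open>x \<mapsto> (f x, proj l x)\<close>, which identifies the manifold with \<open>\<real>\<^sub>>\<^sub>0 \<times> level l\<close>.\<close>

definition at_radius :: "real \<Rightarrow> real \<Rightarrow> 'a \<Rightarrow> 'a" where
  "at_radius l r y = m ((r / l) powr (1 / \<alpha>)) y"

context
  fixes l :: real
  assumes l: "l > 0"
begin

lemma proj_level: "x \<in> points M \<Longrightarrow> proj l x \<in> level l"
  using f_proj[OF l] smooth_map_points[OF smooth_map_proj[OF l]] by (simp add: level_def)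

lemma at_radius_points: "y \<in> level l \<Longrightarrow> r > 0 \<Longrightarrow> at_radius l r y \<in> points M"
  using l by (auto simp: at_radius_def level_def intro: action_in)

lemma f_at_radius:
  assumes "y \<in> level l" "r > 0"
  shows "f (at_radius l r y) = r"
proof -
  have "((r / l) powr (1 / \<alpha>)) powr \<alpha> = r / l" using \<alpha>_pos l assms by (simp add: powr_powr)
  then show ?thesis using assms l by (simp add: at_radius_def level_def f_action)
qed

lemma powr_inverse_mult: "r > 0 \<Longrightarrow> r powr (- (1 / \<alpha>)) * r powr (1 / \<alpha>) = 1"
  by (simp add: powr_add[symmetric])

lemma proj_at_radius:
  assumes "y \<in> level l" "r > 0"
  shows "proj l (at_radius l r y) = y"
proof -
  have y: "y \<in> points M" using assms by (simp add: level_def)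
  have r: "r / l > 0" using assms l by simp
  have "proj l (at_radius l r y) = m ((r / l) powr (- (1 / \<alpha>)) * (r / l) powr (1 / \<alpha>)) y"
    unfolding proj_def f_at_radius[OF assms] unfolding at_radius_def
    by (rule action_mult[symmetric]) (use assms l y in auto)
  then show ?thesis by (simp only: powr_inverse_mult[OF r] action_one[OF y])
qed

lemma at_radius_proj:
  assumes x: "x \<in> points M"
  shows "at_radius l (f x) (proj l x) = x"
proof -
  have r: "f x / l > 0" using f_pos[OF x] l by simp
  have "at_radius l (f x) (proj l x) = m ((f x / l) powr (1 / \<alpha>) * (f x / l) powr (- (1 / \<alpha>))) x"
    unfolding proj_def at_radius_def by (rule action_mult[symmetric]) (use f_pos[OF x] l x in auto)
  then show ?thesis by (metis powr_inverse_mult[OF r] action_one[OF x] mult.commute)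
qed

lemma at_radius_flow:
  assumes y: "y \<in> level l" and r: "0 < r" "0 < r'"
  shows "m (exp (ln (r' / r) / \<alpha>)) (at_radius l r y) = at_radius l r' y"
proof -
  have y': "y \<in> points M" using y by (simp add: level_def)
  have "exp (ln (r' / r) / \<alpha>) * (r / l) powr (1 / \<alpha>) = (r' / r) powr (1 / \<alpha>) * (r / l) powr (1 / \<alpha>)"
    using r by (simp add: powr_def)
  also have "\<dots> = (r' / l) powr (1 / \<alpha>)"
    using r l by (simp add: powr_mult[symmetric])
  finally show ?thesis unfolding at_radius_def using r l by (simp add: action_mult[symmetric] y')
qed

end

end

text \<open>The metric \<open>(\<kappa> \<circ> f) g\<close>, seen as the warped product \<open>dT\<^sup>2 + warp(r)\<^sup>2 g\<^sub>l\<close> over the level set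
  \<open>l\<close>.\<close>

locale weighted_pair = homogeneous_riemannian +
  fixes \<kappa> T :: "real \<Rightarrow> real" and l :: real
  assumes \<kappa>: "weight \<kappa>" and l: "l > 0"
    and T: "\<And>r. r > 0 \<Longrightarrow> (T has_real_derivative sqrt (\<kappa> r / (\<alpha> * r))) (at r)"
    and metric: "path_dist_is_metric M g"
begin

abbreviation d where "d \<equiv> sdist \<kappa> (points M)"
abbreviation dl where "dl \<equiv> sdist (\<lambda>_. 1) (level l)"
definition warp where "warp r = sqrt (\<kappa> r * (r / l))"

lemma \<kappa>_cont: "continuous_on {0<..} \<kappa>" and \<kappa>_pos: "r > 0 \<Longrightarrow> \<kappa> r > 0"
  using \<kappa> by (auto simp: weight_def)

lemma pdist_finite: "x \<in> points M \<Longrightarrow> y \<in> points M \<Longrightarrow> pdist \<kappa> (points M) x y \<noteq> \<infinity>"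
  using metric unfolding path_dist_is_metric_def path_dist_self pdist_finite_iff by blast

lemma path_in_proj:
  assumes "path_in (points M) s t c"
  shows "path_in (level l) s t (proj l \<circ> c)"
proof -
  have c: "piecewise_smooth_path M s t c" using assms by (simp add: path_in_def)
  then have "piecewise_smooth_path M s t (proj l \<circ> c)"
    by (rule piecewise_smooth_path_compose[OF _ charted_M smooth_map_proj[OF l]])
  then show ?thesis
    using piecewise_smooth_path_points[OF c] proj_level[OF l] by (auto simp: path_in_def)
qed

lemma proj_ident: "y \<in> level l \<Longrightarrow> proj l y = y"
  using l by (simp add: proj_def level_def action_one)

text \<open>Paths of the manifold project to the level set, so the level set inherits connectedness.\<close>

lemma pdist_level_finite:
  assumes "x \<in> level l" "y \<in> level l"
  shows "pdist \<kappa>' (level l) x y \<noteq> \<infinity>"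
proof -
  have "x \<in> points M" "y \<in> points M" using assms level_subset by auto
  from pdist_finite[OF this] obtain s t c where c: "path_in (points M) s t c" "c s = x" "c t = y"
    unfolding pdist_finite_iff by blast
  have "path_in (level l) s t (proj l \<circ> c) \<and> (proj l \<circ> c) s = x \<and> (proj l \<circ> c) t = y"
    using path_in_proj[OF c(1)] c assms by (simp add: proj_ident)
  then show ?thesis unfolding pdist_finite_iff by blast
qed

text \<open>Paths in the level set are paths of the manifold, so the intrinsic distance of the level set
  dominates the distance of \<open>g\<close>, which is assumed to separate points.\<close>

lemma Metric_space_level: "Metric_space (level l) dl"
proof (rule Metric_space_sdist[OF level_subset weight_one pdist_level_finite])
  fix x y assume x: "x \<in> level l" and y: "y \<in> level l" and 0: "dl x y = 0"
  have xy: "x \<in> points M" "y \<in> points M" using x y level_subset by auto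
  have "sdist (\<lambda>_. 1) (points M) x y \<le> dl x y"
  proof (rule sdist_ge[OF pdist_level_finite[OF x y] weight_one])
    fix s t c assume c: "path_in (level l) s t c" "c s = x" "c t = y"
    then have "path_in (points M) s t c" using level_subset by (auto simp: path_in_def)
    from sdist_le[OF weight_one this] c
    show "sdist (\<lambda>_. 1) (points M) x y \<le> len (\<lambda>_. 1) s t c" by simp
  qed
  then have "enn2real (path_dist M g x y) = 0" using 0 by (simp add: path_dist_self sdist_def antisym)
  moreover have "Metric_space (points M) (\<lambda>x y. enn2real (path_dist M g x y))"
    using metric unfolding path_dist_is_metric_def by blast
  ultimately show "x = y" using Metric_space.zero xy by fastforce
qed

lemma T_mono:
  assumes "0 < r" "r < r'"
  shows "T r < T r'"
proof (rule DERIV_pos_imp_increasing[OF assms(2)])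
  fix x assume "r \<le> x"
  then have "x > 0" using assms(1) by simp
  moreover from this have "sqrt (\<kappa> x / (\<alpha> * x)) > 0" using \<kappa>_pos \<alpha>_pos by simp
  ultimately show "\<exists>y. (T has_real_derivative y) (at x) \<and> 0 < y" using T by blast
qed

lemma dist_radial:
  assumes "x \<in> points M" "y \<in> points M"
  shows "\<bar>T (f x) - T (f y)\<bar> \<le> d x y"
proof (rule sdist_ge[OF pdist_finite[OF assms] \<kappa>])
  fix s t c assume c: "path_in (points M) s t c" "c s = x" "c t = y"
  have c': "piecewise_smooth_path M s t c" using c(1) by (simp add: path_in_def)
  then have "s \<le> t" by (simp add: piecewise_smooth_path_def)
  with radial_length_le[OF c' \<kappa>_cont \<kappa>_pos T, of t] c
  show "\<bar>T (f x) - T (f y)\<bar> \<le> len \<kappa> s t c" by (simp add: abs_minus_commute)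
qed

text \<open>A path from \<open>x\<close> either leaves the shell \<open>r1 \<le> f \<le> r2\<close>, which costs the radial distance to the
  boundary of the shell, or it stays inside, where projecting to the level set increases lengths at
  most by the factor \<open>1 / \<beta>\<close>.\<close>

lemma dist_shell:
  assumes x: "x \<in> points M" "y \<in> points M" and r: "0 < r1" "r1 < r2"
    and \<beta>: "0 \<le> \<beta>" "\<And>r. r \<in> {r1..r2} \<Longrightarrow> \<beta> \<le> warp r"
  shows "min (min (T (f x) - T r1) (T r2 - T (f x))) (\<beta> * dl (proj l x) (proj l y)) \<le> d x y"
proof (rule sdist_ge[OF pdist_finite[OF x] \<kappa>])
  fix s t c assume c: "path_in (points M) s t c" "c s = x" "c t = y"
  have c': "piecewise_smooth_path M s t c" using c(1) by (simp add: path_in_def)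
  then have "s \<le> t" by (simp add: piecewise_smooth_path_def)
  show "min (min (T (f x) - T r1) (T r2 - T (f x))) (\<beta> * dl (proj l x) (proj l y)) \<le> len \<kappa> s t c"
  proof (cases "\<forall>u\<in>{s..t}. f (c u) \<in> {r1..r2}")
    case True
    have "\<beta> * len (\<lambda>_. 1) s t (proj l \<circ> c) \<le> len \<kappa> s t c"
      by (rule proj_length_le[OF c' \<kappa>_cont \<kappa>_pos l \<beta>(1)]) (use True \<beta>(2) in \<open>auto simp: warp_def\<close>)
    moreover have "\<beta> * dl (proj l x) (proj l y) \<le> \<beta> * len (\<lambda>_. 1) s t (proj l \<circ> c)"
      using sdist_le[OF weight_one path_in_proj[OF c(1)]] c(2,3) \<beta>(1) by (intro mult_left_mono) auto
    ultimately show ?thesis by linarith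
  next
    case False
    then obtain u where u: "s \<le> u" "u \<le> t" "f (c u) \<notin> {r1..r2}" by auto
    have fu: "f (c u) > 0" using f_pos[OF piecewise_smooth_path_points[OF c']] u by simp
    have le: "\<bar>T (f (c u)) - T (f x)\<bar> \<le> len \<kappa> s t c"
      using radial_length_le[OF c' \<kappa>_cont \<kappa>_pos T u(1,2)] c by simp
    show ?thesis
    proof (cases "f (c u) < r1")
      case True
      then have "T (f (c u)) < T r1" using fu T_mono by blast
      then show ?thesis using le by linarith
    next
      case False
      then have "f (c u) > r2" using u(3) by auto
      then have "T (f (c u)) > T r2" using r T_mono by simp
      then show ?thesis using le by linarith
    qed
  qed
qed

text \<open>Points at distance 0 have the same radius by the radial estimate. In a shell around this
  radius the warping factor is bounded below, so they also have the same projection.\<close>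

lemma Metric_space_d: "Metric_space (points M) d"
proof (rule Metric_space_sdist[OF order_refl \<kappa> pdist_finite])
  fix x y assume x: "x \<in> points M" and y: "y \<in> points M" and 0: "d x y = 0"
  have fx: "f x > 0" "f y > 0" using f_pos x y by auto
  have "T (f x) = T (f y)" using dist_radial[OF x y] 0 by simp
  then have eq: "f x = f y" using T_mono fx by (metis less_irrefl linorder_neqE_linordered_idom)
  have "continuous_on {f x / 2..2 * f x} warp" unfolding warp_def
    by (intro continuous_intros continuous_on_subset[OF \<kappa>_cont]) (use fx l in auto)
  moreover have "{f x / 2..2 * f x} \<noteq> {}" using fx by simp
  ultimately obtain r0 where r0: "r0 \<in> {f x / 2..2 * f x}" "\<And>r. r \<in> {f x / 2..2 * f x} \<Longrightarrow> warp r0 \<le> warp r"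
    using continuous_attains_inf[OF compact_Icc] by metis
  have b0: "warp r0 > 0" using r0(1) fx l \<kappa>_pos by (auto simp: warp_def)
  have "min (min (T (f x) - T (f x / 2)) (T (2 * f x) - T (f x))) (warp r0 * dl (proj l x) (proj l y)) \<le> d x y"
    by (rule dist_shell[OF x y]) (use fx r0 b0 in auto)
  moreover have "T (f x / 2) < T (f x)" "T (f x) < T (2 * f x)" using fx by (auto intro!: T_mono)
  ultimately have "warp r0 * dl (proj l x) (proj l y) \<le> 0" using 0 by linarith
  then have "dl (proj l x) (proj l y) \<le> 0" using b0 by (simp add: mult_le_0_iff)
  then have "dl (proj l x) (proj l y) = 0" by (simp add: sdist_def antisym)
  then have "proj l x = proj l y"
    using Metric_space.zero[OF Metric_space_level proj_level[OF l x] proj_level[OF l y]] by simp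
  then show "x = y" using at_radius_proj[OF l x] at_radius_proj[OF l y] eq by metis
qed

lemma dist_orbit:
  assumes y: "y \<in> level l" and r: "0 < r" "0 < r'"
  shows "d (at_radius l r y) (at_radius l r' y) \<le> \<bar>T r - T r'\<bar>"
proof -
  have *: "d (at_radius l r y) (at_radius l r' y) \<le> T r' - T r" if r: "0 < r" "r < r'" for r r'
  proof -
    define \<tau> where "\<tau> = ln (r' / r) / \<alpha>"
    have "\<tau> > 0" using r \<alpha>_pos by (simp add: \<tau>_def)
    define x where "x = at_radius l r y"
    have x: "x \<in> points M" unfolding x_def by (rule at_radius_points[OF l y r(1)])
    have r'0: "0 < r'" using r by simp
    have x': "m (exp \<tau>) x = at_radius l r' y" unfolding x_def \<tau>_def by (rule at_radius_flow[OF l y r(1) r'0])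
    have fx: "f x = r" "f (m (exp \<tau>) x) = r'" unfolding x' unfolding x_def using f_at_radius[OF l y] r by auto
    have "piecewise_smooth_path M 0 \<tau> (\<lambda>t. m (exp t) x)"
      by (rule piecewise_smooth_path_smooth[OF \<open>\<tau> > 0\<close> orbit_smooth[OF x]])
    then have "path_in (points M) 0 \<tau> (\<lambda>t. m (exp t) x)"
      using action_in[OF exp_gt_zero x] by (auto simp: path_in_def)
    from sdist_le[OF \<kappa> this] orbit_length[OF x \<kappa>_cont \<kappa>_pos T \<open>\<tau> > 0\<close>]
    show ?thesis unfolding fx by (simp add: x' action_one[OF x] flip: x_def)
  qed
  have refl: "d (at_radius l r y) (at_radius l r y) = 0"
    by (rule sdist_refl[OF order_refl at_radius_points[OF l y r(1)] \<kappa>])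
  show ?thesis
    using *[of r r'] *[of r' r] r refl sdist_commute[of \<kappa> "points M" "at_radius l r y" "at_radius l r' y"]
    by (cases r r' rule: linorder_cases) auto
qed

text \<open>Every path in the level set is moved by the action to the level \<open>r\<close>, where its length is
  multiplied by the warping factor.\<close>

lemma dist_level:
  assumes y: "y \<in> level l" "y' \<in> level l" and r: "0 < r"
  shows "d (at_radius l r y) (at_radius l r y') \<le> warp r * dl y y'"
proof -
  have br: "warp r > 0" using r l \<kappa>_pos by (simp add: warp_def)
  have "d (at_radius l r y) (at_radius l r y') / warp r \<le> dl y y'"
  proof (rule sdist_ge[OF pdist_level_finite[OF y] weight_one])
    fix s t c assume c: "path_in (level l) s t c" "c s = y" "c t = y'"
    define \<mu> where "\<mu> = (r / l) powr (1 / \<alpha>)"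
    have \<mu>: "\<mu> > 0" using r l by (simp add: \<mu>_def)
    have \<mu>\<alpha>: "\<mu> powr \<alpha> = r / l" using r l \<alpha>_pos by (simp add: \<mu>_def powr_powr)
    have c': "piecewise_smooth_path M s t c" using c(1) by (simp add: path_in_def)
    have "path_in (points M) s t (m \<mu> \<circ> c)"
      using piecewise_smooth_path_compose[OF c' charted_M smooth_map_m[OF \<mu>]]
        action_in[OF \<mu> piecewise_smooth_path_points[OF c']]
      by (auto simp: path_in_def)
    from sdist_le[OF \<kappa> this] have "d (at_radius l r y) (at_radius l r y') \<le> len \<kappa> s t (m \<mu> \<circ> c)"
      using c(2,3) by (simp add: at_radius_def \<mu>_def)
    also have "\<dots> = sqrt (\<kappa> (\<mu> powr \<alpha> * l) * \<mu> powr \<alpha>) * len (\<lambda>_. 1) s t c"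
      by (rule action_length[OF c' _ l \<mu> \<kappa>_cont \<kappa>_pos]) (use c(1) in \<open>auto simp: path_in_def level_def image_subset_iff\<close>)
    also have "\<dots> = warp r * len (\<lambda>_. 1) s t c" using l by (simp add: \<mu>\<alpha> warp_def)
    finally show "d (at_radius l r y) (at_radius l r y') / warp r \<le> len (\<lambda>_. 1) s t c"
      using br by (simp add: field_simps)
  qed
  then show ?thesis using br by (simp add: field_simps)
qed

end


section \<open>Classes of Cauchy sequences\<close>

lemma mdist_zero_iff: "x \<in> mspace X \<Longrightarrow> y \<in> mspace X \<Longrightarrow> mdist X x y = 0 \<longleftrightarrow> x = y"
  by (rule Metric_space.zero[OF Metric_space_mspace_mdist])

lemma mdist_self: "x \<in> mspace X \<Longrightarrow> mdist X x x = 0"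
  by (rule mdist_zero_iff[THEN iffD2]) simp_all

definition cauchy_class :: "'a metric \<Rightarrow> (nat \<Rightarrow> 'a) \<Rightarrow> (nat \<Rightarrow> 'a) set" where
  "cauchy_class X z = Cauchy_rel X `` {z}"

lemma cauchy_class_in: "z \<in> Cauchy_seqs X \<Longrightarrow> cauchy_class X z \<in> mspace (metric_completion X)"
  by (simp add: cauchy_class_def quotientI)

lemma in_cauchy_class: "z \<in> Cauchy_seqs X \<Longrightarrow> z \<in> cauchy_class X z"
  unfolding cauchy_class_def by (rule equiv_class_self[OF equiv_Cauchy_rel])

lemma completion_pointE:
  assumes "A \<in> mspace (metric_completion X)"
  obtains z where "z \<in> Cauchy_seqs X" "A = cauchy_class X z"
  using assms by (auto simp: cauchy_class_def elim: quotientE)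

lemma Cauchy_seqs_in_mspace: "z \<in> Cauchy_seqs X \<Longrightarrow> z k \<in> mspace X"
  by (auto simp: Cauchy_seqs_def Metric_space.MCauchy_def[OF Metric_space_mspace_mdist])

lemma Cauchy_seqsD:
  assumes "z \<in> Cauchy_seqs X" "e > 0"
  obtains K where "\<And>i j. i \<ge> K \<Longrightarrow> j \<ge> K \<Longrightarrow> mdist X (z i) (z j) < e"
  using assms by (fastforce simp: Cauchy_seqs_def Metric_space.MCauchy_def[OF Metric_space_mspace_mdist])

lemma Cauchy_seqsI:
  assumes "\<And>k. z k \<in> mspace X"
    and "\<And>e. e > 0 \<Longrightarrow> \<exists>K. \<forall>i\<ge>K. \<forall>j\<ge>K. mdist X (z i) (z j) < e"
  shows "z \<in> Cauchy_seqs X"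
  using assms by (auto simp: Cauchy_seqs_def Metric_space.MCauchy_def[OF Metric_space_mspace_mdist])

lemma completion_dist_class_tendsto:
  assumes "z \<in> Cauchy_seqs X" "w \<in> Cauchy_seqs X"
  shows "(\<lambda>k. mdist X (z k) (w k)) \<longlonglongrightarrow> mdist (metric_completion X) (cauchy_class X z) (cauchy_class X w)"
  using completion_dist_tendsto[OF cauchy_class_in[OF assms(1), simplified] in_cauchy_class[OF assms(1)]
      cauchy_class_in[OF assms(2), simplified] in_cauchy_class[OF assms(2)]] by simp

lemma completion_dist_le:
  assumes "z \<in> Cauchy_seqs X" "w \<in> Cauchy_seqs X" "B \<longlonglongrightarrow> L" "\<And>k. mdist X (z k) (w k) \<le> B k"
  shows "mdist (metric_completion X) (cauchy_class X z) (cauchy_class X w) \<le> L"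
  by (rule LIMSEQ_le[OF completion_dist_class_tendsto[OF assms(1,2)] assms(3)]) (use assms(4) in blast)

lemma completion_dist_ge:
  assumes "z \<in> Cauchy_seqs X" "w \<in> Cauchy_seqs X" "B \<longlonglongrightarrow> L" "\<And>k. B k \<le> mdist X (z k) (w k)"
  shows "L \<le> mdist (metric_completion X) (cauchy_class X z) (cauchy_class X w)"
  by (rule LIMSEQ_le[OF assms(3) completion_dist_class_tendsto[OF assms(1,2)]]) (use assms(4) in blast)

definition representative :: "(nat \<Rightarrow> 'a) set \<Rightarrow> nat \<Rightarrow> 'a" where
  "representative A = (SOME z. z \<in> A)"

lemma
  assumes "A \<in> mspace (metric_completion X)"
  shows representative_Cauchy: "representative A \<in> Cauchy_seqs X"
    and class_representative: "cauchy_class X (representative A) = A"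
proof -
  have A: "A \<in> Cauchy_seqs X // Cauchy_rel X" using assms by simp
  have "representative A \<in> A"
    unfolding representative_def using in_quotient_imp_non_empty[OF equiv_Cauchy_rel A] by (metis ex_in_conv someI_ex)
  then show c: "representative A \<in> Cauchy_seqs X" using in_quotient_imp_subset[OF equiv_Cauchy_rel A] by blast
  show "cauchy_class X (representative A) = A"
  proof -
    obtain x where x: "A = Cauchy_rel X `` {x}" using A by (rule quotientE)
    then have "(x, representative A) \<in> Cauchy_rel X" using \<open>representative A \<in> A\<close> by blast
    from equiv_class_eq[OF equiv_Cauchy_rel this] x show ?thesis unfolding cauchy_class_def by metis
  qed
qed


section \<open>The collapsed product\<close>

lemma mem_prod_ball:
  "p \<in> mball_of (prod_metric (submetric euclidean_metric {0<..}) N) (r, y) \<epsilon> \<longleftrightarrow>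
    r > 0 \<and> y \<in> mspace N \<and> fst p > 0 \<and> snd p \<in> mspace N \<and> sqrt ((r - fst p)\<^sup>2 + (mdist N y (snd p))\<^sup>2) < \<epsilon>"
  by (cases p) (auto simp: prod_dist_def dist_real_def)

lemma collapse_real: "r > 0 \<Longrightarrow> collapse Y (ereal r, y) = {(ereal r, y)}"
  by (simp add: collapse_def)

lemma collapsed_cases:
  assumes "c \<in> collapsed E Y" "E \<subseteq> {0..\<infinity>}"
  obtains (real) r y where "r > 0" "y \<in> Y" "c = collapse Y (ereal r, y)"
    | (zero) "0 \<in> E" "c = {0} \<times> Y"
    | (infinity) "\<infinity> \<in> E" "c = {\<infinity>} \<times> Y"
proof -
  obtain e y where e: "e \<in> E" "y \<in> Y" "c = collapse Y (e, y)" using assms by (auto simp: collapsed_def)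
  then have e0: "0 \<le> e" using assms(2) by auto
  consider "e = 0" | "e = \<infinity>" | r where "e = ereal r" "r > 0"
    using e0 by (cases e) (auto simp: zero_ereal_def less_eq_real_def)
  then show thesis
  proof cases
    case 1
    with e that(2) show thesis by (simp add: collapse_def)
  next
    case 2
    with e that(3) show thesis by (simp add: collapse_def)
  next
    case 3
    with e that(1)[of r y] show thesis by simp
  qed
qed

lemma collapse_in:
  "{0<..<\<infinity>} \<subseteq> E \<Longrightarrow> r > 0 \<Longrightarrow> y \<in> Y \<Longrightarrow> collapse Y (ereal r, y) \<in> collapsed E Y"
  unfolding collapsed_def by (intro imageI SigmaI) (rule subsetD, auto)

lemma basic_nhd_subset:
  assumes E: "{0<..<\<infinity>} \<subseteq> E" and "basic_nhd E N c B"
  shows "B \<subseteq> collapsed E (mspace N)"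
  using assms(2)
proof cases
  case (ball r y \<epsilon>)
  then show ?thesis using E by (auto simp: mem_prod_ball collapse_in simp del: in_mball_of)
next
  case (zero \<epsilon>)
  have "e \<in> E" if "0 \<le> e" "e < ereal \<epsilon>" for e
    using that E zero(3) by (cases "e = 0") (auto intro!: subsetD[OF E] elim: less_trans)
  then show ?thesis using zero(2) by (auto simp: collapsed_def)
next
  case (infinity R)
  have "e \<in> E" if "ereal R < e" for e
  proof (cases "e = \<infinity>")
    case False
    have "0 < ereal R" using infinity(4) by simp
    with that have "0 < e" by (rule less_trans[rotated])
    with False show ?thesis using E by auto
  qed (use infinity(3) in simp)
  then show ?thesis using infinity(2) by (auto simp: collapsed_def)
qed

text \<open>The topology of the collapsed product is given by fundamental systems of neighbourhoods, so a
  bijection onto a metric space is a homeomorphism if it matches these systems with the balls.\<close>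

lemma homeomorphic_collapsed:
  fixes Q :: "'q metric"
  assumes E: "{0<..<\<infinity>} \<subseteq> E"
    and bij: "bij_betw \<Psi> (collapsed E (mspace N)) (mspace Q)"
    and contains: "\<And>c B. c \<in> collapsed E (mspace N) \<Longrightarrow> basic_nhd E N c B \<Longrightarrow>
      \<exists>\<epsilon>>0. \<forall>q\<in>mspace Q. mdist Q (\<Psi> c) q < \<epsilon> \<longrightarrow> q \<in> \<Psi> ` B"
    and within: "\<And>c \<epsilon>. c \<in> collapsed E (mspace N) \<Longrightarrow> \<epsilon> > 0 \<Longrightarrow>
      \<exists>B. basic_nhd E N c B \<and> (\<forall>x\<in>B. mdist Q (\<Psi> c) (\<Psi> x) < \<epsilon>)"
  shows "mtopology_of Q homeomorphic_space collapsed_topology E N"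
proof -
  interpret Q: Metric_space "mspace Q" "mdist Q" by simp
  let ?C = "collapsed E (mspace N)"
  have "?C \<subseteq> topspace (collapsed_topology E N)"
  proof (rule openin_subset, unfold openin_collapsed_topology, intro conjI ballI)
    fix c assume c: "c \<in> ?C"
    obtain B where "basic_nhd E N c B" using within[OF c, of 1] by auto
    then show "\<exists>B. basic_nhd E N c B \<and> B \<subseteq> ?C" using basic_nhd_subset[OF E] by blast
  qed simp
  moreover have "topspace (collapsed_topology E N) \<subseteq> ?C"
    using openin_topspace[of "collapsed_topology E N"] unfolding openin_collapsed_topology by blast
  ultimately have top: "topspace (collapsed_topology E N) = ?C" by blast
  have im: "\<Psi> ` ?C = mspace Q" using bij by (simp add: bij_betw_def)
  have "homeomorphic_map (collapsed_topology E N) (mtopology_of Q) \<Psi>"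
  proof (rule bijective_open_imp_homeomorphic_map)
    show "continuous_map (collapsed_topology E N) (mtopology_of Q) \<Psi>"
      unfolding continuous_map_def top
    proof (intro conjI allI impI)
      fix U assume U: "openin (mtopology_of Q) U"
      show "openin (collapsed_topology E N) {c \<in> ?C. \<Psi> c \<in> U}"
        unfolding openin_collapsed_topology
      proof (intro conjI ballI)
        fix c assume c: "c \<in> {c \<in> ?C. \<Psi> c \<in> U}"
        then obtain \<epsilon> where \<epsilon>: "\<epsilon> > 0" "Q.mball (\<Psi> c) \<epsilon> \<subseteq> U"
          using U by (auto simp: mtopology_of_def Q.openin_mtopology)
        obtain B where B: "basic_nhd E N c B" "\<forall>x\<in>B. mdist Q (\<Psi> c) (\<Psi> x) < \<epsilon>"
          using within[of c \<epsilon>] c \<epsilon> by auto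
        have "B \<subseteq> ?C" by (rule basic_nhd_subset[OF E B(1)])
        moreover from this im have "\<Psi> x \<in> mspace Q" if "x \<in> B" for x using that by blast
        moreover have "\<Psi> c \<in> mspace Q" using c im by blast
        ultimately have "B \<subseteq> {c \<in> ?C. \<Psi> c \<in> U}" using B(2) \<epsilon>(2) by (auto simp: subset_iff)
        with B(1) show "\<exists>B. basic_nhd E N c B \<and> B \<subseteq> {c \<in> ?C. \<Psi> c \<in> U}" by blast
      qed auto
    qed (use im in auto)
    show "open_map (collapsed_topology E N) (mtopology_of Q) \<Psi>"
      unfolding open_map_def
    proof (intro allI impI)
      fix W assume "openin (collapsed_topology E N) W"
      then have W: "W \<subseteq> ?C" "\<And>c. c \<in> W \<Longrightarrow> \<exists>B. basic_nhd E N c B \<and> B \<subseteq> W"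
        unfolding openin_collapsed_topology by auto
      show "openin (mtopology_of Q) (\<Psi> ` W)"
        unfolding mtopology_of_def Q.openin_mtopology
      proof (intro conjI allI impI)
        show "\<Psi> ` W \<subseteq> mspace Q" using W im by blast
        fix q assume "q \<in> \<Psi> ` W"
        then obtain c where c: "c \<in> W" "q = \<Psi> c" by blast
        obtain B where B: "basic_nhd E N c B" "B \<subseteq> W" using W(2)[OF c(1)] by blast
        obtain \<epsilon> where "\<epsilon> > 0" "\<forall>q\<in>mspace Q. mdist Q (\<Psi> c) q < \<epsilon> \<longrightarrow> q \<in> \<Psi> ` B"
          using contains[OF _ B(1)] c W by blast
        then show "\<exists>\<epsilon>>0. Q.mball q \<epsilon> \<subseteq> \<Psi> ` W"
          using c image_mono[OF B(2), of \<Psi>] by (intro exI[of _ \<epsilon>]) (auto simp: subset_iff)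
      qed
    qed
  qed (use bij top im in \<open>auto simp: bij_betw_def\<close>)
  then show ?thesis using homeomorphic_map_imp_homeomorphic_space homeomorphic_space_sym by blast
qed

text \<open>At finite radius the projection only wraps points into singletons, and the neighbourhoods are
  the balls of the product metric.\<close>

lemma homeomorphic_collapsed_product:
  "collapsed_topology {0<..<\<infinity>} N homeomorphic_space prod_topology (top_of_set {0::real<..}) (mtopology_of N)"
proof -
  let ?Q = "prod_metric (submetric euclidean_metric {0::real<..}) N"
  let ?C = "collapsed {0<..<\<infinity>} (mspace N)"
  define \<Psi> where "\<Psi> c = (real_of_ereal (fst (the_elem c)), snd (the_elem c))" for c :: "(ereal \<times> 'a) set"
  have \<Psi>: "\<Psi> (collapse (mspace N) (ereal r, y)) = (r, y)" if "r > 0" for r y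
    using that by (simp add: \<Psi>_def collapse_real)
  have cases: "\<exists>r y. r > 0 \<and> y \<in> mspace N \<and> c = collapse (mspace N) (ereal r, y)" if "c \<in> ?C" for c
    using that by (cases rule: collapsed_cases) auto
  have "mtopology_of ?Q homeomorphic_space collapsed_topology {0<..<\<infinity>} N"
  proof (rule homeomorphic_collapsed[where \<Psi> = \<Psi>])
    show "bij_betw \<Psi> ?C (mspace ?Q)"
    proof (rule bij_betwI[where g = "\<lambda>(r, y). collapse (mspace N) (ereal r, y)"])
      show "\<Psi> \<in> ?C \<rightarrow> mspace ?Q" using cases \<Psi> by fastforce
      show "(\<lambda>(r, y). collapse (mspace N) (ereal r, y)) \<in> mspace ?Q \<rightarrow> ?C"
        by (auto intro!: collapse_in)
      show "(\<lambda>(r, y). collapse (mspace N) (ereal r, y)) (\<Psi> c) = c" if "c \<in> ?C" for c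
        using cases[OF that] \<Psi> by auto
      show "\<Psi> ((\<lambda>(r, y). collapse (mspace N) (ereal r, y)) p) = p" if "p \<in> mspace ?Q" for p
        using that \<Psi> by auto
    qed
    fix c assume c: "c \<in> ?C"
    obtain r y where ry: "r > 0" "y \<in> mspace N" "c = collapse (mspace N) (ereal r, y)" using cases[OF c] by blast
    have im: "\<Psi> ` (\<lambda>(s, z). collapse (mspace N) (ereal s, z)) ` mball_of ?Q (r, y) \<epsilon> = mball_of ?Q (r, y) \<epsilon>" for \<epsilon>
    proof -
      have "\<Psi> ((\<lambda>(s, z). collapse (mspace N) (ereal s, z)) p) = p" if "p \<in> mball_of ?Q (r, y) \<epsilon>" for p
        using that \<Psi> by (cases p) auto
      then show ?thesis by (simp add: image_image cong: image_cong_simp)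
    qed
    show "\<exists>\<epsilon>>0. \<forall>q\<in>mspace ?Q. mdist ?Q (\<Psi> c) q < \<epsilon> \<longrightarrow> q \<in> \<Psi> ` B" if "basic_nhd {0<..<\<infinity>} N c B" for B
      using that
    proof cases
      case (ball r' y' \<epsilon>)
      then have "r' = r" "y' = y" using ry by (auto simp: collapse_real)
      then show ?thesis using ball im[of \<epsilon>] ry \<Psi> by (intro exI[of _ \<epsilon>]) auto
    qed auto
    show "\<exists>B. basic_nhd {0<..<\<infinity>} N c B \<and> (\<forall>x\<in>B. mdist ?Q (\<Psi> c) (\<Psi> x) < \<epsilon>)" if "\<epsilon> > 0" for \<epsilon>
    proof (intro exI conjI)
      show "basic_nhd {0<..<\<infinity>} N c ((\<lambda>(s, z). collapse (mspace N) (ereal s, z)) ` mball_of ?Q (r, y) \<epsilon>)"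
        unfolding ry(3) by (rule basic_nhd.ball[OF ry(1,2) that])
      show "\<forall>x\<in>(\<lambda>(s, z). collapse (mspace N) (ereal s, z)) ` mball_of ?Q (r, y) \<epsilon>. mdist ?Q (\<Psi> c) (\<Psi> x) < \<epsilon>"
        using ry \<Psi> by auto
    qed
  qed simp
  moreover have "mtopology_of ?Q = prod_topology (top_of_set {0<..}) (mtopology_of N)"
    by (simp add: mtopology_of_prod_metric mtopology_of_submetric)
  ultimately show ?thesis using homeomorphic_space_sym by metis
qed


declare mspace_metric_completion [simp del] mdist_metric_completion [simp del]


section \<open>The completion of a warped distance\<close>

text \<open>The four estimates by which the distance of a warped product is controlled: by the radial arc
  length \<open>T\<close>, and by the factor \<open>b\<close> between the distance of \<open>Y\<close> and the distance on the slice at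
  radius \<open>r\<close>.\<close>

locale warped_distance =
  fixes X :: "'a set" and d :: "'a \<Rightarrow> 'a \<Rightarrow> real" and Y :: "'b set" and dl :: "'b \<Rightarrow> 'b \<Rightarrow> real"
    and \<rho> :: "'a \<Rightarrow> real" and pr :: "'a \<Rightarrow> 'b" and sc :: "real \<Rightarrow> 'b \<Rightarrow> 'a" and T b :: "real \<Rightarrow> real"
  assumes X: "Metric_space X d" and Y: "Metric_space Y dl" and nonempty: "Y \<noteq> {}"
    and \<rho>_pos: "x \<in> X \<Longrightarrow> \<rho> x > 0" and pr_in: "x \<in> X \<Longrightarrow> pr x \<in> Y"
    and sc_in: "y \<in> Y \<Longrightarrow> r > 0 \<Longrightarrow> sc r y \<in> X"
    and \<rho>_sc: "y \<in> Y \<Longrightarrow> r > 0 \<Longrightarrow> \<rho> (sc r y) = r" and pr_sc: "y \<in> Y \<Longrightarrow> r > 0 \<Longrightarrow> pr (sc r y) = y"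
    and sc_pr: "x \<in> X \<Longrightarrow> sc (\<rho> x) (pr x) = x"
    and T_mono: "0 < r \<Longrightarrow> r < r' \<Longrightarrow> T r < T r'" and T_cont: "continuous_on {0<..} T"
    and b_cont: "continuous_on {0<..} b" and b_pos: "r > 0 \<Longrightarrow> b r > 0"
    and radial: "x \<in> X \<Longrightarrow> x' \<in> X \<Longrightarrow> \<bar>T (\<rho> x) - T (\<rho> x')\<bar> \<le> d x x'"
    and shell: "x \<in> X \<Longrightarrow> x' \<in> X \<Longrightarrow> 0 < r1 \<Longrightarrow> r1 < r2 \<Longrightarrow> 0 \<le> \<beta> \<Longrightarrow> (\<And>r. r \<in> {r1..r2} \<Longrightarrow> \<beta> \<le> b r) \<Longrightarrow>
      min (min (T (\<rho> x) - T r1) (T r2 - T (\<rho> x))) (\<beta> * dl (pr x) (pr x')) \<le> d x x'"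
    and orbit: "y \<in> Y \<Longrightarrow> 0 < r \<Longrightarrow> 0 < r' \<Longrightarrow> d (sc r y) (sc r' y) \<le> \<bar>T r - T r'\<bar>"
    and slice: "y \<in> Y \<Longrightarrow> y' \<in> Y \<Longrightarrow> 0 < r \<Longrightarrow> d (sc r y) (sc r y') \<le> b r * dl y y'"
begin

sublocale X: Metric_space X d by (rule X)
sublocale Y: Metric_space Y dl by (rule Y)

abbreviation "MX \<equiv> metric (X, d)"
abbreviation "MY \<equiv> metric (Y, dl)"
abbreviation "Q \<equiv> metric_completion MX"
abbreviation "N \<equiv> metric_completion MY"

lemmas seq_in_X = Cauchy_seqs_in_mspace[of _ MX, simplified X.mspace_metric]
lemmas seq_in_Y = Cauchy_seqs_in_mspace[of _ MY, simplified Y.mspace_metric]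

text \<open>The detour along the two orbits and the slice at radius \<open>r\<close>. Letting \<open>r\<close> tend to an end, this
  is what collapses the end.\<close>

lemma dist_le:
  assumes "x \<in> X" "x' \<in> X" "0 < r"
  shows "d x x' \<le> \<bar>T (\<rho> x) - T r\<bar> + b r * dl (pr x) (pr x') + \<bar>T (\<rho> x') - T r\<bar>"
proof -
  have in': "sc r (pr x) \<in> X" "sc r (pr x') \<in> X" using assms by (auto intro: sc_in pr_in)
  have "d x x' \<le> d x (sc r (pr x)) + (d (sc r (pr x)) (sc r (pr x')) + d (sc r (pr x')) x')"
    using X.triangle[OF assms(1) in'(1) assms(2)] X.triangle[OF in' assms(2)] by linarith
  moreover have "d x (sc r (pr x)) \<le> \<bar>T (\<rho> x) - T r\<bar>"
    using orbit[OF pr_in[OF assms(1)] \<rho>_pos[OF assms(1)] assms(3)] sc_pr[OF assms(1)] by simp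
  moreover have "d x' (sc r (pr x')) \<le> \<bar>T (\<rho> x') - T r\<bar>"
    using orbit[OF pr_in[OF assms(2)] \<rho>_pos[OF assms(2)] assms(3)] sc_pr[OF assms(2)] by simp
  moreover have "d (sc r (pr x)) (sc r (pr x')) \<le> b r * dl (pr x) (pr x')"
    by (rule slice) (use assms pr_in in auto)
  ultimately show ?thesis using X.commute[of "sc r (pr x')" x'] by linarith
qed

subsection \<open>Points at finite radius\<close>

text \<open>The point with coordinates \<open>(r, \<eta>)\<close>. The estimates for the distance of \<open>X\<close> pass to these
  points in the limit.\<close>

definition pt :: "real \<Rightarrow> (nat \<Rightarrow> 'b) set \<Rightarrow> (nat \<Rightarrow> 'a) set" where
  "pt r \<eta> = cauchy_class MX (\<lambda>k. sc r (representative \<eta> k))"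

lemma rep_Y: "\<eta> \<in> mspace N \<Longrightarrow> representative \<eta> k \<in> Y"
  using seq_in_Y[OF representative_Cauchy] by blast

lemma pt_seq:
  assumes \<eta>: "\<eta> \<in> mspace N" and r: "r > 0"
  shows "(\<lambda>k. sc r (representative \<eta> k)) \<in> Cauchy_seqs MX"
proof (rule Cauchy_seqsI)
  show "sc r (representative \<eta> k) \<in> mspace MX" for k using rep_Y[OF \<eta>] r by (simp add: sc_in)
  fix e :: real assume "e > 0"
  then obtain K where K: "\<And>i j. i \<ge> K \<Longrightarrow> j \<ge> K \<Longrightarrow> dl (representative \<eta> i) (representative \<eta> j) < e / b r"
    using Cauchy_seqsD[OF representative_Cauchy[OF \<eta>], of "e / b r"] b_pos[OF r] by auto
  have "d (sc r (representative \<eta> i)) (sc r (representative \<eta> j)) < e" if "i \<ge> K" "j \<ge> K" for i j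
  proof -
    have "b r * dl (representative \<eta> i) (representative \<eta> j) < e"
      using K[OF that] b_pos[OF r] by (simp add: field_simps)
    then show ?thesis using slice[OF rep_Y[OF \<eta>] rep_Y[OF \<eta>] r, of i j] by linarith
  qed
  then show "\<exists>K. \<forall>i\<ge>K. \<forall>j\<ge>K. mdist MX (sc r (representative \<eta> i)) (sc r (representative \<eta> j)) < e" by auto
qed

lemma pt_in: "\<eta> \<in> mspace N \<Longrightarrow> r > 0 \<Longrightarrow> pt r \<eta> \<in> mspace Q"
  unfolding pt_def by (rule cauchy_class_in[OF pt_seq])

lemma rep_dist: "\<eta> \<in> mspace N \<Longrightarrow> \<eta>' \<in> mspace N \<Longrightarrow>
   (\<lambda>k. dl (representative \<eta> k) (representative \<eta>' k)) \<longlonglongrightarrow> mdist N \<eta> \<eta>'"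
  using completion_dist_class_tendsto[OF representative_Cauchy representative_Cauchy, of \<eta> MY \<eta>']
  by (simp add: class_representative)

lemma pt_dist_le:
  assumes \<eta>: "\<eta> \<in> mspace N" "\<eta>' \<in> mspace N" and r: "r > 0" "r' > 0"
  shows "mdist Q (pt r \<eta>) (pt r' \<eta>') \<le> b r * mdist N \<eta> \<eta>' + \<bar>T r - T r'\<bar>"
  unfolding pt_def
proof (rule completion_dist_le[OF pt_seq[OF \<eta>(1) r(1)] pt_seq[OF \<eta>(2) r(2)]])
  show "(\<lambda>k. b r * dl (representative \<eta> k) (representative \<eta>' k) + \<bar>T r - T r'\<bar>)
      \<longlonglongrightarrow> b r * mdist N \<eta> \<eta>' + \<bar>T r - T r'\<bar>"
    by (intro tendsto_intros rep_dist \<eta>)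
  show "mdist MX (sc r (representative \<eta> k)) (sc r' (representative \<eta>' k))
      \<le> b r * dl (representative \<eta> k) (representative \<eta>' k) + \<bar>T r - T r'\<bar>" for k
    using dist_le[OF sc_in[OF rep_Y[OF \<eta>(1)] r(1)] sc_in[OF rep_Y[OF \<eta>(2)] r(2)] r(1), of k k] rep_Y \<eta> r
    by (simp add: \<rho>_sc pr_sc abs_minus_commute)
qed

lemma pt_dist_shell:
  assumes \<eta>: "\<eta> \<in> mspace N" "\<eta>' \<in> mspace N" and r: "r > 0" "r' > 0"
    and "0 < r1" "r1 < r2" "0 \<le> \<beta>" "\<And>r. r \<in> {r1..r2} \<Longrightarrow> \<beta> \<le> b r"
  shows "min (min (T r - T r1) (T r2 - T r)) (\<beta> * mdist N \<eta> \<eta>') \<le> mdist Q (pt r \<eta>) (pt r' \<eta>')"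
  unfolding pt_def
proof (rule completion_dist_ge[OF pt_seq[OF \<eta>(1) r(1)] pt_seq[OF \<eta>(2) r(2)]])
  show "(\<lambda>k. min (min (T r - T r1) (T r2 - T r)) (\<beta> * dl (representative \<eta> k) (representative \<eta>' k)))
      \<longlonglongrightarrow> min (min (T r - T r1) (T r2 - T r)) (\<beta> * mdist N \<eta> \<eta>')"
    by (intro tendsto_intros rep_dist \<eta>)
  show "min (min (T r - T r1) (T r2 - T r)) (\<beta> * dl (representative \<eta> k) (representative \<eta>' k))
      \<le> mdist MX (sc r (representative \<eta> k)) (sc r' (representative \<eta>' k))" for k
    using shell[OF sc_in[OF rep_Y[OF \<eta>(1)] r(1)] sc_in[OF rep_Y[OF \<eta>(2)] r(2)] assms(5-8), of k k] rep_Y \<eta> r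
    by (simp add: \<rho>_sc pr_sc)
qed

subsection \<open>The height of a point of the completion\<close>

text \<open>Since \<open>T \<circ> \<rho>\<close> is 1-Lipschitz, it extends to the completion.\<close>

definition height :: "(nat \<Rightarrow> 'a) set \<Rightarrow> real" where
  "height A = lim (\<lambda>k. T (\<rho> (representative A k)))"

lemma height_tendsto:
  assumes z: "z \<in> Cauchy_seqs MX"
  shows "(\<lambda>k. T (\<rho> (z k))) \<longlonglongrightarrow> height (cauchy_class MX z)"
proof -
  let ?w = "representative (cauchy_class MX z)"
  have w: "?w \<in> Cauchy_seqs MX" by (rule representative_Cauchy[OF cauchy_class_in[OF z]])
  have "Cauchy (\<lambda>k. T (\<rho> (?w k)))"
  proof (rule metric_CauchyI)
    fix e :: real assume "e > 0"
    then obtain K where K: "\<And>i j. i \<ge> K \<Longrightarrow> j \<ge> K \<Longrightarrow> d (?w i) (?w j) < e"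
      using Cauchy_seqsD[OF w] by auto
    then have "dist (T (\<rho> (?w i))) (T (\<rho> (?w j))) < e" if "i \<ge> K" "j \<ge> K" for i j
      using radial[OF seq_in_X[OF w] seq_in_X[OF w], of i j] K[OF that] by (simp add: dist_real_def)
    then show "\<exists>K. \<forall>i\<ge>K. \<forall>j\<ge>K. dist (T (\<rho> (?w i))) (T (\<rho> (?w j))) < e" by blast
  qed
  then have "(\<lambda>k. T (\<rho> (?w k))) \<longlonglongrightarrow> height (cauchy_class MX z)"
    unfolding height_def by (simp add: Cauchy_convergent_iff convergent_LIMSEQ_iff)
  moreover have "(\<lambda>k. T (\<rho> (z k)) - T (\<rho> (?w k))) \<longlonglongrightarrow> 0"
  proof (rule Lim_null_comparison)
    have "mdist Q (cauchy_class MX z) (cauchy_class MX z) = 0"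
      by (rule mdist_self[OF cauchy_class_in[OF z]])
    then show "(\<lambda>k. d (z k) (?w k)) \<longlonglongrightarrow> 0"
      using completion_dist_class_tendsto[OF z w] class_representative[OF cauchy_class_in[OF z]] by simp
    show "\<forall>\<^sub>F k in sequentially. norm (T (\<rho> (z k)) - T (\<rho> (?w k))) \<le> d (z k) (?w k)"
      using radial[OF seq_in_X[OF z] seq_in_X[OF w]] by simp
  qed
  ultimately have "(\<lambda>k. (T (\<rho> (z k)) - T (\<rho> (?w k))) + T (\<rho> (?w k))) \<longlonglongrightarrow> 0 + height (cauchy_class MX z)"
    by (intro tendsto_add)
  then show ?thesis by simp
qed

lemma height_pt: "\<eta> \<in> mspace N \<Longrightarrow> r > 0 \<Longrightarrow> height (pt r \<eta>) = T r"
  using LIMSEQ_unique[OF height_tendsto[OF pt_seq], of \<eta> r "T r"] by (simp add: pt_def \<rho>_sc rep_Y)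

lemma height_lipschitz:
  assumes "A \<in> mspace Q" "B \<in> mspace Q"
  shows "\<bar>height A - height B\<bar> \<le> mdist Q A B"
proof -
  obtain z where z: "z \<in> Cauchy_seqs MX" "A = cauchy_class MX z" by (rule completion_pointE[OF assms(1)])
  obtain w where w: "w \<in> Cauchy_seqs MX" "B = cauchy_class MX w" by (rule completion_pointE[OF assms(2)])
  show ?thesis unfolding z(2) w(2)
  proof (rule completion_dist_ge[OF z(1) w(1)])
    show "(\<lambda>k. \<bar>T (\<rho> (z k)) - T (\<rho> (w k))\<bar>) \<longlonglongrightarrow> \<bar>height (cauchy_class MX z) - height (cauchy_class MX w)\<bar>"
      by (intro tendsto_intros height_tendsto z w)
    show "\<bar>T (\<rho> (z k)) - T (\<rho> (w k))\<bar> \<le> mdist MX (z k) (w k)" for k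
      using radial[OF seq_in_X[OF z(1)] seq_in_X[OF w(1)]] by simp
  qed
qed

lemma b_lower_bound:
  assumes "0 < r1" "r1 < r2"
  obtains \<beta> where "\<beta> > 0" "\<And>r. r \<in> {r1..r2} \<Longrightarrow> \<beta> \<le> b r"
proof -
  have "continuous_on {r1..r2} b" by (rule continuous_on_subset[OF b_cont]) (use assms in auto)
  moreover have "{r1..r2} \<noteq> {}" using assms by simp
  ultimately obtain r0 where "r0 \<in> {r1..r2}" "\<And>r. r \<in> {r1..r2} \<Longrightarrow> b r0 \<le> b r"
    using continuous_attains_inf[OF compact_Icc] by metis
  moreover from this have "b r0 > 0" using b_pos assms by simp
  ultimately show thesis using that by blast
qed

text \<open>A point whose height is a value \<open>T r\<close> is a point at radius \<open>r\<close>: for a Cauchy sequence that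
  stays in a shell around \<open>r\<close>, the projections to \<open>Y\<close> form a Cauchy sequence.\<close>

lemma point_at_finite_radius:
  assumes A: "A \<in> mspace Q" and r: "r > 0" "height A = T r"
  obtains \<eta> where "\<eta> \<in> mspace N" "A = pt r \<eta>"
proof -
  obtain z where z: "z \<in> Cauchy_seqs MX" "A = cauchy_class MX z" by (rule completion_pointE[OF A])
  note zX = seq_in_X[OF z(1)]
  have lim: "(\<lambda>k. T (\<rho> (z k))) \<longlonglongrightarrow> T r" using height_tendsto[OF z(1)] z(2) r(2) by simp
  have r12: "0 < r / 2" "r / 2 < 2 * r" using r by auto
  obtain \<beta> where \<beta>: "\<beta> > 0" "\<And>s. s \<in> {r / 2..2 * r} \<Longrightarrow> \<beta> \<le> b s" using b_lower_bound[OF r12] by blast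
  \<comment> \<open>Half of the radial distance from \<open>r\<close> to the boundary of the shell: a point of height within \<open>\<delta>\<close>
    of \<open>T r\<close> is still farther than \<open>\<delta>\<close> from the boundary.\<close>
  define \<delta> where "\<delta> = min (T r - T (r / 2)) (T (2 * r) - T r) / 2"
  have \<delta>: "\<delta> > 0" using T_mono[of "r / 2" r] T_mono[of r "2 * r"] r by (simp add: \<delta>_def)
  have "\<forall>\<^sub>F k in sequentially. dist (T (\<rho> (z k))) (T r) < \<delta>" by (rule tendstoD[OF lim \<delta>])
  then obtain K1 where K1: "\<And>k. k \<ge> K1 \<Longrightarrow> \<bar>T (\<rho> (z k)) - T r\<bar> < \<delta>"
    by (auto simp: eventually_sequentially dist_real_def)
  have y: "(\<lambda>k. pr (z k)) \<in> Cauchy_seqs MY"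
  proof (rule Cauchy_seqsI)
    show "pr (z k) \<in> mspace MY" for k using pr_in[OF zX] by simp
    fix e :: real assume "e > 0"
    then have "min \<delta> (\<beta> * e) > 0" using \<delta> \<beta> by simp
    from Cauchy_seqsD[OF z(1) this]
    obtain K2 where K2: "\<And>i j. i \<ge> K2 \<Longrightarrow> j \<ge> K2 \<Longrightarrow> d (z i) (z j) < min \<delta> (\<beta> * e)"
      unfolding X.mdist_metric by blast
    have "dl (pr (z i)) (pr (z j)) < e" if ij: "i \<ge> max K1 K2" "j \<ge> max K1 K2" for i j
    proof -
      have "\<delta> < T (\<rho> (z i)) - T (r / 2)" "\<delta> < T (2 * r) - T (\<rho> (z i))"
      proof -
        have "2 * \<delta> \<le> T r - T (r / 2)" "2 * \<delta> \<le> T (2 * r) - T r" by (simp_all add: \<delta>_def)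
        moreover have "\<bar>T (\<rho> (z i)) - T r\<bar> < \<delta>" using K1[of i] ij(1) by simp
        ultimately show "\<delta> < T (\<rho> (z i)) - T (r / 2)" "\<delta> < T (2 * r) - T (\<rho> (z i))" by linarith+
      qed
      moreover have "min (min (T (\<rho> (z i)) - T (r / 2)) (T (2 * r) - T (\<rho> (z i)))) (\<beta> * dl (pr (z i)) (pr (z j))) \<le> d (z i) (z j)"
        by (rule shell[OF zX zX r12 less_imp_le[OF \<beta>(1)] \<beta>(2)])
      moreover have "d (z i) (z j) < min \<delta> (\<beta> * e)" using K2 ij by simp
      ultimately have "\<beta> * dl (pr (z i)) (pr (z j)) < \<beta> * e" by linarith
      then show ?thesis using \<beta>(1) by simp
    qed
    then show "\<exists>K. \<forall>i\<ge>K. \<forall>j\<ge>K. mdist MY (pr (z i)) (pr (z j)) < e"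
      by (intro exI[of _ "max K1 K2"]) simp
  qed
  define \<eta> where "\<eta> = cauchy_class MY (\<lambda>k. pr (z k))"
  have \<eta>: "\<eta> \<in> mspace N" unfolding \<eta>_def by (rule cauchy_class_in[OF y])
  have "mdist N \<eta> \<eta> = 0" by (rule mdist_self[OF \<eta>])
  then have dy: "(\<lambda>k. dl (pr (z k)) (representative \<eta> k)) \<longlonglongrightarrow> 0"
    using completion_dist_class_tendsto[OF y representative_Cauchy[OF \<eta>]] class_representative[OF \<eta>]
    by (simp add: \<eta>_def)
  have "mdist Q A (pt r \<eta>) \<le> 0"
    unfolding z(2) pt_def
  proof (rule completion_dist_le[OF z(1) pt_seq[OF \<eta> r(1)]])
    have "(\<lambda>k. \<bar>T (\<rho> (z k)) - T r\<bar> + b r * dl (pr (z k)) (representative \<eta> k)) \<longlonglongrightarrow> \<bar>T r - T r\<bar> + b r * 0"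
      by (intro tendsto_intros lim dy)
    then show "(\<lambda>k. \<bar>T (\<rho> (z k)) - T r\<bar> + b r * dl (pr (z k)) (representative \<eta> k)) \<longlonglongrightarrow> 0" by simp
    show "mdist MX (z k) (sc r (representative \<eta> k)) \<le> \<bar>T (\<rho> (z k)) - T r\<bar> + b r * dl (pr (z k)) (representative \<eta> k)" for k
      using dist_le[OF zX sc_in[OF rep_Y[OF \<eta>] r(1)] r(1), of k k] rep_Y[OF \<eta>] r by (simp add: \<rho>_sc pr_sc)
  qed
  then have "mdist Q A (pt r \<eta>) = 0"
    using Metric_space.nonneg[OF Metric_space_mspace_mdist] by (rule antisym)
  then have "A = pt r \<eta>" by (rule mdist_zero_iff[OF A pt_in[OF \<eta> r(1)], THEN iffD1])
  with \<eta> show thesis using that by blast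
qed

subsection \<open>Collapsing ends\<close>

text \<open>Towards an end of finite radial length along which \<open>b\<close> tends to 0, the slices shrink to a
  single point of the completion, whose distance to any other point is the radial one.\<close>

lemma collapsed_end:
  assumes F: "F \<noteq> bot" "\<forall>\<^sub>F r in F. r > 0" and s: "filterlim s F sequentially" "\<And>k. s k > (0::real)"
    and T: "(T \<longlongrightarrow> \<tau>) F" and b: "(b \<longlongrightarrow> 0) F"
  obtains S where "S \<in> mspace Q" "height S = \<tau>" "\<And>A. A \<in> mspace Q \<Longrightarrow> mdist Q S A = \<bar>height A - \<tau>\<bar>"
proof -
  have cusp: "d x x' \<le> \<bar>T (\<rho> x) - \<tau>\<bar> + \<bar>T (\<rho> x') - \<tau>\<bar>" if x: "x \<in> X" "x' \<in> X" for x x'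
  proof -
    have "((\<lambda>r. \<bar>T (\<rho> x) - T r\<bar> + b r * dl (pr x) (pr x') + \<bar>T (\<rho> x') - T r\<bar>) \<longlongrightarrow>
        \<bar>T (\<rho> x) - \<tau>\<bar> + 0 * dl (pr x) (pr x') + \<bar>T (\<rho> x') - \<tau>\<bar>) F"
      by (intro tendsto_intros T b)
    moreover have "\<forall>\<^sub>F r in F. d x x' \<le> \<bar>T (\<rho> x) - T r\<bar> + b r * dl (pr x) (pr x') + \<bar>T (\<rho> x') - T r\<bar>"
      using F(2) by (rule eventually_mono) (rule dist_le[OF x])
    ultimately show ?thesis using tendsto_lowerbound[OF _ _ F(1)] by simp
  qed
  obtain y0 where y0: "y0 \<in> Y" using nonempty by blast
  have Ts: "(\<lambda>k. T (s k)) \<longlonglongrightarrow> \<tau>" by (rule filterlim_compose[OF T s(1)])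
  have sX: "sc (s k) y0 \<in> X" for k by (rule sc_in[OF y0 s(2)])
  have \<rho>s: "\<rho> (sc (s k) y0) = s k" for k by (rule \<rho>_sc[OF y0 s(2)])
  have sC: "(\<lambda>k. sc (s k) y0) \<in> Cauchy_seqs MX"
  proof (rule Cauchy_seqsI)
    fix e :: real assume "e > 0"
    then have "\<forall>\<^sub>F k in sequentially. dist (T (s k)) \<tau> < e / 2" by (intro tendstoD[OF Ts]) simp
    then obtain K where K: "\<And>k. k \<ge> K \<Longrightarrow> \<bar>T (s k) - \<tau>\<bar> < e / 2"
      by (auto simp: eventually_sequentially dist_real_def)
    have "d (sc (s i) y0) (sc (s j) y0) < e" if "i \<ge> K" "j \<ge> K" for i j
      using cusp[OF sX sX, of i j] K[OF that(1)] K[OF that(2)] by (simp add: \<rho>s)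
    then show "\<exists>K. \<forall>i\<ge>K. \<forall>j\<ge>K. mdist MX (sc (s i) y0) (sc (s j) y0) < e" by auto
  qed (use sX in simp)
  define S where "S = cauchy_class MX (\<lambda>k. sc (s k) y0)"
  have S: "S \<in> mspace Q" unfolding S_def by (rule cauchy_class_in[OF sC])
  have hS: "height S = \<tau>"
    using LIMSEQ_unique[OF height_tendsto[OF sC], of \<tau>] Ts by (simp add: S_def \<rho>s)
  have "mdist Q S A = \<bar>height A - \<tau>\<bar>" if A: "A \<in> mspace Q" for A
  proof (rule antisym)
    obtain z where z: "z \<in> Cauchy_seqs MX" "A = cauchy_class MX z" by (rule completion_pointE[OF A])
    show "mdist Q S A \<le> \<bar>height A - \<tau>\<bar>" unfolding S_def z(2)
    proof (rule completion_dist_le[OF sC z(1)])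
      have "(\<lambda>k. \<bar>T (s k) - \<tau>\<bar> + \<bar>T (\<rho> (z k)) - \<tau>\<bar>) \<longlonglongrightarrow> \<bar>\<tau> - \<tau>\<bar> + \<bar>height (cauchy_class MX z) - \<tau>\<bar>"
        by (intro tendsto_intros Ts height_tendsto z)
      then show "(\<lambda>k. \<bar>T (s k) - \<tau>\<bar> + \<bar>T (\<rho> (z k)) - \<tau>\<bar>) \<longlonglongrightarrow> \<bar>height (cauchy_class MX z) - \<tau>\<bar>" by simp
      show "mdist MX (sc (s k) y0) (z k) \<le> \<bar>T (s k) - \<tau>\<bar> + \<bar>T (\<rho> (z k)) - \<tau>\<bar>" for k
        using cusp[OF sX seq_in_X[OF z(1)]] by (simp add: \<rho>s)
    qed
    show "\<bar>height A - \<tau>\<bar> \<le> mdist Q S A" using height_lipschitz[OF S A] hS by (simp add: abs_minus_commute)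
  qed
  with S hS show thesis using that by blast
qed

lemma height_between:
  assumes "0 < r1" "T r1 < h" "h < T r2" "0 < r2"
  obtains r where "r1 < r" "r < r2" "T r = h"
proof -
  have "r1 < r2"
    using assms T_mono[of r2 r1] by (cases r1 r2 rule: linorder_cases) auto
  have "\<exists>r\<ge>r1. r \<le> r2 \<and> T r = h"
    by (rule IVT') (use assms \<open>r1 < r2\<close> in \<open>auto intro: continuous_on_subset[OF T_cont]\<close>)
  then obtain r where "r1 \<le> r" "r \<le> r2" "T r = h" by blast
  with assms show thesis by (intro that[of r]) (auto simp: less_le)
qed

lemma T_inf_less:
  assumes "(T \<longlongrightarrow> \<tau>) (at_right 0)" "r > 0"
  shows "\<tau> < T r"
proof -
  have "\<forall>\<^sub>F s in at_right 0. T s \<le> T (r / 2)"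
    unfolding eventually_at_right_field using assms(2) less_imp_le[OF T_mono[of _ "r / 2"]]
    by (intro exI[of _ "r / 2"]) auto
  from tendsto_upperbound[OF assms(1) this] have "\<tau> \<le> T (r / 2)" by simp
  also have "\<dots> < T r" using assms(2) by (intro T_mono) auto
  finally show ?thesis .
qed

lemma T_sup_greater:
  assumes "(T \<longlongrightarrow> \<tau>) at_top" "r > 0"
  shows "T r < \<tau>"
proof -
  have "\<forall>\<^sub>F s in at_top. T (2 * r) \<le> T s"
    using eventually_gt_at_top[of "2 * r"] by (rule eventually_mono) (use assms(2) less_imp_le[OF T_mono[of "2 * r"]] in auto)
  from tendsto_lowerbound[OF assms(1) this] have "T (2 * r) \<le> \<tau>" by simp
  moreover have "T r < T (2 * r)" using assms(2) by (intro T_mono) auto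
  ultimately show ?thesis by simp
qed

text \<open>A height between two values of the continuous function \<open>T\<close> is a value of \<open>T\<close>.\<close>

lemma height_cases:
  assumes "A \<in> mspace Q"
  obtains (finite) r \<eta> where "r > 0" "\<eta> \<in> mspace N" "A = pt r \<eta>"
    | (below) "\<And>r. r > 0 \<Longrightarrow> height A < T r"
    | (above) "\<And>r. r > 0 \<Longrightarrow> T r < height A"
proof (cases "\<exists>r>0. height A = T r")
  case True
  then obtain r where r: "r > 0" "height A = T r" by blast
  from point_at_finite_radius[OF assms r] obtain \<eta> where "\<eta> \<in> mspace N" "A = pt r \<eta>" .
  with r(1) show thesis by (rule finite)
next
  case False
  show thesis
  proof (cases "\<forall>r>0. height A < T r")
    case True
    then show thesis using below by blast
  next
    case ne: False
    then obtain r1 where r1: "r1 > 0" "T r1 < height A" using False by (metis linorder_neqE_linordered_idom)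
    have "T r < height A" if r: "r > 0" for r
    proof (rule ccontr)
      assume "\<not> T r < height A"
      then have "height A < T r" using False r by (metis linorder_neqE_linordered_idom)
      from height_between[OF r1 this r] obtain s where "r1 < s" "T s = height A" by metis
      then show False using False r1(1) by (metis less_trans)
    qed
    then show thesis by (rule above)
  qed
qed

lemma height_ge:
  assumes A: "A \<in> mspace Q" and "\<And>r. r > 0 \<Longrightarrow> \<tau> \<le> T r"
  shows "\<tau> \<le> height A"
proof -
  obtain z where z: "z \<in> Cauchy_seqs MX" "A = cauchy_class MX z" by (rule completion_pointE[OF A])
  show ?thesis unfolding z(2)
    by (rule LIMSEQ_le_const[OF height_tendsto[OF z(1)]]) (use assms(2) \<rho>_pos seq_in_X[OF z(1)] in blast)
qed

lemma height_le:
  assumes A: "A \<in> mspace Q" and "\<And>r. r > 0 \<Longrightarrow> T r \<le> \<tau>"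
  shows "height A \<le> \<tau>"
proof -
  obtain z where z: "z \<in> Cauchy_seqs MX" "A = cauchy_class MX z" by (rule completion_pointE[OF A])
  show ?thesis unfolding z(2)
    by (rule LIMSEQ_le_const2[OF height_tendsto[OF z(1)]]) (use assms(2) \<rho>_pos seq_in_X[OF z(1)] in blast)
qed

lemma mspace_N_nonempty: "mspace N \<noteq> {}"
proof -
  obtain y where y: "y \<in> Y" using nonempty by blast
  then have "(\<lambda>_. y) \<in> Cauchy_seqs MY" by (intro Cauchy_seqsI) auto
  then show ?thesis using cauchy_class_in by blast
qed

text \<open>Every end is either at infinite distance, or of finite radial length and collapsing. A point
  of the completion has a height, and by monotonicity of \<open>T\<close> the height is a value of \<open>T\<close> or the
  limit of \<open>T\<close> at an end. In the first case the point has a radius and a position in the completion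
  of \<open>Y\<close>; in the second case it is the point to which the end collapses, whose neighbourhoods are
  the sets of points of nearby height.\<close>

theorem homeomorphic_completion:
  assumes E: "{0<..<\<infinity>} \<subseteq> E" "E \<subseteq> {0..\<infinity>}"
    and zero: "(0 \<in> E \<and> (T \<longlongrightarrow> \<tau>0) (at_right 0) \<and> (b \<longlongrightarrow> 0) (at_right 0)) \<or>
      (0 \<notin> E \<and> filterlim T at_bot (at_right 0))"
    and infinity: "(\<infinity> \<in> E \<and> (T \<longlongrightarrow> \<tau>1) at_top \<and> (b \<longlongrightarrow> 0) at_top) \<or>
      (\<infinity> \<notin> E \<and> filterlim T at_top at_top)"
  shows "mtopology_of Q homeomorphic_space collapsed_topology E N"
proof -
  let ?NN = "mspace N"
  let ?C = "collapsed E ?NN"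
  let ?c = "\<lambda>r \<eta>. collapse ?NN (ereal r, \<eta>)"
  have "\<exists>S. 0 \<in> E \<longrightarrow> S \<in> mspace Q \<and> height S = \<tau>0 \<and> (\<forall>A\<in>mspace Q. mdist Q S A = \<bar>height A - \<tau>0\<bar>)"
  proof (cases "0 \<in> E")
    case True
    then have lim: "(T \<longlongrightarrow> \<tau>0) (at_right 0)" "(b \<longlongrightarrow> 0) (at_right 0)" using zero by auto
    have "filterlim (\<lambda>k. 1 / real (Suc k)) (at_right 0) sequentially"
      by (rule tendsto_imp_filterlim_at_right[OF LIMSEQ_Suc[OF lim_1_over_n]]) simp
    from collapsed_end[OF _ _ this _ lim] show ?thesis
      using eventually_at_right_less[of "0::real"] by (metis of_nat_0_less_iff trivial_limit_at_right_real zero_less_Suc zero_less_divide_1_iff)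
  qed simp
  then obtain S0 where S0: "0 \<in> E \<Longrightarrow> S0 \<in> mspace Q" "0 \<in> E \<Longrightarrow> height S0 = \<tau>0"
    "\<And>A. 0 \<in> E \<Longrightarrow> A \<in> mspace Q \<Longrightarrow> mdist Q S0 A = \<bar>height A - \<tau>0\<bar>" by blast
  have "\<exists>S. \<infinity> \<in> E \<longrightarrow> S \<in> mspace Q \<and> height S = \<tau>1 \<and> (\<forall>A\<in>mspace Q. mdist Q S A = \<bar>height A - \<tau>1\<bar>)"
  proof (cases "\<infinity> \<in> E")
    case True
    then have lim: "(T \<longlongrightarrow> \<tau>1) at_top" "(b \<longlongrightarrow> 0) at_top" using infinity by auto
    have "filterlim (\<lambda>k. real (Suc k)) at_top sequentially"
      using filterlim_real_sequentially filterlim_sequentially_Suc by blast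
    from collapsed_end[OF _ _ this _ lim] show ?thesis
      using eventually_gt_at_top[of "0::real"] by (metis of_nat_0_less_iff trivial_limit_at_top_linorder zero_less_Suc)
  qed simp
  then obtain S1 where S1: "\<infinity> \<in> E \<Longrightarrow> S1 \<in> mspace Q" "\<infinity> \<in> E \<Longrightarrow> height S1 = \<tau>1"
    "\<And>A. \<infinity> \<in> E \<Longrightarrow> A \<in> mspace Q \<Longrightarrow> mdist Q S1 A = \<bar>height A - \<tau>1\<bar>" by blast
  have \<tau>0: "\<tau>0 < T r" if "0 \<in> E" "r > 0" for r using zero T_inf_less that by blast
  have \<tau>1: "T r < \<tau>1" if "\<infinity> \<in> E" "r > 0" for r using infinity T_sup_greater that by blast
  have E_cases: "e = 0 \<or> e = \<infinity> \<or> (\<exists>r>0. e = ereal r)" if "e \<in> E" for e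
    using that E(2) by (cases e) (auto simp: zero_ereal_def less_eq_real_def)
  \<comment> \<open>The height as a function on \<open>E\<close>, and the point of the completion that belongs to a point of
    \<open>E \<times> N\<close>. At an added end the latter is independent of the second coordinate.\<close>
  define Th where "Th e = (if e = 0 then \<tau>0 else if e = \<infinity> then \<tau>1 else T (real_of_ereal e))" for e
  define P where "P e \<eta> = (if e = 0 then S0 else if e = \<infinity> then S1 else pt (real_of_ereal e) \<eta>)" for e \<eta>
  have Th_less: "Th e < Th e'" if e: "e \<in> E" "e' \<in> E" "e < e'" for e e'
    using E_cases[OF e(1)] E_cases[OF e(2)]
  proof (elim disjE exE conjE)
    fix r r' assume "r > 0" "e = ereal r" "r' > 0" "e' = ereal r'"
    then show ?thesis using e(3) T_mono by (simp add: Th_def)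
  next
    assume "e = 0" "e' = \<infinity>"
    then show ?thesis using e \<tau>0[of 1] \<tau>1[of 1] by (simp add: Th_def)
  qed (use e \<tau>0 \<tau>1 in \<open>auto simp: Th_def\<close>)
  have Th_less_iff: "Th e < Th e' \<longleftrightarrow> e < e'" if "e \<in> E" "e' \<in> E" for e e'
    using Th_less[of e e'] Th_less[of e' e] that by (cases e e' rule: linorder_cases) auto
  have P_in: "P e \<eta> \<in> mspace Q" and height_P: "height (P e \<eta>) = Th e" if "e \<in> E" "\<eta> \<in> ?NN" for e \<eta>
    using E_cases[OF that(1)] that S0(1,2) S1(1,2) pt_in height_pt by (auto simp: P_def Th_def)
  have points: "\<exists>e\<in>E. \<exists>\<eta>\<in>?NN. q = P e \<eta>" if q: "q \<in> mspace Q" for q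
    using q
  proof (cases rule: height_cases)
    case (finite r \<eta>)
    then have "ereal r \<in> E" "q = P (ereal r) \<eta>" using E(1) by (auto simp: P_def)
    with finite(2) show ?thesis by blast
  next
    case below
    have "\<not> filterlim T at_bot (at_right 0)"
    proof
      assume "filterlim T at_bot (at_right 0)"
      then have "\<forall>\<^sub>F r in at_right 0. T r < height q" by (simp add: filterlim_at_bot_dense)
      then have "\<forall>\<^sub>F r in at_right (0::real). False"
        using eventually_at_right_less[of "0::real"] by eventually_elim (use below in fastforce)
      then show False by simp
    qed
    with zero have 0: "0 \<in> E" and lim: "(T \<longlongrightarrow> \<tau>0) (at_right 0)" by auto
    have "height q \<le> \<tau>0"
    proof (rule tendsto_lowerbound[OF lim])
      show "\<forall>\<^sub>F r in at_right 0. height q \<le> T r"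
        using eventually_at_right_less[of "0::real"] by eventually_elim (use below less_imp_le in blast)
    qed simp
    moreover have "\<tau>0 \<le> height q" by (rule height_ge[OF q]) (use \<tau>0[OF 0] less_imp_le in blast)
    ultimately have "mdist Q S0 q = 0" using S0(3)[OF 0 q] by simp
    then have "q = P 0 \<eta>" for \<eta> using mdist_zero_iff[OF S0(1)[OF 0] q] by (simp add: P_def)
    then show ?thesis using 0 mspace_N_nonempty by blast
  next
    case above
    have "\<not> filterlim T at_top at_top"
    proof
      assume "filterlim T at_top at_top"
      then have "\<forall>\<^sub>F r in at_top. height q < T r" by (simp add: filterlim_at_top_dense)
      then have "\<forall>\<^sub>F r in at_top::real filter. False"
        using eventually_gt_at_top[of "0::real"] by eventually_elim (use above in fastforce)
      then show False by simp
    qed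
    with infinity have i: "\<infinity> \<in> E" and lim: "(T \<longlongrightarrow> \<tau>1) at_top" by auto
    have "\<tau>1 \<le> height q"
    proof (rule tendsto_upperbound[OF lim])
      show "\<forall>\<^sub>F r in at_top. T r \<le> height q"
        using eventually_gt_at_top[of "0::real"] by eventually_elim (use above less_imp_le in blast)
    qed simp
    moreover have "height q \<le> \<tau>1" by (rule height_le[OF q]) (use \<tau>1[OF i] less_imp_le in blast)
    ultimately have "mdist Q S1 q = 0" using S1(3)[OF i q] by simp
    then have "q = P \<infinity> \<eta>" for \<eta> using mdist_zero_iff[OF S1(1)[OF i] q] by (simp add: P_def)
    then show ?thesis using i mspace_N_nonempty by blast
  qed
  define \<Psi> where "\<Psi> c = (let p = SOME p. p \<in> c in P (fst p) (snd p))" for c :: "(ereal \<times> (nat \<Rightarrow> 'b) set) set"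
  have \<Psi>: "\<Psi> (collapse ?NN (e, \<eta>)) = P e \<eta>" if "\<eta> \<in> ?NN" for e \<eta>
  proof -
    let ?p = "SOME p. p \<in> collapse ?NN (e, \<eta>)"
    have "(e, \<eta>) \<in> collapse ?NN (e, \<eta>)" using that by (simp add: collapse_def)
    then have "?p \<in> collapse ?NN (e, \<eta>)" by (rule someI)
    then have "P (fst ?p) (snd ?p) = P e \<eta>" by (auto simp: collapse_def P_def split: if_splits)
    then show ?thesis by (simp add: \<Psi>_def Let_def)
  qed
  have pt_inj: "\<eta> = \<eta>'" if "r > 0" "\<eta> \<in> ?NN" "\<eta>' \<in> ?NN" "pt r \<eta> = pt r \<eta>'" for r \<eta> \<eta>'
  proof -
    have r12: "0 < r / 2" "r / 2 < 2 * r" using that by auto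
    obtain \<beta> where \<beta>: "\<beta> > 0" "\<And>s. s \<in> {r / 2..2 * r} \<Longrightarrow> \<beta> \<le> b s" using b_lower_bound[OF r12] by blast
    have "min (min (T r - T (r / 2)) (T (2 * r) - T r)) (\<beta> * mdist N \<eta> \<eta>') \<le> mdist Q (pt r \<eta>) (pt r \<eta>')"
      by (rule pt_dist_shell[OF that(2,3,1,1) r12 less_imp_le[OF \<beta>(1)] \<beta>(2)])
    moreover have "mdist Q (pt r \<eta>) (pt r \<eta>') = 0"
      unfolding that(4) by (rule mdist_self[OF pt_in[OF that(3,1)]])
    moreover have "T (r / 2) < T r" "T r < T (2 * r)" using that(1) by (auto intro!: T_mono)
    ultimately have "\<beta> * mdist N \<eta> \<eta>' \<le> 0" by linarith
    then have "mdist N \<eta> \<eta>' \<le> 0" using \<beta>(1) by (simp only: mult_le_0_iff) linarith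
    then have "mdist N \<eta> \<eta>' = 0" using Metric_space.nonneg[OF Metric_space_mspace_mdist] by (rule antisym)
    then show "\<eta> = \<eta>'" using mdist_zero_iff[OF that(2,3)] by blast
  qed
  have bij: "bij_betw \<Psi> ?C (mspace Q)"
  proof (rule bij_betw_imageI)
    show "inj_on \<Psi> ?C"
    proof (rule inj_onI)
      fix c c' assume "c \<in> ?C" "c' \<in> ?C" and eq: "\<Psi> c = \<Psi> c'"
      then obtain e \<eta> e' \<eta>' where c: "e \<in> E" "\<eta> \<in> ?NN" "c = collapse ?NN (e, \<eta>)"
        and c': "e' \<in> E" "\<eta>' \<in> ?NN" "c' = collapse ?NN (e', \<eta>')" by (auto simp: collapsed_def)
      have P: "P e \<eta> = P e' \<eta>'" using eq c c' \<Psi> by simp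
      then have "Th e = Th e'" using height_P[OF c(1,2)] height_P[OF c'(1,2)] by simp
      then have e: "e = e'" using Th_less[OF c(1) c'(1)] Th_less[OF c'(1) c(1)] by (metis less_irrefl linorder_less_linear)
      show "c = c'"
      proof (cases "e = 0 \<or> e = \<infinity>")
        case True
        then show ?thesis using c(3) c'(3) e by (auto simp: collapse_def)
      next
        case False
        then obtain r where "r > 0" "e = ereal r" using E_cases[OF c(1)] by blast
        then have "\<eta> = \<eta>'" using pt_inj[OF _ c(2) c'(2)] P e by (simp add: P_def)
        then show ?thesis using c(3) c'(3) e by simp
      qed
    qed
    show "\<Psi> ` ?C = mspace Q"
    proof
      show "\<Psi> ` ?C \<subseteq> mspace Q" using P_in by (auto simp: collapsed_def \<Psi>)
      show "mspace Q \<subseteq> \<Psi> ` ?C"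
      proof
        fix q assume "q \<in> mspace Q"
        then obtain e \<eta> where e: "e \<in> E" "\<eta> \<in> ?NN" "q = P e \<eta>" using points by blast
        then have "collapse ?NN (e, \<eta>) \<in> ?C" by (simp add: collapsed_def)
        then show "q \<in> \<Psi> ` ?C" using \<Psi>[OF e(2)] e(3) by (metis imageI)
      qed
    qed
  qed
  have real_E: "ereal r \<in> E" if "r > 0" for r using E(1) that by auto
  have Th_real: "Th (ereal r) = T r" and P_real: "P (ereal r) \<eta> = pt r \<eta>" if "r > 0" for r \<eta>
    using that by (simp_all add: Th_def P_def)
  have \<Psi>_end: "\<Psi> ({e} \<times> ?NN) = P e \<eta>" if "e = 0 \<or> e = \<infinity>" for e \<eta>
  proof -
    obtain \<eta>' where "\<eta>' \<in> ?NN" using mspace_N_nonempty by blast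
    from \<Psi>[OF this, of e] that show ?thesis by (auto simp: collapse_def P_def)
  qed
  have in_image: "q \<in> \<Psi> ` collapse ?NN ` (E' \<times> ?NN)" if q: "q \<in> mspace Q"
    and E': "\<And>e. e \<in> E \<Longrightarrow> height q = Th e \<Longrightarrow> e \<in> E'" for q E'
  proof -
    obtain e \<eta> where e: "e \<in> E" "\<eta> \<in> ?NN" "q = P e \<eta>" using points[OF q] by blast
    then have "(e, \<eta>) \<in> E' \<times> ?NN" using E'[OF e(1)] height_P[OF e(1,2)] e by simp
    then show ?thesis using \<Psi>[OF e(2)] e(3) by (metis imageI)
  qed
  show ?thesis
  proof (rule homeomorphic_collapsed[OF E(1) bij])
    fix c B assume c: "c \<in> ?C" and B: "basic_nhd E N c B"
    from B show "\<exists>\<epsilon>>0. \<forall>q\<in>mspace Q. mdist Q (\<Psi> c) q < \<epsilon> \<longrightarrow> q \<in> \<Psi> ` B"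
    proof cases
      case (ball r \<eta> \<epsilon>)
      note r = ball(3) and \<eta> = ball(4) and \<epsilon> = ball(5)
      \<comment> \<open>A shell around \<open>r\<close> of width at most \<open>\<epsilon> / 2\<close> on both sides, whose inner radius stays
        positive. Inside of it small distances bound the second coordinate, and points closer than
        \<open>\<delta>\<close> cannot leave it.\<close>
      define r1 where "r1 = max (r / 2) (r - \<epsilon> / 2)"
      define r2 where "r2 = r + \<epsilon> / 2"
      have r12: "0 < r1" "r1 < r" "r < r2" "r1 < r2" using r \<epsilon> by (auto simp: r1_def r2_def)
      obtain \<beta> where \<beta>: "\<beta> > 0" "\<And>s. s \<in> {r1..r2} \<Longrightarrow> \<beta> \<le> b s" using b_lower_bound[OF r12(1,4)] by blast
      define \<delta> where "\<delta> = min (min (T r - T r1) (T r2 - T r)) (\<beta> * (\<epsilon> / 2))"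
      have "\<delta> > 0" using T_mono[OF r12(1,2)] T_mono[OF r r12(3)] \<beta>(1) \<epsilon> by (simp add: \<delta>_def)
      moreover have "q \<in> \<Psi> ` B" if q: "q \<in> mspace Q" and lt: "mdist Q (\<Psi> c) q < \<delta>" for q
      proof -
        have lt': "mdist Q (pt r \<eta>) q < \<delta>" using lt \<Psi>[OF \<eta>] P_real[OF r] ball(1) by simp
        then have "\<bar>T r - height q\<bar> < \<delta>"
          using height_lipschitz[OF pt_in[OF \<eta> r] q] by (simp only: height_pt[OF \<eta> r])
        then have "T r1 < height q" "height q < T r2" unfolding \<delta>_def by linarith+
        from height_between[OF r12(1) this] r12 obtain r' where r': "r1 < r'" "r' < r2" "T r' = height q"
          by (metis less_trans)
        have r'0: "r' > 0" using r' r12 by simp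
        from point_at_finite_radius[OF q r'0 r'(3)[symmetric]] obtain \<eta>' where \<eta>': "\<eta>' \<in> ?NN" "q = pt r' \<eta>'" .
        have "min (min (T r - T r1) (T r2 - T r)) (\<beta> * mdist N \<eta> \<eta>') \<le> mdist Q (pt r \<eta>) (pt r' \<eta>')"
          by (rule pt_dist_shell[OF \<eta> \<eta>'(1) r r'0 r12(1,4) less_imp_le[OF \<beta>(1)] \<beta>(2)])
        then have "\<beta> * mdist N \<eta> \<eta>' < \<beta> * (\<epsilon> / 2)" using lt' unfolding \<delta>_def \<eta>'(2) min_less_iff_conj by linarith
        then have "mdist N \<eta> \<eta>' < \<epsilon> / 2" using \<beta>(1) mult_less_cancel_left_pos by blast
        moreover have "r - \<epsilon> / 2 < r'" "r' < r + \<epsilon> / 2" using r' unfolding r1_def r2_def by linarith+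
        then have "\<bar>r - r'\<bar> \<le> \<epsilon> / 2" by linarith
        moreover have "sqrt ((r - r')\<^sup>2 + (mdist N \<eta> \<eta>')\<^sup>2) \<le> \<bar>r - r'\<bar> + \<bar>mdist N \<eta> \<eta>'\<bar>"
          by (rule sqrt_sum_squares_le_sum_abs)
        moreover have "mdist N \<eta> \<eta>' \<ge> 0" by (rule Metric_space.nonneg[OF Metric_space_mspace_mdist])
        ultimately have "sqrt ((r - r')\<^sup>2 + (mdist N \<eta> \<eta>')\<^sup>2) < \<epsilon>" by linarith
        then have "(r', \<eta>') \<in> mball_of (prod_metric (submetric euclidean_metric {0<..}) N) (r, \<eta>) \<epsilon>"
          unfolding mem_prod_ball using r \<eta> r'0 \<eta>'(1) by simp
        then have "?c r' \<eta>' \<in> B" unfolding ball(2) by (rule rev_image_eqI) simp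
        then show ?thesis using \<Psi>[OF \<eta>'(1)] P_real[OF r'0] \<eta>'(2) by (metis imageI)
      qed
      ultimately show ?thesis by blast
    next
      case (zero \<epsilon>)
      have "T \<epsilon> - \<tau>0 > 0" using \<tau>0[OF zero(3,4)] by simp
      moreover have "q \<in> \<Psi> ` B" if q: "q \<in> mspace Q" and lt: "mdist Q (\<Psi> c) q < T \<epsilon> - \<tau>0" for q
        unfolding zero(2)
      proof (rule in_image[OF q])
        fix e assume e: "e \<in> E" "height q = Th e"
        have "\<Psi> c = S0" using \<Psi>_end[of 0] by (simp add: zero(1) P_def)
        then have "Th e < Th (ereal \<epsilon>)" using lt S0(3)[OF zero(3) q] e(2) Th_real[OF zero(4)] by simp
        then show "e \<in> {0..<ereal \<epsilon>}" using Th_less_iff[OF e(1) real_E[OF zero(4)]] e(1) E(2) by auto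
      qed
      ultimately show ?thesis by blast
    next
      case (infinity R)
      have "\<tau>1 - T R > 0" using \<tau>1[OF infinity(3,4)] by simp
      moreover have "q \<in> \<Psi> ` B" if q: "q \<in> mspace Q" and lt: "mdist Q (\<Psi> c) q < \<tau>1 - T R" for q
        unfolding infinity(2)
      proof (rule in_image[OF q])
        fix e assume e: "e \<in> E" "height q = Th e"
        have "\<Psi> c = S1" using \<Psi>_end[of \<infinity>] by (simp add: infinity(1) P_def)
        then have "Th (ereal R) < Th e" using lt S1(3)[OF infinity(3) q] e(2) Th_real[OF infinity(4)] by simp
        then show "e \<in> {ereal R<..\<infinity>}" using Th_less_iff[OF real_E[OF infinity(4)] e(1)] by simp
      qed
      ultimately show ?thesis by blast
    qed
  next
    fix c and \<epsilon> :: real assume c: "c \<in> ?C" and \<epsilon>: "\<epsilon> > 0"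
    from c E(2) show "\<exists>B. basic_nhd E N c B \<and> (\<forall>x\<in>B. mdist Q (\<Psi> c) (\<Psi> x) < \<epsilon>)"
    proof (cases rule: collapsed_cases)
      case (real r \<eta>)
      have "isCont T r" using T_cont real(1) by (simp add: continuous_on_eq_continuous_at)
      then obtain \<delta> where \<delta>: "\<delta> > 0" "\<And>r'. \<bar>r' - r\<bar> < \<delta> \<Longrightarrow> \<bar>T r' - T r\<bar> < \<epsilon> / 2"
        unfolding continuous_at_eps_delta dist_real_def using \<epsilon> by (metis half_gt_zero)
      define e where "e = min \<delta> (\<epsilon> / (2 * b r))"
      have e: "e > 0" using \<delta>(1) \<epsilon> b_pos[OF real(1)] by (simp add: e_def)
      show ?thesis
      proof (intro exI conjI ballI)
        show "basic_nhd E N c ((\<lambda>(s, z). collapse ?NN (ereal s, z)) `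
            mball_of (prod_metric (submetric euclidean_metric {0<..}) N) (r, \<eta>) e)"
          unfolding real(3) by (rule basic_nhd.ball[OF real(1,2) e])
        fix x assume "x \<in> (\<lambda>(s, z). collapse ?NN (ereal s, z)) `
            mball_of (prod_metric (submetric euclidean_metric {0<..}) N) (r, \<eta>) e"
        then obtain p where p: "p \<in> mball_of (prod_metric (submetric euclidean_metric {0<..}) N) (r, \<eta>) e"
          "x = ?c (fst p) (snd p)" by (auto simp del: in_mball_of)
        then have p': "fst p > 0" "snd p \<in> ?NN" "sqrt ((r - fst p)\<^sup>2 + (mdist N \<eta> (snd p))\<^sup>2) < e"
          unfolding mem_prod_ball by auto
        have "\<bar>r - fst p\<bar> < e" "\<bar>mdist N \<eta> (snd p)\<bar> < e"
          using p'(3) real_sqrt_ge_abs1[of "r - fst p" "mdist N \<eta> (snd p)"]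
            real_sqrt_ge_abs2[of "mdist N \<eta> (snd p)" "r - fst p"] by linarith+
        then have "\<bar>T (fst p) - T r\<bar> < \<epsilon> / 2" "mdist N \<eta> (snd p) < \<epsilon> / (2 * b r)"
          using \<delta>(2)[of "fst p"] by (auto simp: e_def abs_minus_commute)
        moreover from this(2) have "b r * mdist N \<eta> (snd p) < \<epsilon> / 2" using b_pos[OF real(1)] by (simp only: field_simps)
        ultimately have "mdist Q (pt r \<eta>) (pt (fst p) (snd p)) < \<epsilon>"
          using pt_dist_le[OF real(2) p'(2) real(1) p'(1)] by linarith
        then show "mdist Q (\<Psi> c) (\<Psi> x) < \<epsilon>"
          unfolding real(3) p(2) \<Psi>[OF real(2)] \<Psi>[OF p'(2)] P_real[OF real(1)] P_real[OF p'(1)] .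
      qed
    next
      case zero': zero
      then have lim: "(T \<longlongrightarrow> \<tau>0) (at_right 0)" using zero by auto
      have "\<forall>\<^sub>F r in at_right 0. dist (T r) \<tau>0 < \<epsilon>" by (rule tendstoD[OF lim \<epsilon>])
      then have "\<forall>\<^sub>F r in at_right 0. r > 0 \<and> dist (T r) \<tau>0 < \<epsilon>"
        using eventually_at_right_less[of "0::real"] by eventually_elim simp
      then obtain r where r: "r > 0" "dist (T r) \<tau>0 < \<epsilon>"
        using eventually_happens'[OF trivial_limit_at_right_real] by blast
      have B: "basic_nhd E N c (collapse ?NN ` ({0..<ereal r} \<times> ?NN))"
        unfolding zero'(2) by (rule basic_nhd.zero[OF zero'(1) r(1)])
      have "mdist Q (\<Psi> c) (\<Psi> x) < \<epsilon>" if x: "x \<in> collapse ?NN ` ({0..<ereal r} \<times> ?NN)" for x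
      proof -
        obtain e \<eta> where e: "0 \<le> e" "e < ereal r" "\<eta> \<in> ?NN" "x = collapse ?NN (e, \<eta>)" using x by auto
        have eE: "e \<in> E" using e zero'(1) E(1) by (cases "e = 0") (auto intro!: subsetD[OF E(1)] elim: less_trans)
        have "Th 0 \<le> Th e" using Th_less_iff[OF eE zero'(1)] e(1) by (simp add: leD not_less[symmetric])
        moreover have "Th e < Th (ereal r)" by (rule Th_less[OF eE real_E[OF r(1)] e(2)])
        ultimately have "\<bar>height (P e \<eta>) - \<tau>0\<bar> < \<epsilon>"
          using r by (simp add: height_P[OF eE e(3)] Th_real dist_real_def) (simp add: Th_def)
        moreover have "\<Psi> c = S0" using \<Psi>_end[of 0] by (simp add: zero'(2) P_def)
        ultimately show ?thesis using S0(3)[OF zero'(1) P_in[OF eE e(3)]] e(4) \<Psi>[OF e(3)] by simp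
      qed
      with B show ?thesis by blast
    next
      case inf': infinity
      then have lim: "(T \<longlongrightarrow> \<tau>1) at_top" using infinity by auto
      have "\<forall>\<^sub>F r in at_top. dist (T r) \<tau>1 < \<epsilon>" by (rule tendstoD[OF lim \<epsilon>])
      then have "\<forall>\<^sub>F r in at_top. r > 0 \<and> dist (T r) \<tau>1 < \<epsilon>"
        using eventually_gt_at_top[of "0::real"] by eventually_elim simp
      then obtain r where r: "r > 0" "dist (T r) \<tau>1 < \<epsilon>"
        using eventually_happens'[OF trivial_limit_at_top_linorder] by blast
      have B: "basic_nhd E N c (collapse ?NN ` ({ereal r<..\<infinity>} \<times> ?NN))"
        unfolding inf'(2) by (rule basic_nhd.infinity[OF inf'(1) r(1)])
      have "mdist Q (\<Psi> c) (\<Psi> x) < \<epsilon>" if x: "x \<in> collapse ?NN ` ({ereal r<..\<infinity>} \<times> ?NN)" for x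
      proof -
        obtain e \<eta> where e: "ereal r < e" "\<eta> \<in> ?NN" "x = collapse ?NN (e, \<eta>)" using x by auto
        have "0 < ereal r" using r(1) by simp
        then have "0 < e" using e(1) by (rule less_trans)
        then have eE: "e \<in> E" using inf'(1) E(1) by (cases "e = \<infinity>") auto
        have "Th e \<le> Th \<infinity>" using Th_less_iff[OF inf'(1) eE] by (simp add: not_less[symmetric])
        moreover have "Th (ereal r) < Th e" by (rule Th_less[OF real_E[OF r(1)] eE e(1)])
        ultimately have "\<bar>height (P e \<eta>) - \<tau>1\<bar> < \<epsilon>"
          using r by (simp add: height_P[OF eE e(2)] Th_real dist_real_def) (simp add: Th_def)
        moreover have "\<Psi> c = S1" using \<Psi>_end[of \<infinity>] by (simp add: inf'(2) P_def)
        ultimately show ?thesis using S1(3)[OF inf'(1) P_in[OF eE e(2)]] e(3) \<Psi>[OF e(2)] by simp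
      qed
      with B show ?thesis by blast
    qed
  qed
qed

end


section \<open>The radial arc length and its limits\<close>

lemma monotone_tendsto_at_right_0:
  fixes h :: "real \<Rightarrow> real"
  assumes mono: "\<And>r r'. 0 < r \<Longrightarrow> r < r' \<Longrightarrow> h r \<le> h r'"
  shows "((\<lambda>r. ereal (h r)) \<longlongrightarrow> (INF r\<in>{0<..}. ereal (h r))) (at_right 0)"
proof (rule order_tendstoI)
  fix e assume e: "e < (INF r\<in>{0<..}. ereal (h r))"
  have "e < ereal (h r)" if "r > 0" for r by (rule less_INF_D[OF e]) (use that in simp)
  then show "\<forall>\<^sub>F r in at_right 0. e < ereal (h r)"
    using eventually_at_right_less[of "0::real"] by (rule eventually_mono[rotated])
next
  fix e assume "(INF r\<in>{0<..}. ereal (h r)) < e"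
  then obtain r where r: "r > 0" "ereal (h r) < e" by (auto simp: INF_less_iff)
  have "ereal (h s) < e" if "0 < s" "s < r" for s
    using mono[OF that] r(2) by (meson ereal_less_eq(3) le_less_trans)
  then show "\<forall>\<^sub>F s in at_right 0. ereal (h s) < e"
    unfolding eventually_at_right_field using r(1) by blast
qed

lemma monotone_tendsto_at_top:
  fixes h :: "real \<Rightarrow> real"
  assumes mono: "\<And>r r'. 0 < r \<Longrightarrow> r < r' \<Longrightarrow> h r \<le> h r'"
  shows "((\<lambda>r. ereal (h r)) \<longlongrightarrow> (SUP r\<in>{0<..}. ereal (h r))) at_top"
proof (rule order_tendstoI)
  fix e assume e: "(SUP r\<in>{0<..}. ereal (h r)) < e"
  have "ereal (h r) < e" if "r > 0" for r by (rule SUP_lessD[OF e]) (use that in simp)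
  then show "\<forall>\<^sub>F r in at_top. ereal (h r) < e"
    using eventually_gt_at_top[of "0::real"] by (rule eventually_mono[rotated])
next
  fix e assume "e < (SUP r\<in>{0<..}. ereal (h r))"
  then obtain r where r: "r > 0" "e < ereal (h r)" by (auto simp: less_SUP_iff)
  have "e < ereal (h s)" if "r < s" for s
    using mono[OF r(1) that] r(2) by (meson ereal_less_eq(3) less_le_trans)
  then show "\<forall>\<^sub>F s in at_top. e < ereal (h s)"
    using eventually_gt_at_top[of r] by (rule eventually_mono[rotated])
qed

lemma That_derivative:
  assumes v: "continuous_on {0<..} v" and R0: "R0 > 0" and r: "r > 0"
  shows "(That v R0 has_real_derivative sqrt (v r / r)) (at r)"
proof -
  define s t where "s = min r R0 / 2" and "t = max r R0 + 1"
  have st: "0 < s" "s < r" "s \<le> R0" "r < t" "R0 \<le> t" using r R0 by (auto simp: s_def t_def)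
  have "continuous_on {s..t} (\<lambda>q. sqrt (v q / q))"
    by (intro continuous_intros continuous_on_subset[OF v]) (use st in auto)
  from interval_integral_FTC2[OF st(3,5) this, of r] st
  have "(That v R0 has_vector_derivative sqrt (v r / r)) (at r within {s..t})"
    by (simp add: That_def[abs_def])
  then show ?thesis
    using st by (simp add: at_within_Icc_at has_real_derivative_iff_has_vector_derivative)
qed

lemma That_mono:
  assumes v: "continuous_on {0<..} v" "\<And>r. r > 0 \<Longrightarrow> v r > 0" and R0: "R0 > 0" and r: "0 < r" "r < r'"
  shows "That v R0 r < That v R0 r'"
proof (rule DERIV_pos_imp_increasing[OF r(2)])
  fix x assume "r \<le> x"
  then have "x > 0" using r by simp
  then show "\<exists>y. (That v R0 has_real_derivative y) (at x) \<and> 0 < y"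
    using That_derivative[OF v(1) R0] v(2) by (intro exI[of _ "sqrt (v x / x)"]) simp
qed

text \<open>\<open>Lim\<close> is a description operator, so its value is the limit only once a limit is known to
  exist; it does because \<open>That\<close> is monotone.\<close>

lemma That_limits:
  assumes v: "continuous_on {0<..} v" "\<And>r. r > 0 \<Longrightarrow> v r > 0" and R0: "R0 > 0"
  shows "((\<lambda>r. ereal (That v R0 r)) \<longlongrightarrow> That_zero v R0) (at_right 0)"
    and "((\<lambda>r. ereal (That v R0 r)) \<longlongrightarrow> That_infinity v R0) at_top"
proof -
  have mono: "That v R0 r \<le> That v R0 r'" if "0 < r" "r < r'" for r r'
    using That_mono[OF v R0 that] by simp
  show "((\<lambda>r. ereal (That v R0 r)) \<longlongrightarrow> That_zero v R0) (at_right 0)"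
    using monotone_tendsto_at_right_0[of "That v R0", OF mono]
    unfolding That_zero_def by (metis tendsto_Lim trivial_limit_at_right_real)
  show "((\<lambda>r. ereal (That v R0 r)) \<longlongrightarrow> That_infinity v R0) at_top"
    using monotone_tendsto_at_top[of "That v R0", OF mono]
    unfolding That_infinity_def by (metis tendsto_Lim trivial_limit_at_top_linorder)
qed


section \<open>The completion of a conformal change of a homogeneous pair\<close>

theorem theorem3p23:
  fixes M :: "('a, 'e::euclidean_space) atlas_space"
    and m :: "real \<Rightarrow> 'a \<Rightarrow> 'a"
    and g :: "'a tensor2"
    and f :: "'a \<Rightarrow> real"
    and v :: "real \<Rightarrow> real"
    and \<alpha> l R0 :: real
  assumes "smooth_manifold M"
    and "free_smooth_action M m"
    and "\<alpha> \<noteq> 0"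
    and "homogeneous_pair M m g f \<alpha>"
    and "positive_definite M g"
    and "path_dist_is_metric M g"
    and "l > 0"
    and "smooth_on {0<..} v"
    and "\<And>r. r > 0 \<Longrightarrow> v r > 0"
    and "R0 > 0"
  shows "let Mbar = metric_completion (path_metric M (conformal v f g));
             Mlbar = metric_completion (path_metric (level_set M f l) (level_metric M g));
             T0 = That_zero v R0;
             Tinf = That_infinity v R0
         in (T0 = -\<infinity> \<and> Tinf = \<infinity> \<longrightarrow>
               mtopology_of Mbar homeomorphic_space
                 prod_topology (top_of_set {0::real<..}) (mtopology_of Mlbar)) \<and>
            (T0 \<in> range ereal \<and> Tinf = \<infinity> \<and> ((\<lambda>r. r * v r) \<longlongrightarrow> 0) (at_right 0) \<longrightarrow>
               mtopology_of Mbar homeomorphic_space topology_O0 Mlbar) \<and>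
            (T0 = -\<infinity> \<and> Tinf \<in> range ereal \<and> ((\<lambda>r. r * v r) \<longlongrightarrow> 0) at_top \<longrightarrow>
               mtopology_of Mbar homeomorphic_space topology_Oinf Mlbar) \<and>
            (T0 \<in> range ereal \<and> Tinf \<in> range ereal \<and>
             ((\<lambda>r. r * v r) \<longlongrightarrow> 0) (at_right 0) \<and> ((\<lambda>r. r * v r) \<longlongrightarrow> 0) at_top \<longrightarrow>
               mtopology_of Mbar homeomorphic_space topology_O0inf Mlbar)"
proof -
  have cv: "continuous_on {0<..} v" by (rule smooth_on_continuous_on[OF assms(8)])
  interpret H: homogeneous_riemannian M m g f \<alpha>
    by unfold_locales (use assms in auto)
  \<comment> \<open>The length of an orbit for \<open>(v \<circ> f) g\<close> between the radii \<open>R0\<close> and \<open>r\<close>, where \<open>\<alpha> > 0\<close> by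
    positivity of \<open>g\<close>.\<close>
  define T where "T r = That v R0 r / sqrt \<alpha>" for r
  have \<alpha>: "sqrt \<alpha> > 0" using H.\<alpha>_pos by simp
  interpret H: weighted_pair M m g f \<alpha> v T l
  proof
    show "H.weight v" using cv assms(9) by (simp add: H.weight_def)
    fix r :: real assume "r > 0"
    have "((\<lambda>r. That v R0 r / sqrt \<alpha>) has_real_derivative sqrt (v r / r) / sqrt \<alpha>) (at r)"
      by (rule DERIV_cdivide[OF That_derivative[OF cv assms(10) \<open>r > 0\<close>]])
    then show "(T has_real_derivative sqrt (v r / (\<alpha> * r))) (at r)"
      by (simp add: T_def[abs_def] real_sqrt_divide[symmetric] mult.commute)
  qed (use assms in auto)
  have levels: "H.level l \<noteq> {}"
  proof -
    obtain x where "x \<in> points M" using assms(1) unfolding smooth_manifold_def by blast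
    then show ?thesis using H.proj_level[OF assms(7)] by blast
  qed
  interpret W: warped_distance "points M" H.d "H.level l" H.dl f "H.proj l" "H.at_radius l" T H.warp
  proof (rule warped_distance.intro)
    show "continuous_on {0<..} T"
      by (rule DERIV_continuous_on[where D = "\<lambda>r. sqrt (v r / (\<alpha> * r))"])
         (rule has_field_derivative_at_within[OF H.T], simp)
    show "continuous_on {0<..} H.warp"
      unfolding H.warp_def by (intro continuous_intros cv) (use assms(7) in auto)
    show "H.warp r > 0" if "r > 0" for r using that assms(7,9) by (simp add: H.warp_def)
  qed (fact H.Metric_space_d H.Metric_space_level levels H.f_pos H.T_mono H.dist_radial H.dist_orbit H.dist_level
      H.proj_level[OF assms(7)] H.at_radius_points[OF assms(7)] H.f_at_radius[OF assms(7)] H.proj_at_radius[OF assms(7)]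
      H.at_radius_proj[OF assms(7)] H.dist_shell)+
  have Q: "path_metric M (conformal v f g) = metric (points M, H.d)"
    by (simp add: path_metric_def H.path_dist_conformal H.sdist_def[abs_def])
  have N: "path_metric (level_set M f l) (level_metric M g) = metric (H.level l, H.dl)"
    by (simp add: path_metric_def H.path_dist_level H.sdist_def[abs_def])
  note lim = That_limits[OF cv assms(9,10)]
  have T_lim: "(T \<longlongrightarrow> t / sqrt \<alpha>) F" if "((\<lambda>r. ereal (That v R0 r)) \<longlongrightarrow> ereal t) F" for t F
    unfolding T_def[abs_def] using that \<alpha> by (intro tendsto_divide tendsto_const) auto
  have T_bot: "filterlim T at_bot F" if "((\<lambda>r. ereal (That v R0 r)) \<longlongrightarrow> -\<infinity>) F" for F
    unfolding filterlim_at_bot_dense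
  proof
    fix Z :: real
    have "\<forall>\<^sub>F r in F. ereal (That v R0 r) < ereal (Z * sqrt \<alpha>)"
      by (rule order_tendstoD(2)[OF that]) simp
    then show "\<forall>\<^sub>F r in F. T r < Z"
      by (rule eventually_mono) (use \<alpha> in \<open>simp add: T_def field_simps\<close>)
  qed
  have T_top: "filterlim T at_top F" if "((\<lambda>r. ereal (That v R0 r)) \<longlongrightarrow> \<infinity>) F" for F
    unfolding filterlim_at_top_dense
  proof
    fix Z :: real
    have "\<forall>\<^sub>F r in F. ereal (Z * sqrt \<alpha>) < ereal (That v R0 r)"
      by (rule order_tendstoD(1)[OF that]) simp
    then show "\<forall>\<^sub>F r in F. Z < T r"
      by (rule eventually_mono) (use \<alpha> in \<open>simp add: T_def field_simps\<close>)
  qed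
  have b_lim: "(H.warp \<longlongrightarrow> 0) F" if "((\<lambda>r. r * v r) \<longlongrightarrow> 0) F" for F
  proof -
    have "((\<lambda>r. sqrt (r * v r / l)) \<longlongrightarrow> sqrt (0 / l)) F"
      by (intro tendsto_intros that) (use assms(7) in auto)
    then show ?thesis by (simp add: H.warp_def[abs_def] mult.commute)
  qed
  have main: "mtopology_of W.Q homeomorphic_space collapsed_topology E W.N"
    if E: "{0<..<\<infinity>} \<subseteq> E" "E \<subseteq> {0..\<infinity>}"
      and z: "(0 \<in> E \<and> That_zero v R0 \<in> range ereal \<and> ((\<lambda>r. r * v r) \<longlongrightarrow> 0) (at_right 0)) \<or>
        (0 \<notin> E \<and> That_zero v R0 = -\<infinity>)"
      and i: "(\<infinity> \<in> E \<and> That_infinity v R0 \<in> range ereal \<and> ((\<lambda>r. r * v r) \<longlongrightarrow> 0) at_top) \<or>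
        (\<infinity> \<notin> E \<and> That_infinity v R0 = \<infinity>)" for E
  proof -
    have z': "\<exists>\<tau>. (0 \<in> E \<and> (T \<longlongrightarrow> \<tau>) (at_right 0) \<and> (H.warp \<longlongrightarrow> 0) (at_right 0)) \<or>
        (0 \<notin> E \<and> filterlim T at_bot (at_right 0))"
      using z
    proof (elim disjE conjE rangeE)
      fix t assume "0 \<in> E" "That_zero v R0 = ereal t" "((\<lambda>r. r * v r) \<longlongrightarrow> 0) (at_right 0)"
      then show ?thesis using T_lim[of t] lim(1) b_lim by auto
    next
      assume "0 \<notin> E" "That_zero v R0 = -\<infinity>"
      then show ?thesis using T_bot lim(1) by auto
    qed
    have i': "\<exists>\<tau>. (\<infinity> \<in> E \<and> (T \<longlongrightarrow> \<tau>) at_top \<and> (H.warp \<longlongrightarrow> 0) at_top) \<or>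
        (\<infinity> \<notin> E \<and> filterlim T at_top at_top)"
      using i
    proof (elim disjE conjE rangeE)
      fix t assume "\<infinity> \<in> E" "That_infinity v R0 = ereal t" "((\<lambda>r. r * v r) \<longlongrightarrow> 0) at_top"
      then show ?thesis using T_lim[of t] lim(2) b_lim by auto
    next
      assume "\<infinity> \<notin> E" "That_infinity v R0 = \<infinity>"
      then show ?thesis using T_top lim(2) by auto
    qed
    from z' i' show ?thesis using W.homeomorphic_completion[OF E] by blast
  qed
  have 1: "mtopology_of W.Q homeomorphic_space prod_topology (top_of_set {0::real<..}) (mtopology_of W.N)"
    if "That_zero v R0 = -\<infinity>" "That_infinity v R0 = \<infinity>"
  proof -
    have "mtopology_of W.Q homeomorphic_space collapsed_topology {0<..<\<infinity>} W.N"
      by (rule main) (use that in auto)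
    then show ?thesis using homeomorphic_collapsed_product homeomorphic_space_trans by blast
  qed
  have 2: "mtopology_of W.Q homeomorphic_space topology_O0 W.N"
    if "That_zero v R0 \<in> range ereal" "That_infinity v R0 = \<infinity>" "((\<lambda>r. r * v r) \<longlongrightarrow> 0) (at_right 0)"
    unfolding topology_O0_def by (rule main) (use that in auto)
  have 3: "mtopology_of W.Q homeomorphic_space topology_Oinf W.N"
    if "That_zero v R0 = -\<infinity>" "That_infinity v R0 \<in> range ereal" "((\<lambda>r. r * v r) \<longlongrightarrow> 0) at_top"
    unfolding topology_Oinf_def by (rule main) (use that in auto)
  have 4: "mtopology_of W.Q homeomorphic_space topology_O0inf W.N"
    if "That_zero v R0 \<in> range ereal" "That_infinity v R0 \<in> range ereal"
      "((\<lambda>r. r * v r) \<longlongrightarrow> 0) (at_right 0)" "((\<lambda>r. r * v r) \<longlongrightarrow> 0) at_top"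
    unfolding topology_O0inf_def by (rule main) (use that in auto)
  show ?thesis unfolding Let_def Q N using 1 2 3 4 by blast
qed

end
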